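(* Let $\mathbb{K}$ be an algebraically closed field and let $q\in\mathbb{K}^*$ be a primitive $m$-th root of unity. Then each simple right $\mathcal{M}at_2(q)$-module that is both $\det_q$-torsionfree and $Z_{12}Z_{21}$-torsionfree is isomorphic to one of the following simple $\mathcal{M}at_2(q)$-modules: (1) $(\mathcal{N}_1,\alpha,\beta,\lambda_1,\lambda_2)$ for some $(\alpha,\beta,\lambda_1,\lambda_2)\in(\mathbb{K}^* )^4$; (2) $(\mathcal{N}_2,\beta,\gamma,\lambda_2)$ for some $(\beta,\lambda_2)\in(\mathbb{K}^* )^2$ and $\gamma\in\mathbb{K}$ (with some auxiliary integer $0\le r\le m-1$ entering its definition).
   Context: All modules are right modules. $\mathcal{M}at_2(q)$ is the associative unital $\mathbb{K}$-algebra generated by $Z_{11},Z_{12},Z_{21},Z_{22}$ with relations $Z_{12}Z_{11}=Z_{11}Z_{12}$, $Z_{21}Z_{11}=qZ_{11}Z_{21}$, $Z_{22}Z_{21}=Z_{21}Z_{22}$, $Z_{22}Z_{12}=qZ_{12}Z_{22}$, $Z_{21}Z_{12}=qZ_{12}Z_{21}$, $Z_{22}Z_{11}=Z_{11}Z_{22}+(q-1)Z_{12}Z_{21}$. Put $\det_q:=Z_{11}Z_{22}-Z_{12}Z_{21}$. The elements $\det_q$ and $Z_{12}Z_{21}$ are normal in $\mathcal{M}at_2(q)$. For a normal element $x$, a module $M$ is $x$-torsionfree if $m'x^i=0$ with $m'\in M$, $i\ge 0$ implies $m'=0$. The module $(\mathcal{N}_1,\alpha,\beta,\lambda_1,\lambda_2)$,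 with $\alpha,\beta,\lambda_1,\lambda_2\in\mathbb{K}^*$, has $\mathbb{K}$-basis $e(a,b)$, $0\le a,b\le m-1$, and action: $e(a,b)Z_{11}=q^{b}e(a+1,b)$ if $a<m-1$, and $=q^b\alpha\, e(0,b)$ if $a=m-1$; $e(a,b)Z_{12}=q^{b-a}\lambda_2e(a,b-1)$ if $b>0$, and $=\beta^{-1}\lambda_2q^{-a}e(a,m-1)$ if $b=0$; $e(a,b)Z_{21}=e(a,b+1)$ if $b<m-1$, and $=\beta e(a,0)$ if $b=m-1$; $e(a,b)Z_{22}=\left(\lambda_1+q\lambda_2-q(1-q^{-a})\lambda_2\right)e(a-1,b)$ if $a>0$, and $=\alpha^{-1}(\lambda_1+q\lambda_2)e(m-1,b)$ if $a=0$. The module $(\mathcal{N}_2,\beta,\gamma,\lambda_2)$, with $\beta,\lambda_2\in\mathbb{K}^*$, $\gamma\in\mathbb{K}$ and an integer $0\le r\le m-1$ (suppressed from the notation), has $\mathbb{K}$-basis $e(a,b)$, $0\le a,b\le m-1$, and action: $e(a,b)Z_{11}=q^{b}(q^{a}-1)q^{-r}\lambda_2\,e(a-1,b)$ if $a>0$, and $=0$ if $a=0$; $e(a,b)Z_{12}=q^{a+b}q^{-r}\lambda_2e(a,b-1)$ if $b>0$, and $=\beta^{-1}q^{a}q^{-r}\lambda_2e(a,m-1)$ if $b=0$; $e(a,b)Z_{21}=e(a,b+1)$ if $b\le m-2$, and $=\beta e(a,0)$ if $b=m-1$; $e(a,b)Z_{22}=e(a+1,b)$ if $a<m-1$, and $=\gamma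 e(0,b)$ if $a=m-1$. *)

theory Defs
  imports
    "HOL-Library.Poly_Mapping"
    "HOL-Algebra.Algebraic_Closure_Type"
    "HOL-Algebra.QuotRing"
    "HOL-Algebra.Module"
begin

definition primitive_root_of_unity :: "nat \<Rightarrow> 'k::field \<Rightarrow> bool" where
  "primitive_root_of_unity m q \<longleftrightarrow> m > 0 \<and> q ^ m = 1 \<and> (\<forall>k. 0 < k \<and> k < m \<longrightarrow> q ^ k \<noteq> 1)"

subsection \<open>Right modules over a ring\<close>

text \<open>
  The record of left modules is reused: the scalar multiplication \<open>r \<odot>\<^bsub>M\<^esub> x\<close> is to be read
  as the right action \<open>x r\<close>, so that \<open>x (r s) = (x r) s\<close>. Likewise the locale \<^locale>\<open>submodule\<close>,
  which does not refer to associativity of the action, describes the right submodules.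
  For an algebra over a field \<open>K\<close> the \<open>K\<close>-structure of a module is given by the elements
  \<open>c 1\<close> of the algebra, so submodules and module homomorphisms are automatically \<open>K\<close>-linear.
\<close>

locale right_module = R?: ring R + M?: abelian_group M
  for R :: "('a, 'c) ring_scheme" (structure) and M :: "('a, 'b, 'd) module_scheme" (structure) +
  assumes act_closed:
      "\<lbrakk>r \<in> carrier R; x \<in> carrier M\<rbrakk> \<Longrightarrow> r \<odot>\<^bsub>M\<^esub> x \<in> carrier M"
    and act_add_ring:
      "\<lbrakk>r \<in> carrier R; s \<in> carrier R; x \<in> carrier M\<rbrakk> \<Longrightarrow>
        (r \<oplus>\<^bsub>R\<^esub> s) \<odot>\<^bsub>M\<^esub> x = r \<odot>\<^bsub>M\<^esub> x \<oplus>\<^bsub>M\<^esub> s \<odot>\<^bsub>M\<^esub> x"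
    and act_add_module:
      "\<lbrakk>r \<in> carrier R; x \<in> carrier M; y \<in> carrier M\<rbrakk> \<Longrightarrow>
        r \<odot>\<^bsub>M\<^esub> (x \<oplus>\<^bsub>M\<^esub> y) = r \<odot>\<^bsub>M\<^esub> x \<oplus>\<^bsub>M\<^esub> r \<odot>\<^bsub>M\<^esub> y"
    and act_mult:
      "\<lbrakk>r \<in> carrier R; s \<in> carrier R; x \<in> carrier M\<rbrakk> \<Longrightarrow>
        (r \<otimes>\<^bsub>R\<^esub> s) \<odot>\<^bsub>M\<^esub> x = s \<odot>\<^bsub>M\<^esub> (r \<odot>\<^bsub>M\<^esub> x)"
    and act_one:
      "x \<in> carrier M \<Longrightarrow> \<one>\<^bsub>R\<^esub> \<odot>\<^bsub>M\<^esub> x = x"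

definition simple_right_module :: "('a, 'c) ring_scheme \<Rightarrow> ('a, 'b, 'd) module_scheme \<Rightarrow> bool" where
  "simple_right_module R M \<longleftrightarrow>
     right_module R M \<and> carrier M \<noteq> {\<zero>\<^bsub>M\<^esub>} \<and>
     (\<forall>H. submodule H R M \<longrightarrow> H = {\<zero>\<^bsub>M\<^esub>} \<or> H = carrier M)"

definition right_module_iso ::
    "('a, 'c) ring_scheme \<Rightarrow> ('a, 'b, 'd) module_scheme \<Rightarrow> ('a, 'e, 'f) module_scheme \<Rightarrow> bool" where
  "right_module_iso R M N \<longleftrightarrow>
     (\<exists>h. bij_betw h (carrier M) (carrier N) \<and>
          (\<forall>x\<in>carrier M. \<forall>y\<in>carrier M. h (x \<oplus>\<^bsub>M\<^esub> y) = h x \<oplus>\<^bsub>N\<^esub> h y) \<and>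
          (\<forall>r\<in>carrier R. \<forall>x\<in>carrier M. h (r \<odot>\<^bsub>M\<^esub> x) = r \<odot>\<^bsub>N\<^esub> h x))"

definition torsionfree :: "('a, 'c) ring_scheme \<Rightarrow> 'a \<Rightarrow> ('a, 'b, 'd) module_scheme \<Rightarrow> bool" where
  "torsionfree R x M \<longleftrightarrow>
     (\<forall>v\<in>carrier M. \<forall>i::nat. (x [^]\<^bsub>R\<^esub> i) \<odot>\<^bsub>M\<^esub> v = \<zero>\<^bsub>M\<^esub> \<longrightarrow> v = \<zero>\<^bsub>M\<^esub>)"

subsection \<open>The free algebra on four generators\<close>

datatype gen = Z11 | Z12 | Z21 | Z22

text \<open>
  The free monoid, written additively (without commutativity): then \<open>word \<Rightarrow>\<^sub>0 'k\<close>, with its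
  convolution product, is the monoid algebra of the free monoid, i.e. the free algebra.
\<close>

datatype word = Word (letters: "gen list")

instantiation word :: monoid_add
begin
definition zero_word :: word where "0 = Word []"
definition plus_word :: "word \<Rightarrow> word \<Rightarrow> word" where "u + w = Word (letters u @ letters w)"
instance by standard (simp_all add: zero_word_def plus_word_def)
end

type_synonym 'k free_alg = "word \<Rightarrow>\<^sub>0 'k"

definition fgen :: "gen \<Rightarrow> 'k::field free_alg" where
  "fgen g = Poly_Mapping.single (Word [g]) 1"

definition fscalar :: "'k::field \<Rightarrow> 'k free_alg" where
  "fscalar c = Poly_Mapping.single 0 c"

subsection \<open>The algebra of quantum matrices\<close>

definition mat2_relations :: "'k::field \<Rightarrow> 'k free_alg set" where
  "mat2_relations q =
    {fgen Z12 * fgen Z11 - fgen Z11 * fgen Z12,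
     fgen Z21 * fgen Z11 - fscalar q * (fgen Z11 * fgen Z21),
     fgen Z22 * fgen Z21 - fgen Z21 * fgen Z22,
     fgen Z22 * fgen Z12 - fscalar q * (fgen Z12 * fgen Z22),
     fgen Z21 * fgen Z12 - fscalar q * (fgen Z12 * fgen Z21),
     fgen Z22 * fgen Z11 - (fgen Z11 * fgen Z22 + fscalar (q - 1) * (fgen Z12 * fgen Z21))}"

definition mat2_ideal :: "'k::field \<Rightarrow> 'k free_alg set" where
  "mat2_ideal q = Idl\<^bsub>ring_of_type_algebra\<^esub> (mat2_relations q)"

definition Mat2 :: "'k::field \<Rightarrow> 'k free_alg set ring" where
  "Mat2 q = ring_of_type_algebra Quot (mat2_ideal q)"

definition Zgen :: "'k::field \<Rightarrow> gen \<Rightarrow> 'k free_alg set" where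
  "Zgen q g = mat2_ideal q +>\<^bsub>ring_of_type_algebra\<^esub> fgen g"

definition det_q :: "'k::field \<Rightarrow> 'k free_alg set" where
  "det_q q = (Zgen q Z11 \<otimes>\<^bsub>Mat2 q\<^esub> Zgen q Z22) \<ominus>\<^bsub>Mat2 q\<^esub> (Zgen q Z12 \<otimes>\<^bsub>Mat2 q\<^esub> Zgen q Z21)"

subsection \<open>Modules given by the action of the generators on a basis\<close>

text \<open>
  Vectors with basis \<open>e(a,b)\<close>, \<open>0 \<le> a, b \<le> m - 1\<close>, are functions on index pairs vanishing
  outside \<open>basis_index m\<close>; \<open>evec c (a,b)\<close> is \<open>c e(a,b)\<close>.
\<close>

type_synonym 'k vec = "nat \<times> nat \<Rightarrow> 'k"

definition basis_index :: "nat \<Rightarrow> (nat \<times> nat) set" where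
  "basis_index m = {..<m} \<times> {..<m}"

definition evec :: "'k::field \<Rightarrow> nat \<times> nat \<Rightarrow> 'k vec" where
  "evec c s = (\<lambda>p. if p = s then c else 0)"

definition lin_ext :: "nat \<Rightarrow> (nat \<times> nat \<Rightarrow> 'k::field vec) \<Rightarrow> 'k vec \<Rightarrow> 'k vec" where
  "lin_ext m f v = (\<lambda>p. \<Sum>s\<in>basis_index m. v s * f s p)"

text \<open>
  \<open>T g (a,b)\<close> is the image of \<open>e(a,b)\<close> under the generator \<open>g\<close>. Since the action is on the right,
  the leftmost letter of a word acts first.
\<close>

definition word_act :: "nat \<Rightarrow> (gen \<Rightarrow> nat \<times> nat \<Rightarrow> 'k::field vec) \<Rightarrow> 'k vec \<Rightarrow> word \<Rightarrow> 'k vec" where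
  "word_act m T v w = foldl (\<lambda>u g. lin_ext m (T g) u) v (letters w)"

definition free_act :: "nat \<Rightarrow> (gen \<Rightarrow> nat \<times> nat \<Rightarrow> 'k::field vec) \<Rightarrow> 'k vec \<Rightarrow> 'k free_alg \<Rightarrow> 'k vec" where
  "free_act m T v f = (\<lambda>p. \<Sum>w\<in>Poly_Mapping.keys f. Poly_Mapping.lookup f w * word_act m T v w p)"

text \<open>
  An element of the quotient algebra is a coset \<open>C\<close>; it acts as the common action of its
  representatives. This is meaningful when \<open>T\<close> satisfies the defining relations, see
  \<open>gen_module_smult_Zgen\<close> below.
\<close>

definition gen_module ::
    "nat \<Rightarrow> (gen \<Rightarrow> nat \<times> nat \<Rightarrow> 'k::field vec) \<Rightarrow> ('k free_alg set, 'k vec) module" where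
  "gen_module m T =
    \<lparr>carrier = {v. \<forall>p. p \<notin> basis_index m \<longrightarrow> v p = 0},
     monoid.mult = undefined, one = undefined,
     zero = (\<lambda>p. 0), add = (\<lambda>u v p. u p + v p),
     module.smult = (\<lambda>C v. the_elem (free_act m T v ` C))\<rparr>"

text \<open>The parameters \<open>\<lambda>\<^sub>1, \<lambda>\<^sub>2\<close> are called \<open>l\<^sub>1, l\<^sub>2\<close>, as \<open>\<lambda>\<close> is not available as a name.\<close>

fun N1_gen :: "nat \<Rightarrow> 'k::field \<Rightarrow> 'k \<Rightarrow> 'k \<Rightarrow> 'k \<Rightarrow> 'k \<Rightarrow> gen \<Rightarrow> nat \<times> nat \<Rightarrow> 'k vec" where
  "N1_gen m q \<alpha> \<beta> l\<^sub>1 l\<^sub>2 Z11 (a, b) =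
     (if a < m - 1 then evec (q ^ b) (a + 1, b) else evec (q ^ b * \<alpha>) (0, b))"
| "N1_gen m q \<alpha> \<beta> l\<^sub>1 l\<^sub>2 Z12 (a, b) =
     (if b > 0 then evec (q powi (int b - int a) * l\<^sub>2) (a, b - 1)
      else evec (inverse \<beta> * l\<^sub>2 * q powi (- int a)) (a, m - 1))"
| "N1_gen m q \<alpha> \<beta> l\<^sub>1 l\<^sub>2 Z21 (a, b) =
     (if b < m - 1 then evec 1 (a, b + 1) else evec \<beta> (a, 0))"
| "N1_gen m q \<alpha> \<beta> l\<^sub>1 l\<^sub>2 Z22 (a, b) =
     (if a > 0 then evec (l\<^sub>1 + q * l\<^sub>2 - q * (1 - q powi (- int a)) * l\<^sub>2) (a - 1, b)
      else evec (inverse \<alpha> * (l\<^sub>1 + q * l\<^sub>2)) (m - 1, b))"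

definition N1 :: "nat \<Rightarrow> 'k::field \<Rightarrow> 'k \<Rightarrow> 'k \<Rightarrow> 'k \<Rightarrow> 'k \<Rightarrow> ('k free_alg set, 'k vec) module" where
  "N1 m q \<alpha> \<beta> l\<^sub>1 l\<^sub>2 = gen_module m (N1_gen m q \<alpha> \<beta> l\<^sub>1 l\<^sub>2)"

fun N2_gen :: "nat \<Rightarrow> 'k::field \<Rightarrow> nat \<Rightarrow> 'k \<Rightarrow> 'k \<Rightarrow> 'k \<Rightarrow> gen \<Rightarrow> nat \<times> nat \<Rightarrow> 'k vec" where
  "N2_gen m q r \<beta> \<gamma> l\<^sub>2 Z11 (a, b) =
     (if a > 0 then evec (q ^ b * (q ^ a - 1) * q powi (- int r) * l\<^sub>2) (a - 1, b)
      else (\<lambda>p. 0))"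
| "N2_gen m q r \<beta> \<gamma> l\<^sub>2 Z12 (a, b) =
     (if b > 0 then evec (q ^ (a + b) * q powi (- int r) * l\<^sub>2) (a, b - 1)
      else evec (inverse \<beta> * q ^ a * q powi (- int r) * l\<^sub>2) (a, m - 1))"
| "N2_gen m q r \<beta> \<gamma> l\<^sub>2 Z21 (a, b) =
     (if b < m - 1 then evec 1 (a, b + 1) else evec \<beta> (a, 0))"
| "N2_gen m q r \<beta> \<gamma> l\<^sub>2 Z22 (a, b) =
     (if a < m - 1 then evec 1 (a + 1, b) else evec \<gamma> (0, b))"

definition N2 :: "nat \<Rightarrow> 'k::field \<Rightarrow> nat \<Rightarrow> 'k \<Rightarrow> 'k \<Rightarrow> 'k \<Rightarrow> ('k free_alg set, 'k vec) module" where
  "N2 m q r \<beta> \<gamma> l\<^sub>2 = gen_module m (N2_gen m q r \<beta> \<gamma> l\<^sub>2)"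

subsection \<open>The action is well defined\<close>

lemma lin_ext_evec: "s \<in> basis_index m \<Longrightarrow> lin_ext m f (evec c s) = (\<lambda>p. c * f s p)"
  by (rule ext) (simp add: lin_ext_def evec_def basis_index_def if_distrib[of "\<lambda>x. x * _"] cong: if_cong)

lemma lin_ext_zero: "lin_ext m f (\<lambda>p. 0) = (\<lambda>p. 0)"
  by (simp add: lin_ext_def)

lemma lin_ext_scale: "lin_ext m f (\<lambda>p. c * v p) = (\<lambda>p. c * lin_ext m f v p)"
  by (simp add: lin_ext_def sum_distrib_left mult.assoc)

lemma lin_ext_sum: "lin_ext m f (\<lambda>p. \<Sum>i\<in>A. u i p) = (\<lambda>p. \<Sum>i\<in>A. lin_ext m f (u i) p)"
  by (rule ext) (simp add: lin_ext_def sum_distrib_right sum.swap[of _ A])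

lemma word_act_scale: "word_act m T (\<lambda>p. c * v p) w = (\<lambda>p. c * word_act m T v w p)"
proof -
  have "foldl (\<lambda>u g. lin_ext m (T g) u) (\<lambda>p. c * v p) xs
      = (\<lambda>p. c * foldl (\<lambda>u g. lin_ext m (T g) u) v xs p)" for xs
    by (induction xs arbitrary: v) (simp_all add: lin_ext_scale)
  then show ?thesis by (simp add: word_act_def)
qed

lemma word_act_sum: "word_act m T (\<lambda>p. \<Sum>i\<in>A. u i p) w = (\<lambda>p. \<Sum>i\<in>A. word_act m T (u i) w p)"
proof -
  have "foldl (\<lambda>u g. lin_ext m (T g) u) (\<lambda>p. \<Sum>i\<in>A. u i p) xs
      = (\<lambda>p. \<Sum>i\<in>A. foldl (\<lambda>u g. lin_ext m (T g) u) (u i) xs p)" for xs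
    by (induction xs arbitrary: u) (simp_all add: lin_ext_sum)
  then show ?thesis by (simp add: word_act_def)
qed

lemma word_act_plus: "word_act m T v (u + w) = word_act m T (word_act m T v u) w"
  by (simp add: word_act_def plus_word_def)

lemma free_act_superset:
  assumes "finite S" "Poly_Mapping.keys f \<subseteq> S"
  shows "free_act m T v f = (\<lambda>p. \<Sum>w\<in>S. Poly_Mapping.lookup f w * word_act m T v w p)"
  unfolding free_act_def using assms
  by (intro ext sum.mono_neutral_left) (auto simp: in_keys_iff)

lemma free_act_single: "free_act m T v (Poly_Mapping.single w c) = (\<lambda>p. c * word_act m T v w p)"
  by (subst free_act_superset[of "{w}"]) auto

lemma free_act_add: "free_act m T v (f + g) = (\<lambda>p. free_act m T v f p + free_act m T v g p)"
proof -
  let ?S = "Poly_Mapping.keys f \<union> Poly_Mapping.keys g"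
  have "Poly_Mapping.keys (f + g) \<subseteq> ?S" by (rule Poly_Mapping.keys_add)
  then show ?thesis
    by (subst (1 2 3) free_act_superset[of ?S])
      (auto simp: lookup_add algebra_simps sum.distrib)
qed

lemma free_act_uminus: "free_act m T v (- f) = (\<lambda>p. - free_act m T v f p)"
  by (simp add: free_act_def sum_negf)

lemma free_act_diff: "free_act m T v (f - g) = (\<lambda>p. free_act m T v f p - free_act m T v g p)"
  using free_act_add[of m T v f "- g"] by (simp add: free_act_uminus)

lemma free_act_zero: "free_act m T v 0 = (\<lambda>p. 0)"
  by (simp add: free_act_def)

lemma free_act_scale: "free_act m T (\<lambda>p. c * v p) f = (\<lambda>p. c * free_act m T v f p)"
  by (simp add: free_act_def word_act_scale sum_distrib_left mult.left_commute)

lemma free_act_sum: "free_act m T (\<lambda>p. \<Sum>i\<in>A. u i p) f = (\<lambda>p. \<Sum>i\<in>A. free_act m T (u i) f p)"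
  by (rule ext) (simp add: free_act_def word_act_sum sum_distrib_left sum.swap[of _ A])

lemma free_alg_induct [case_names single add]:
  fixes f :: "'k::field free_alg"
  assumes "\<And>w c. P (Poly_Mapping.single w c)" "\<And>f g. P f \<Longrightarrow> P g \<Longrightarrow> P (f + g)"
  shows "P f"
proof (induction f rule: Poly_Mapping.update_induct)
  case const show ?case using assms(1)[of 0 0] by simp
next
  case (update f w c)
  have "Poly_Mapping.update w c f = Poly_Mapping.single w c + f"
    using update(1)
    by (intro poly_mapping_eqI) (auto simp: lookup_update lookup_add lookup_single in_keys_iff when_def)
  then show ?case using assms(2)[OF assms(1) update(3)] by simp
qed

lemma free_act_mult: "free_act m T v (f * g) = free_act m T (free_act m T v f) g"
proof (induction f arbitrary: v rule: free_alg_induct)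
  case (single w c)
  show ?case
  proof (induction g rule: free_alg_induct)
    case (single w' c')
    show ?case
      by (simp add: mult_single free_act_single word_act_plus word_act_scale mult_ac)
  next
    case (add f g) then show ?case by (simp add: distrib_left free_act_add)
  qed
next
  case (add f f')
  have "free_act m T (\<lambda>p. x p + y p) g = (\<lambda>p. free_act m T x g p + free_act m T y g p)" for x y
    using free_act_sum[of m T "\<lambda>i. if i then x else y" UNIV g]
    by (simp add: UNIV_bool add.commute)
  then show ?case using add by (simp add: distrib_right free_act_add)
qed

definition satisfies_relations :: "'k::field \<Rightarrow> nat \<Rightarrow> (gen \<Rightarrow> nat \<times> nat \<Rightarrow> 'k vec) \<Rightarrow> bool" where
  "satisfies_relations q m T \<longleftrightarrow>
     (\<forall>g. \<forall>s\<in>basis_index m. \<forall>p. p \<notin> basis_index m \<longrightarrow> T g s p = 0) \<and>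
     (\<forall>f\<in>mat2_relations q. \<forall>s\<in>basis_index m. free_act m T (evec 1 s) f = (\<lambda>p. 0))"

abbreviation (input) FR :: "'k::field free_alg ring" where
  "FR \<equiv> ring_of_type_algebra"

lemma FR_simps:
  "carrier FR = UNIV" "x \<otimes>\<^bsub>FR\<^esub> y = x * y" "x \<oplus>\<^bsub>FR\<^esub> y = x + y" "\<zero>\<^bsub>FR\<^esub> = 0" "\<one>\<^bsub>FR\<^esub> = 1"
  by (simp_all add: ring_of_type_algebra_def)

lemma FR_ring: "ring (FR :: 'k::field free_alg ring)"
proof -
  have "\<exists>y. x + y = 0" for x :: "'k free_alg"
    using add.right_inverse by blast
  then show ?thesis
    unfolding ring_of_type_algebra_def using add.right_inverse
    by unfold_locales (auto simp: algebra_simps Units_def)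
qed

lemma vec_expand:
  fixes v :: "'k::field vec"
  assumes "\<And>p. p \<notin> basis_index m \<Longrightarrow> v p = 0"
  shows "v = (\<lambda>p. \<Sum>s\<in>basis_index m. v s * evec 1 s p)"
proof
  fix p
  have "finite (basis_index m)" by (simp add: basis_index_def)
  then show "v p = (\<Sum>s\<in>basis_index m. v s * evec 1 s p)"
    using assms[of p] by (simp add: evec_def if_distrib[of "\<lambda>x. _ * x"] cong: if_cong)
qed

lemma lin_ext_closed:
  assumes "\<And>s p. s \<in> basis_index m \<Longrightarrow> p \<notin> basis_index m \<Longrightarrow> f s p = 0" "p \<notin> basis_index m"
  shows "lin_ext m f v p = 0"
  using assms by (simp add: lin_ext_def)

lemma free_act_closed:
  assumes T: "\<And>g s p. s \<in> basis_index m \<Longrightarrow> p \<notin> basis_index m \<Longrightarrow> T g s p = 0"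
    and v: "\<And>p. p \<notin> basis_index m \<Longrightarrow> v p = 0" and p: "p \<notin> basis_index m"
  shows "free_act m T v f p = 0"
proof -
  have "foldl (\<lambda>u g. lin_ext m (T g) u) v xs p = 0" for xs
    by (induction xs rule: rev_induct) (use v p in \<open>auto intro: lin_ext_closed T\<close>)
  then show ?thesis by (simp add: free_act_def word_act_def)
qed

lemma free_act_ideal:
  assumes T: "satisfies_relations q m T" and f: "f \<in> mat2_ideal q"
    and v: "\<And>p. p \<notin> basis_index m \<Longrightarrow> v p = 0"
  shows "free_act m T v f = (\<lambda>p. 0)"
proof -
  define V where "V = {v :: 'a vec. \<forall>p. p \<notin> basis_index m \<longrightarrow> v p = 0}"
  define J where "J = {f. \<forall>v\<in>V. free_act m T v f = (\<lambda>p. 0)}"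
  interpret FR: ring "FR :: 'a free_alg ring" by (rule FR_ring)
  have closed: "free_act m T v f \<in> V" if "v \<in> V" for v f
    using that T free_act_closed[of m T v] by (auto simp: V_def satisfies_relations_def)
  have zero: "free_act m T (\<lambda>p. 0) f = (\<lambda>p. 0)" for f
    using free_act_scale[of m T 0 "\<lambda>p. 0" f] by simp
  have "ideal J FR"
  proof (rule idealI)
    show "subgroup J (add_monoid FR)"
    proof (rule FR.add.subgroupI)
      fix f assume f: "f \<in> J"
      have "\<ominus>\<^bsub>FR\<^esub> f = - f"
        using FR.add.inv_equality[of "- f" f] by (simp add: FR_simps a_inv_def)
      then show "\<ominus>\<^bsub>FR\<^esub> f \<in> J" using f by (simp add: J_def free_act_uminus)
    next
      have "0 \<in> J" by (simp add: J_def free_act_zero)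
      then show "J \<noteq> {}" by blast
    qed (auto simp: J_def FR_simps free_act_add)
  qed (auto simp: J_def FR_simps free_act_mult zero closed FR_ring)
  moreover have "mat2_relations q \<subseteq> J"
  proof
    fix f assume "f \<in> mat2_relations q"
    then have *: "free_act m T (evec 1 s) f = (\<lambda>p. 0)" if "s \<in> basis_index m" for s
      using that T by (simp add: satisfies_relations_def)
    show "f \<in> J" unfolding J_def
    proof (intro CollectI ballI)
      fix v assume "v \<in> V"
      then have "v = (\<lambda>p. \<Sum>s\<in>basis_index m. v s * evec 1 s p)"
        unfolding V_def by (blast intro: vec_expand)
      then have "free_act m T v f = free_act m T (\<lambda>p. \<Sum>s\<in>basis_index m. v s * evec 1 s p) f"
        by (rule arg_cong)
      also have "\<dots> = (\<lambda>p. 0)"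
        by (subst free_act_sum) (simp add: free_act_scale *)
      finally show "free_act m T v f = (\<lambda>p. 0)" .
    qed
  qed
  ultimately have "mat2_ideal q \<subseteq> J"
    unfolding mat2_ideal_def genideal_def by blast
  with f v show ?thesis unfolding J_def V_def by blast
qed

lemma gen_module_smult_coset:
  assumes T: "satisfies_relations q m T" and v: "v \<in> carrier (gen_module m T)"
  shows "(mat2_ideal q +>\<^bsub>FR\<^esub> f) \<odot>\<^bsub>gen_module m T\<^esub> v = free_act m T v f"
proof -
  interpret FR: ring "FR :: 'a free_alg ring" by (rule FR_ring)
  have "ideal (mat2_ideal q) FR"
    unfolding mat2_ideal_def by (rule FR.genideal_ideal) (simp add: FR_simps)
  then have "0 \<in> mat2_ideal q"
    using additive_subgroup.zero_closed[OF ideal.axioms(1)] by (fastforce simp: FR_simps)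
  then have "free_act m T v ` (mat2_ideal q +>\<^bsub>FR\<^esub> f) = {free_act m T v f}"
    using v free_act_ideal[OF T]
    by (auto simp: a_r_coset_def' FR_simps free_act_add gen_module_def image_iff)
  then show ?thesis by (simp add: gen_module_def)
qed

lemma gen_module_smult_Zgen:
  assumes T: "satisfies_relations q m T" and s: "s \<in> basis_index m"
  shows "Zgen q g \<odot>\<^bsub>gen_module m T\<^esub> evec 1 s = T g s"
proof -
  have "evec 1 s \<in> carrier (gen_module m T)"
    using s by (auto simp: gen_module_def evec_def)
  from gen_module_smult_coset[OF T this, of "fgen g"] show ?thesis
    by (simp add: Zgen_def fgen_def free_act_single word_act_def lin_ext_evec[OF s])
qed

lemma free_act_fgen: "free_act m T v (fgen g) = lin_ext m (T g) v"
  by (simp add: fgen_def free_act_single word_act_def)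

lemma free_act_fscalar: "free_act m T v (fscalar c) = (\<lambda>p. c * v p)"
  by (simp add: fscalar_def free_act_single word_act_def zero_word_def)


lemma evec_scale: "(\<lambda>p. c * evec d s p) = evec (c * d) s"
  by (simp add: evec_def fun_eq_iff)

lemma evec_uminus: "(\<lambda>p. - evec c s p) = evec (- c) s"
  by (simp add: evec_def fun_eq_iff)

lemma evec_diff: "(\<lambda>p. evec c s p - evec d s p) = evec (c - d) s"
  by (simp add: evec_def fun_eq_iff)

lemma evec_add: "(\<lambda>p. evec c s p + evec d s p) = evec (c + d) s"
  by (simp add: evec_def fun_eq_iff)

lemma evec_eq_0: "evec c s = (\<lambda>p. 0) \<longleftrightarrow> c = 0"
proof
  assume "evec c s = (\<lambda>p. 0)"
  then show "c = 0" by (auto simp: evec_def dest: fun_cong[of _ _ s])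
qed (simp add: evec_def)

lemma N1_satisfies_relations:
  assumes m: "m > 0" and q: "q ^ m = 1" and nz: "\<alpha> \<noteq> 0" "\<beta> \<noteq> 0"
  shows "satisfies_relations q m (N1_gen m q \<alpha> \<beta> l\<^sub>1 l\<^sub>2)"
proof -
  obtain n where n: "m = Suc n" using m by (cases m) auto
  have q0: "q \<noteq> 0" using m q by (auto simp: power_0_left)
  have q1: "q ^ n = inverse q" using q q0 by (simp add: n field_simps)
  have supp: "N1_gen m q \<alpha> \<beta> l\<^sub>1 l\<^sub>2 g s p = 0" if "s \<in> basis_index m" "p \<notin> basis_index m" for g s p
    using that m by (cases g; cases s) (auto simp: basis_index_def evec_def)
  have "free_act m (N1_gen m q \<alpha> \<beta> l\<^sub>1 l\<^sub>2) (evec 1 s) f = (\<lambda>p. 0)"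
    if f: "f \<in> mat2_relations q" and s: "s \<in> basis_index m" for f s
  proof -
    obtain a b where ab: "s = (a, b)" "a \<le> n" "b \<le> n" using s by (cases s) (auto simp: basis_index_def n)
    have [simp]: "x < k \<Longrightarrow> y < k \<Longrightarrow> (x, y) \<in> basis_index k" for x y k by (simp add: basis_index_def)
    have [simp]: "a < Suc n" "b < Suc n" "a < n \<longleftrightarrow> a \<noteq> n" "b < n \<longleftrightarrow> b \<noteq> n" using ab by auto
    have [simp]: "n = 0 \<Longrightarrow> q = 1" "n = 0 \<Longrightarrow> a = 0" "n = 0 \<Longrightarrow> b = 0"
      "a - j < Suc n" "b - j < Suc n" "n - j < Suc n"
      "0 < a \<Longrightarrow> a - Suc 0 < n" "0 < b \<Longrightarrow> b - Suc 0 < n" for j using ab q by (auto simp: n)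
    note [simp] = q0 q1 nz power_diff of_nat_diff Suc_le_eq power_int_add evec_diff evec_add evec_eq_0 evec_scale evec_uminus lin_ext_evec lin_ext_zero
      free_act_diff free_act_add free_act_mult free_act_fgen free_act_fscalar
      power_int_diff power_int_minus
    from f consider
        "f = fgen Z12 * fgen Z11 - fgen Z11 * fgen Z12"
      | "f = fgen Z21 * fgen Z11 - fscalar q * (fgen Z11 * fgen Z21)"
      | "f = fgen Z22 * fgen Z21 - fgen Z21 * fgen Z22"
      | "f = fgen Z22 * fgen Z12 - fscalar q * (fgen Z12 * fgen Z22)"
      | "f = fgen Z21 * fgen Z12 - fscalar q * (fgen Z12 * fgen Z21)"
      | "f = fgen Z22 * fgen Z11 - (fgen Z11 * fgen Z22 + fscalar (q - 1) * (fgen Z12 * fgen Z21))"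
      by (auto simp: mat2_relations_def)
    then show ?thesis
    proof cases
      case 1
      show ?thesis unfolding 1 n ab(1) by (cases "n = 0"; cases "a = 0"; cases "a = n"; cases "b = 0"; cases "b = n"; simp; (simp add: evec_def fun_eq_iff field_simps)?)
    next
      case 2
      show ?thesis unfolding 2 n ab(1) by (cases "n = 0"; cases "a = 0"; cases "a = n"; cases "b = 0"; cases "b = n"; simp; (simp add: evec_def fun_eq_iff field_simps)?)
    next
      case 3
      show ?thesis unfolding 3 n ab(1) by (cases "n = 0"; cases "a = 0"; cases "a = n"; cases "b = 0"; cases "b = n"; simp; (simp add: evec_def fun_eq_iff field_simps)?)
    next
      case 4
      show ?thesis unfolding 4 n ab(1) by (cases "n = 0"; cases "a = 0"; cases "a = n"; cases "b = 0"; cases "b = n"; simp; (simp add: evec_def fun_eq_iff field_simps)?)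
    next
      case 5
      show ?thesis unfolding 5 n ab(1) by (cases "n = 0"; cases "a = 0"; cases "a = n"; cases "b = 0"; cases "b = n"; simp; (simp add: evec_def fun_eq_iff field_simps)?)
    next
      case 6
      show ?thesis unfolding 6 n ab(1) by (cases "n = 0"; cases "a = 0"; cases "a = n"; cases "b = 0"; cases "b = n"; simp; (simp add: evec_def fun_eq_iff field_simps)?)
    qed
  qed
  then show ?thesis using supp by (auto simp: satisfies_relations_def)
qed

lemma N2_satisfies_relations:
  assumes m: "m > 0" and q: "q ^ m = 1" and nz: "\<beta> \<noteq> 0"
  shows "satisfies_relations q m (N2_gen m q r \<beta> \<gamma> l\<^sub>2)"
proof -
  obtain n where n: "m = Suc n" using m by (cases m) auto
  have q0: "q \<noteq> 0" using m q by (auto simp: power_0_left)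
  have q1: "q ^ n = inverse q" using q q0 by (simp add: n field_simps)
  have supp: "N2_gen m q r \<beta> \<gamma> l\<^sub>2 g s p = 0" if "s \<in> basis_index m" "p \<notin> basis_index m" for g s p
    using that m by (cases g; cases s) (auto simp: basis_index_def evec_def)
  have "free_act m (N2_gen m q r \<beta> \<gamma> l\<^sub>2) (evec 1 s) f = (\<lambda>p. 0)"
    if f: "f \<in> mat2_relations q" and s: "s \<in> basis_index m" for f s
  proof -
    obtain a b where ab: "s = (a, b)" "a \<le> n" "b \<le> n" using s by (cases s) (auto simp: basis_index_def n)
    have [simp]: "x < k \<Longrightarrow> y < k \<Longrightarrow> (x, y) \<in> basis_index k" for x y k by (simp add: basis_index_def)
    have [simp]: "a < Suc n" "b < Suc n" "a < n \<longleftrightarrow> a \<noteq> n" "b < n \<longleftrightarrow> b \<noteq> n" using ab by auto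
    have [simp]: "n = 0 \<Longrightarrow> q = 1" "n = 0 \<Longrightarrow> a = 0" "n = 0 \<Longrightarrow> b = 0"
      "a - j < Suc n" "b - j < Suc n" "n - j < Suc n"
      "0 < a \<Longrightarrow> a - Suc 0 < n" "0 < b \<Longrightarrow> b - Suc 0 < n" for j using ab q by (auto simp: n)
    note [simp] = q0 q1 nz power_diff of_nat_diff Suc_le_eq power_int_add evec_diff evec_add evec_eq_0 evec_scale evec_uminus lin_ext_evec lin_ext_zero
      free_act_diff free_act_add free_act_mult free_act_fgen free_act_fscalar
      power_int_diff power_int_minus power_add
    from f consider
        "f = fgen Z12 * fgen Z11 - fgen Z11 * fgen Z12"
      | "f = fgen Z21 * fgen Z11 - fscalar q * (fgen Z11 * fgen Z21)"
      | "f = fgen Z22 * fgen Z21 - fgen Z21 * fgen Z22"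
      | "f = fgen Z22 * fgen Z12 - fscalar q * (fgen Z12 * fgen Z22)"
      | "f = fgen Z21 * fgen Z12 - fscalar q * (fgen Z12 * fgen Z21)"
      | "f = fgen Z22 * fgen Z11 - (fgen Z11 * fgen Z22 + fscalar (q - 1) * (fgen Z12 * fgen Z21))"
      by (auto simp: mat2_relations_def)
    then show ?thesis
    proof cases
      case 1
      show ?thesis unfolding 1 n ab(1) by (cases "n = 0"; cases "a = 0"; cases "a = n"; cases "b = 0"; cases "b = n"; simp; (simp add: evec_def fun_eq_iff field_simps)?)
    next
      case 2
      show ?thesis unfolding 2 n ab(1) by (cases "n = 0"; cases "a = 0"; cases "a = n"; cases "b = 0"; cases "b = n"; simp; (simp add: evec_def fun_eq_iff field_simps)?)
    next
      case 3
      show ?thesis unfolding 3 n ab(1) by (cases "n = 0"; cases "a = 0"; cases "a = n"; cases "b = 0"; cases "b = n"; simp; (simp add: evec_def fun_eq_iff field_simps)?)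
    next
      case 4
      show ?thesis unfolding 4 n ab(1) by (cases "n = 0"; cases "a = 0"; cases "a = n"; cases "b = 0"; cases "b = n"; simp; (simp add: evec_def fun_eq_iff field_simps)?)
    next
      case 5
      show ?thesis unfolding 5 n ab(1) by (cases "n = 0"; cases "a = 0"; cases "a = n"; cases "b = 0"; cases "b = n"; simp; (simp add: evec_def fun_eq_iff field_simps)?)
    next
      case 6
      show ?thesis unfolding 6 n ab(1) by (cases "n = 0"; cases "a = 0"; cases "a = n"; cases "b = 0"; cases "b = n"; simp; (simp add: evec_def fun_eq_iff field_simps)?)
    qed
  qed
  then show ?thesis using supp by (auto simp: satisfies_relations_def)
qed

text \<open>The generators act on the modules by the formulas used in their definition.\<close>

corollary N1_smult_Zgen:
  assumes "primitive_root_of_unity m q" "\<alpha> \<noteq> 0" "\<beta> \<noteq> 0" "a < m" "b < m"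
  shows "Zgen q g \<odot>\<^bsub>N1 m q \<alpha> \<beta> l\<^sub>1 l\<^sub>2\<^esub> evec 1 (a, b) = N1_gen m q \<alpha> \<beta> l\<^sub>1 l\<^sub>2 g (a, b)"
  unfolding N1_def using assms
  by (intro gen_module_smult_Zgen N1_satisfies_relations) (auto simp: primitive_root_of_unity_def basis_index_def)

corollary N2_smult_Zgen:
  assumes "primitive_root_of_unity m q" "\<beta> \<noteq> 0" "a < m" "b < m"
  shows "Zgen q g \<odot>\<^bsub>N2 m q r \<beta> \<gamma> l\<^sub>2\<^esub> evec 1 (a, b) = N2_gen m q r \<beta> \<gamma> l\<^sub>2 g (a, b)"
  unfolding N2_def using assms
  by (intro gen_module_smult_Zgen N2_satisfies_relations) (auto simp: primitive_root_of_unity_def basis_index_def)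

end

theory Submission
  imports Defs
begin

text \<open>
  The \<open>m\<close>-th powers of \<open>Z\<^sub>1\<^sub>1, Z\<^sub>1\<^sub>2, Z\<^sub>2\<^sub>1, Z\<^sub>2\<^sub>2\<close>, \<open>det\<^sub>q\<close> and \<open>Z\<^sub>1\<^sub>2 Z\<^sub>2\<^sub>1\<close> are central, and a simple module is finitely
  generated over the commutative algebra they generate. By Zariski's lemma they act as scalars, so the
  commuting elements \<open>det\<^sub>q\<close> and \<open>Z\<^sub>1\<^sub>2 Z\<^sub>2\<^sub>1\<close> have a common eigenvector \<open>e\<close>. If \<open>Z\<^sub>1\<^sub>1\<^sup>m \<noteq> 0\<close>, the vectors
  \<open>e Z\<^sub>1\<^sub>1\<^sup>a Z\<^sub>2\<^sub>1\<^sup>b\<close> satisfy the formulas of \<open>N\<^sub>1\<close>. Otherwise \<open>e\<close> can be chosen with \<open>e Z\<^sub>1\<^sub>1 = 0\<close>, and the vectors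
  \<open>e Z\<^sub>2\<^sub>2\<^sup>a Z\<^sub>2\<^sub>1\<^sup>b\<close> satisfy the formulas of \<open>N\<^sub>2\<close> with \<open>r = 0\<close>. The modules \<open>N\<^sub>1\<close> and \<open>N\<^sub>2\<close> are simple because the
  joint eigenvalues of \<open>det\<^sub>q\<close> and \<open>Z\<^sub>1\<^sub>2 Z\<^sub>2\<^sub>1\<close> separate their basis vectors, so the resulting homomorphisms
  are isomorphisms.
\<close>

section \<open>Commutative rings acting on an abelian group\<close>

text \<open>The obstacle is that a simple module is not known to be finite-dimensional: eigenvectors
  cannot be taken for granted, and over a countable field Schur's lemma alone does not turn central
  elements into scalars. Zariski's lemma fills this gap. It is proved for the module itself rather
  than for a field extension: the acting ring stays a ring of polynomials, everything is understood
  modulo the annihilator \<open>annih\<close>, and fractions are replaced by elements that act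
  bijectively. In this way no quotient ring or fraction field has to be formed, and subrings are
  sets inside one commutative ring type. Torsionfreeness enters as injectivity of det_q and Z12 Z21:
  it makes both eigenvalues nonzero and forces Z21^m \<noteq> 0. Nothing similar holds for Z11,
  which is the source of the two families. The choice r = 0 loses nothing, since \<open>r\<close>
  and \<open>l\<^sub>2\<close> enter the second family only through q^(-r)
  \<open>l\<^sub>2\<close>.\<close>

definition is_subring :: "'p::comm_ring_1 set \<Rightarrow> bool" where
  "is_subring B \<longleftrightarrow> 1 \<in> B \<and> (\<forall>x\<in>B. \<forall>y\<in>B. x - y \<in> B \<and> x * y \<in> B)"

lemma is_subring_closed:
  assumes "is_subring B"
  shows "0 \<in> B" "1 \<in> B" "x \<in> B \<Longrightarrow> - x \<in> B" "x \<in> B \<Longrightarrow> y \<in> B \<Longrightarrow> x - y \<in> B"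
    "x \<in> B \<Longrightarrow> y \<in> B \<Longrightarrow> x + y \<in> B" "x \<in> B \<Longrightarrow> y \<in> B \<Longrightarrow> x * y \<in> B" "x \<in> B \<Longrightarrow> x ^ n \<in> B"
proof -
  have 1: "1 \<in> B" and d: "x - y \<in> B" and p: "x * y \<in> B" if "x \<in> B" "y \<in> B" for x y
    using that assms by (auto simp: is_subring_def)
  have one: "1 \<in> B" using assms by (simp add: is_subring_def)
  show zero: "0 \<in> B" using d[OF one one] by simp
  have neg: "- x \<in> B" if "x \<in> B" for x using d[OF zero that] by simp
  show "x + y \<in> B" if "x \<in> B" "y \<in> B" using d[OF that(1) neg[OF that(2)]] by simp
  show "x ^ n \<in> B" if "x \<in> B" by (induction n) (use one p that in auto)
  show "- x \<in> B" if "x \<in> B" using neg that .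
qed (use assms in \<open>simp_all add: is_subring_def\<close>)

definition polys_over :: "'p::comm_ring_1 set \<Rightarrow> 'p poly set" where
  "polys_over B = {p. \<forall>i. coeff p i \<in> B}"

definition adjoin :: "'p::comm_ring_1 set \<Rightarrow> 'p \<Rightarrow> 'p set" where
  "adjoin B t = (\<lambda>p. poly p t) ` polys_over B"

lemma polys_over_closed:
  assumes "is_subring B"
  shows "0 \<in> polys_over B" "1 \<in> polys_over B" "p \<in> polys_over B \<Longrightarrow> r \<in> polys_over B \<Longrightarrow> p - r \<in> polys_over B"
    "p \<in> polys_over B \<Longrightarrow> r \<in> polys_over B \<Longrightarrow> p * r \<in> polys_over B"
    "p \<in> polys_over B \<Longrightarrow> r \<in> polys_over B \<Longrightarrow> p + r \<in> polys_over B"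
    "p \<in> polys_over B \<Longrightarrow> p ^ n \<in> polys_over B"
    "b \<in> B \<Longrightarrow> [:b:] \<in> polys_over B" "b \<in> B \<Longrightarrow> p \<in> polys_over B \<Longrightarrow> pCons b p \<in> polys_over B"
proof -
  note c = is_subring_closed[OF assms]
  have s: "sum h I \<in> B" if "\<And>i. i \<in> I \<Longrightarrow> h i \<in> B" for h and I :: "nat set"
    using that by (induction I rule: infinite_finite_induct) (auto intro: c)
  show m: "p * r \<in> polys_over B" if "p \<in> polys_over B" "r \<in> polys_over B" for p r
    using that by (auto simp: polys_over_def coeff_mult intro!: s c)
  show one: "1 \<in> polys_over B" by (auto simp: polys_over_def coeff_1 intro: c)
  show "p ^ n \<in> polys_over B" if "p \<in> polys_over B" by (induction n) (use one m that in auto)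
qed (use is_subring_closed[OF assms] in \<open>auto simp: polys_over_def coeff_pCons split: nat.splits\<close>)

lemma is_subring_adjoin:
  assumes "is_subring B" shows "is_subring (adjoin B t)"
proof -
  note c = polys_over_closed[OF assms]
  have "1 \<in> adjoin B t" using c(2) by (force simp: adjoin_def)
  moreover have "poly p t - poly r t \<in> adjoin B t" "poly p t * poly r t \<in> adjoin B t"
    if "p \<in> polys_over B" "r \<in> polys_over B" for p r
    using imageI[OF c(3)[OF that], of "\<lambda>p. poly p t"] imageI[OF c(4)[OF that], of "\<lambda>p. poly p t"]
    by (auto simp: adjoin_def)
  ultimately show ?thesis unfolding is_subring_def by (auto simp: adjoin_def)
qed

lemma subset_adjoin: "is_subring B \<Longrightarrow> B \<subseteq> adjoin B t"
  by (force simp: adjoin_def intro: polys_over_closed(7))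

lemma mem_adjoin:
  assumes "is_subring B" shows "t \<in> adjoin B t"
proof -
  have "[:0, 1:] \<in> polys_over B"
    using assms by (intro polys_over_closed(8) polys_over_closed(7) is_subring_closed(1,2))
  then show ?thesis unfolding adjoin_def by (rule rev_image_eqI) simp
qed

section \<open>Spans over localisations and algebraic elements\<close>

locale comm_ring_action = abelian_group M
  for M :: "('v, 'm) ring_scheme" (structure) and act :: "'p::comm_ring_1 \<Rightarrow> 'v \<Rightarrow> 'v" +
  assumes act_closed [simp, intro]: "x \<in> carrier M \<Longrightarrow> act p x \<in> carrier M"
    and act_add_left: "x \<in> carrier M \<Longrightarrow> act (p + q) x = act p x \<oplus> act q x"
    and act_add_right: "x \<in> carrier M \<Longrightarrow> y \<in> carrier M \<Longrightarrow> act p (x \<oplus> y) = act p x \<oplus> act p y"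
    and act_mult: "x \<in> carrier M \<Longrightarrow> act (p * q) x = act p (act q x)"
    and act_one [simp]: "x \<in> carrier M \<Longrightarrow> act 1 x = x"
begin

lemma act_zero_left [simp]: "x \<in> carrier M \<Longrightarrow> act 0 x = \<zero>"
  using act_add_left[of x 0 0] by (metis act_closed add.l_cancel_one' add_0)

lemma act_zero_right [simp]: "act p \<zero> = \<zero>"
  using act_mult[of \<zero> p 0] by simp

lemma act_minus_left: "x \<in> carrier M \<Longrightarrow> act (- p) x = \<ominus> act p x"
  using act_add_left[of x "- p" p] by (simp add: minus_equality)

lemma act_diff_left: "x \<in> carrier M \<Longrightarrow> act (p - q) x = act p x \<ominus> act q x"
  using act_add_left[of x p "- q"] by (simp add: act_minus_left minus_eq)

lemma act_minus_right:
  assumes "x \<in> carrier M" shows "act p (\<ominus> x) = \<ominus> act p x"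
  using act_mult[OF assms, of p "- 1"] act_mult[OF assms, of "- 1" p] assms
  by (simp add: act_minus_left)

lemma act_diff_right: "x \<in> carrier M \<Longrightarrow> y \<in> carrier M \<Longrightarrow> act p (x \<ominus> y) = act p x \<ominus> act p y"
  by (simp add: minus_eq act_add_right act_minus_right)

lemma act_commute: "x \<in> carrier M \<Longrightarrow> act p (act q x) = act q (act p x)"
  by (metis act_mult mult.commute)

definition annih :: "'p set" where
  "annih = {p. \<forall>x\<in>carrier M. act p x = \<zero>}"

lemma annih_closed:
  "0 \<in> annih" "p \<in> annih \<Longrightarrow> - p \<in> annih" "p \<in> annih \<Longrightarrow> r \<in> annih \<Longrightarrow> p + r \<in> annih"
  "p \<in> annih \<Longrightarrow> r \<in> annih \<Longrightarrow> p - r \<in> annih" "p \<in> annih \<Longrightarrow> p * r \<in> annih" "p \<in> annih \<Longrightarrow> r * p \<in> annih"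
  by (auto simp: annih_def act_add_left act_minus_left act_diff_left act_mult minus_eq)

lemma annih_sum: "(\<And>i. i \<in> I \<Longrightarrow> h i \<in> annih) \<Longrightarrow> sum h I \<in> annih"
  by (induction I rule: infinite_finite_induct) (auto intro: annih_closed)

lemma annih_diff_iff: "p - r \<in> annih \<Longrightarrow> p \<in> annih \<longleftrightarrow> r \<in> annih"
  using annih_closed(3)[of "p - r" r] annih_closed(4)[of p "p - r"] by auto

text \<open>The submodule generated by \<open>V\<close> over the localisation of \<open>Q\<close> at \<open>f\<close>, in case \<open>f\<close> acts
  bijectively.\<close>

inductive_set loc_span :: "'p set \<Rightarrow> 'p \<Rightarrow> 'v set \<Rightarrow> 'v set" for Q f V where
  zero: "\<zero> \<in> loc_span Q f V"
| gen: "v \<in> V \<Longrightarrow> v \<in> loc_span Q f V"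
| add: "x \<in> loc_span Q f V \<Longrightarrow> y \<in> loc_span Q f V \<Longrightarrow> x \<oplus> y \<in> loc_span Q f V"
| act: "p \<in> Q \<Longrightarrow> x \<in> loc_span Q f V \<Longrightarrow> act p x \<in> loc_span Q f V"
| div: "x \<in> carrier M \<Longrightarrow> act f x \<in> loc_span Q f V \<Longrightarrow> x \<in> loc_span Q f V"

lemma loc_span_closed:
  assumes "V \<subseteq> carrier M" "x \<in> loc_span Q f V" shows "x \<in> carrier M"
  using assms(2,1) by induction auto

text \<open>Division is the only critical rule. It survives when the target inverts
  \<open>f * l\<close> instead of \<open>f\<close>, because acting with \<open>l \<in> Q'\<close>
  turns a witness for \<open>f\<close> into one for \<open>f * l\<close>. So an operator may
  introduce a new denominator; \<open>l = 1\<close> gives plain stability.\<close>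

lemma loc_span_map:
  assumes x: "x \<in> loc_span Q f V" and V: "V \<subseteq> carrier M" "V' \<subseteq> carrier M"
    and T: "\<And>x. x \<in> carrier M \<Longrightarrow> T x \<in> carrier M"
      "\<And>x y. x \<in> carrier M \<Longrightarrow> y \<in> carrier M \<Longrightarrow> T (x \<oplus> y) = T x \<oplus> T y"
      "\<And>p x. x \<in> carrier M \<Longrightarrow> T (act p x) = act p (T x)"
    and TV: "\<And>v. v \<in> V \<Longrightarrow> T v \<in> loc_span Q' (f * l) V'"
    and Q: "\<And>p x. p \<in> Q \<Longrightarrow> x \<in> loc_span Q' (f * l) V' \<Longrightarrow> act p x \<in> loc_span Q' (f * l) V'" and l: "l \<in> Q'"
  shows "T x \<in> loc_span Q' (f * l) V'"
  using x
proof induction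
  case zero
  have "T \<zero> = \<zero>" using T(3)[of \<zero> 0] T(1)[of \<zero>] by simp
  then show ?case by (simp add: loc_span.zero)
next
  case (add x y)
  then show ?case using loc_span_closed[OF V(1)] by (simp add: T loc_span.add)
next
  case (act p x)
  then show ?case using loc_span_closed[OF V(1)] by (simp add: T Q)
next
  case (div x)
  then have "act (f * l) (T x) = act l (T (act f x))" by (simp add: T act_mult act_commute)
  with div T show ?case by (metis l loc_span.act loc_span.div)
qed (rule TV)

lemma loc_span_act_sum:
  assumes "v \<in> carrier M" "\<And>i. i \<in> I \<Longrightarrow> act (h i) v \<in> loc_span Q f V" shows "act (sum h I) v \<in> loc_span Q f V"
  using assms
  by (induction I rule: infinite_finite_induct) (auto simp: act_add_left intro: loc_span.zero loc_span.add)

text \<open>This is algebraicity over the image of \<open>B\<close> in the quotient by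
  \<open>annih\<close>, expressed through representatives.\<close>

definition algebraic_over :: "'p set \<Rightarrow> 'p \<Rightarrow> bool" where
  "algebraic_over B z \<longleftrightarrow> (\<exists>p\<in>polys_over B. (\<exists>i. coeff p i \<notin> annih) \<and> poly p z \<in> annih)"

text \<open>Top terms with coefficient in \<open>annih\<close> are discarded one after another. The
  result has the degree of the reduction modulo \<open>annih\<close>, so its leading coefficient can
  serve as a denominator.\<close>

lemma exists_lead_coeff_notin_annih:
  assumes B: "is_subring B" and "p \<in> polys_over B" "\<exists>i. coeff p i \<notin> annih"
  shows "\<exists>p'\<in>polys_over B. lead_coeff p' \<notin> annih \<and> (\<forall>i. coeff (p - p') i \<in> annih)"
  using assms(2-)
proof (induction "degree p" arbitrary: p rule: less_induct)
  case less
  show ?case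
  proof (cases "lead_coeff p \<in> annih")
    case False
    then show ?thesis using less.prems(1) by (intro bexI[of _ p]) (auto simp: annih_closed)
  next
    case True
    define p1 where "p1 = p - monom (lead_coeff p) (degree p)"
    have d: "degree p \<noteq> 0"
    proof
      assume "degree p = 0"
      with True less.prems(2) show False
        by (metis annih_closed(1) coeff_eq_0 gr0I)
    qed
    have c: "coeff p1 i = (if i = degree p then 0 else coeff p i)" for i by (simp add: p1_def)
    have "degree p1 < degree p"
      using d by (intro le_less_trans[OF degree_le[of "degree p - 1"]]) (auto simp: c coeff_eq_0)
    moreover have "p1 \<in> polys_over B" using less.prems(1) is_subring_closed(1)[OF B] by (simp add: polys_over_def c)
    moreover have "\<exists>i. coeff p1 i \<notin> annih" using less.prems(2) True by (metis c)
    ultimately obtain p' where p': "p' \<in> polys_over B" "lead_coeff p' \<notin> annih" "\<And>i. coeff (p1 - p') i \<in> annih"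
      using less.hyps by blast
    have "coeff (p - p') i \<in> annih" for i
      using annih_closed(3)[OF p'(3)[of i], of "coeff p i - coeff p1 i"] True annih_closed(1) by (auto simp: c)
    with p' show ?thesis by blast
  qed
qed

lemma coeff_mult_in_annih: "(\<And>i. coeff G i \<in> annih) \<Longrightarrow> coeff (H * G) i \<in> annih"
  by (simp add: coeff_mult annih_sum annih_closed(6))

lemma poly_in_annih: "(\<And>i. coeff p i \<in> annih) \<Longrightarrow> poly p z \<in> annih"
  by (simp add: poly_altdef annih_sum annih_closed)

lemma algebraic_over_mono: "B \<subseteq> B' \<Longrightarrow> algebraic_over B z \<Longrightarrow> algebraic_over B' z"
  unfolding algebraic_over_def polys_over_def by blast

lemma algebraic_over_mem:
  assumes "is_subring B" "1 \<notin> annih" "b \<in> B" shows "algebraic_over B b"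
proof -
  have "[:- b, 1:] \<in> polys_over B"
    using assms by (intro polys_over_closed(8) polys_over_closed(7) is_subring_closed(2,3))
  moreover have "coeff [:- b, 1:] 1 \<notin> annih" using assms(2) by simp
  moreover have "poly [:- b, 1:] b \<in> annih" by (simp add: annih_closed(1))
  ultimately show ?thesis unfolding algebraic_over_def by blast
qed

text \<open>Once the leading coefficient \<open>l\<close> of an equation for \<open>z\<close> is
  invertible, \<open>z ^ d\<close> is a combination of lower powers. So \<open>z\<close> may leave
  the ring, at the price of the generators \<open>act (z ^ i) v\<close> with \<open>i < d\<close>
  and the new denominator \<open>l\<close>.\<close>

lemma loc_span_remove_algebraic:
  assumes B: "is_subring B" "B \<subseteq> Q" and z: "algebraic_over B z"
    and f: "f \<in> B" and V: "finite V" "V \<subseteq> carrier M"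
  shows "\<exists>l\<in>B - annih. \<exists>V'. finite V' \<and> V' \<subseteq> carrier M \<and> loc_span (insert z Q) f V \<subseteq> loc_span Q (f * l) V'"
proof -
  obtain p where p: "p \<in> polys_over B" "lead_coeff p \<notin> annih" "poly p z \<in> annih"
  proof -
    obtain p0 where p0: "p0 \<in> polys_over B" "\<exists>i. coeff p0 i \<notin> annih" "poly p0 z \<in> annih"
      using z by (auto simp: algebraic_over_def)
    from exists_lead_coeff_notin_annih[OF B(1) p0(1,2)] obtain p where
      p: "p \<in> polys_over B" "lead_coeff p \<notin> annih" "\<And>i. coeff (p0 - p) i \<in> annih" by blast
    have "poly p0 z - poly p z \<in> annih" using poly_in_annih[of "p0 - p" z] p(3) by simp
    then have "poly p z \<in> annih" using p0(3) annih_diff_iff by blast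
    with p that show ?thesis by blast
  qed
  define d l where "d = degree p" and "l = lead_coeff p"
  \<comment> \<open>A constant equation would put its leading coefficient into \<open>annih\<close>.
    Positive degree ensures that \<open>V'\<close> contains the vectors of \<open>V\<close>
    themselves.\<close>
  have "d \<noteq> 0"
  proof
    assume "d = 0"
    then obtain a where "p = [:a:]" unfolding d_def using degree_eq_zeroE by blast
    with p show False by simp
  qed
  define V' where "V' = (\<lambda>(i, v). act (z ^ i) v) ` ({..<d} \<times> V)"
  have V': "finite V'" "V' \<subseteq> carrier M" using V by (auto simp: V'_def)
  have lB: "l \<in> B" using p(1) by (simp add: l_def polys_over_def)
  let ?R = "loc_span Q (f * l) V'"
  have mem: "act (z ^ i) v \<in> ?R" if "v \<in> V" "i < d" for v i
    using that by (intro loc_span.gen) (auto simp: V'_def)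
  have top: "act (z ^ d) v \<in> ?R" if v: "v \<in> V" for v
  proof -
    have vM: "v \<in> carrier M" using v V by auto
    have "poly p z = (\<Sum>i<d. coeff p i * z ^ i) + l * z ^ d"
      by (simp add: poly_altdef d_def l_def lessThan_Suc_atMost[symmetric])
    then have "l * z ^ d = poly p z + (\<Sum>i<d. (- coeff p i) * z ^ i)" by (simp add: sum_negf)
    moreover have "act (poly p z) v = \<zero>" using p(3) vM by (auto simp: annih_def)
    ultimately have "act (l * z ^ d) v = act (\<Sum>i<d. (- coeff p i) * z ^ i) v"
      using vM by (simp add: act_add_left)
    also have "\<dots> \<in> ?R"
    proof (rule loc_span_act_sum[OF vM])
      fix i assume i: "i \<in> {..<d}"
      have "- coeff p i \<in> Q" using p(1) B is_subring_closed(3)[OF B(1)] by (auto simp: polys_over_def)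
      then have "act (- coeff p i) (act (z ^ i) v) \<in> ?R" using i mem[OF v] by (auto intro: loc_span.act)
      then show "act (- coeff p i * z ^ i) v \<in> ?R" unfolding act_mult[OF vM] .
    qed
    \<comment> \<open>The factor \<open>f\<close> is supplied because \<open>?R\<close> allows
      division only by the full product \<open>f * l\<close>.\<close>
    finally have "act f (act (l * z ^ d) v) \<in> ?R" using f B by (auto intro: loc_span.act)
    then have "act (f * l) (act (z ^ d) v) \<in> ?R" using vM by (simp add: act_mult)
    then show ?thesis using vM loc_span.div by blast
  qed
  have z_closed: "act z x \<in> ?R" if "x \<in> ?R" for x
  proof -
    have "act z x \<in> loc_span Q (f * l * 1) V'"
    proof (rule loc_span_map[OF that V'(2) V'(2)])
      fix v assume "v \<in> V'"
      then obtain i w where iw: "i < d" "w \<in> V" "v = act (z ^ i) w" by (auto simp: V'_def)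
      have "act z v = act (z ^ Suc i) w" using iw V by (auto simp: act_mult)
      also have "\<dots> \<in> ?R" using mem[OF iw(2), of "Suc i"] top[OF iw(2)] iw(1) by (cases "Suc i = d") auto
      finally show "act z v \<in> loc_span Q (f * l * 1) V'" by simp
    qed (use B is_subring_closed(2)[OF B(1)] in \<open>auto simp: act_add_right act_commute intro: loc_span.act\<close>)
    then show ?thesis by simp
  qed
  have "x \<in> ?R" if "x \<in> loc_span (insert z Q) f V" for x
  proof (rule loc_span_map[OF that V(2) V'(2), where T = "\<lambda>x. x"])
    fix v assume "v \<in> V"
    then show "v \<in> ?R" using mem[of v 0] \<open>d \<noteq> 0\<close> V by auto
  qed (use lB B z_closed in \<open>auto intro: loc_span.act\<close>)
  then show ?thesis using lB p(2) V' unfolding l_def by blast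
qed

end

section \<open>Nakayama's lemma and Zariski's lemma for a simple action\<close>

locale simple_action = comm_ring_action +
  assumes nontrivial: "carrier M \<noteq> {\<zero>}"
    and inj: "p \<notin> annih \<Longrightarrow> x \<in> carrier M \<Longrightarrow> act p x = \<zero> \<Longrightarrow> x = \<zero>"
    and surj: "p \<notin> annih \<Longrightarrow> x \<in> carrier M \<Longrightarrow> \<exists>y\<in>carrier M. x = act p y"
begin

lemma one_notin_annih: "1 \<notin> annih"
  using nontrivial zero_closed by (auto simp: annih_def)

text \<open>The bijectivity assumed in \<open>simple_action\<close> is the conclusion of Schur's
  lemma. It makes the quotient by \<open>annih\<close> a domain whose field of fractions acts on the
  module, so products of denominators stay outside \<open>annih\<close>.\<close>

lemma annih_prime: "p * r \<in> annih \<Longrightarrow> p \<in> annih \<or> r \<in> annih"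
proof -
  assume pr: "p * r \<in> annih"
  have "act r x = \<zero>" if "p \<notin> annih" "x \<in> carrier M" for x
    using inj[OF that(1), of "act r x"] pr that(2) by (simp add: annih_def act_mult)
  then show ?thesis by (auto simp: annih_def)
qed

lemma annih_power: "p ^ n \<in> annih \<Longrightarrow> p \<in> annih"
proof (induction n)
  case (Suc n)
  then show ?case using annih_prime[of p "p ^ n"] by auto
qed (use one_notin_annih in simp)

lemma loc_span_remove_all_algebraic:
  assumes B: "is_subring B" and Z: "finite Z" "\<And>z. z \<in> Z \<Longrightarrow> algebraic_over B z"
    and V: "finite V" "V \<subseteq> carrier M" and f: "f \<in> B - annih"
  shows "\<exists>f'\<in>B - annih. \<exists>V'. finite V' \<and> V' \<subseteq> carrier M \<and> loc_span (Z \<union> B) f V \<subseteq> loc_span B f' V'"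
  using Z V f
proof (induction Z arbitrary: f V rule: finite_induct)
  case empty
  then show ?case by auto
next
  case (insert z Z)
  have "\<exists>l\<in>B - annih. \<exists>V'. finite V' \<and> V' \<subseteq> carrier M
      \<and> loc_span (insert z (Z \<union> B)) f V \<subseteq> loc_span (Z \<union> B) (f * l) V'"
    using insert.prems by (intro loc_span_remove_algebraic[OF B]) auto
  then obtain l V' where l: "l \<in> B - annih" "finite V'" "V' \<subseteq> carrier M"
    "loc_span (insert z (Z \<union> B)) f V \<subseteq> loc_span (Z \<union> B) (f * l) V'" by blast
  moreover have "f * l \<in> B - annih" using l(1) insert.prems annih_prime is_subring_closed(6)[OF B] by auto
  ultimately obtain f' V'' where "f' \<in> B - annih" "finite V''" "V'' \<subseteq> carrier M"
    "loc_span (Z \<union> B) (f * l) V' \<subseteq> loc_span B f' V''"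
    using insert.IH[of V' "f * l"] insert.prems by blast
  with l(4) show ?case by (intro bexI[of _ f'] exI[of _ V'']) auto
qed

text \<open>The coefficient of \<open>v\<close> lives in a localisation, and its denominator is a
  power of \<open>f\<close>; multiplying by that power leaves a coefficient in \<open>B\<close>
  itself. A sum multiplies two such powers, and each division costs one more factor
  \<open>f\<close>.\<close>

lemma loc_span_insert_decompose:
  assumes B: "is_subring B" and f: "f \<in> B" and V: "insert v V \<subseteq> carrier M" and x: "x \<in> loc_span B f (insert v V)"
  shows "\<exists>n. \<exists>b\<in>B. act (f ^ n) x \<ominus> act b v \<in> loc_span B f V"
  using x
proof induction
  case zero
  have "act (f ^ 0) \<zero> \<ominus> act 0 v = \<zero>" using V by (simp add: minus_eq)
  then show ?case using is_subring_closed(1)[OF B] loc_span.zero by metis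
next
  case (gen w)
  show ?case
  proof (cases "w = v")
    case True
    have "act (f ^ 0) w \<ominus> act 1 v = \<zero>" using V True by (simp add: minus_eq r_neg)
    then show ?thesis using is_subring_closed(2)[OF B] loc_span.zero by metis
  next
    case False
    then have "act (f ^ 0) w \<ominus> act 0 v = w" "w \<in> V" using gen V by (auto simp: minus_eq)
    then show ?thesis using is_subring_closed(1)[OF B] loc_span.gen by metis
  qed
next
  case (add x y)
  note c = is_subring_closed[OF B]
  obtain n b k b' where *: "b \<in> B" "act (f ^ n) x \<ominus> act b v \<in> loc_span B f V"
    "b' \<in> B" "act (f ^ k) y \<ominus> act b' v \<in> loc_span B f V" using add.IH by blast
  have xy: "x \<in> carrier M" "y \<in> carrier M" "v \<in> carrier M" using add.hyps V loc_span_closed by blast+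
  have "act (f ^ k) (act (f ^ n) x \<ominus> act b v) \<oplus> act (f ^ n) (act (f ^ k) y \<ominus> act b' v) \<in> loc_span B f V"
    using * f c(7) by (intro loc_span.add loc_span.act) auto
  also have "act (f ^ k) (act (f ^ n) x \<ominus> act b v) \<oplus> act (f ^ n) (act (f ^ k) y \<ominus> act b' v)
      = act (f ^ (n + k)) (x \<oplus> y) \<ominus> act (f ^ k * b + f ^ n * b') v"
    using xy by (simp add: power_add act_mult act_add_left act_add_right act_diff_right minus_eq
      minus_add a_ac act_commute[of x "f ^ k"] act_minus_right)
  finally show ?case using * f by (intro exI[of _ "n + k"] bexI[of _ "f ^ k * b + f ^ n * b'"] c(5) c(6) c(7))
next
  case (act p x)
  then obtain n b where *: "b \<in> B" "act (f ^ n) x \<ominus> act b v \<in> loc_span B f V" by blast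
  have xy: "x \<in> carrier M" "v \<in> carrier M" using act.hyps V loc_span_closed by blast+
  have "act (f ^ n) (act p x) \<ominus> act (p * b) v = act p (act (f ^ n) x \<ominus> act b v)"
    using xy by (simp add: act_mult act_diff_right act_commute)
  also have "\<dots> \<in> loc_span B f V" using * act.hyps by (intro loc_span.act)
  finally show ?case using * act.hyps is_subring_closed(6)[OF B] by blast
next
  case (div x)
  then obtain n b where "b \<in> B" "act (f ^ n) (act f x) \<ominus> act b v \<in> loc_span B f V" by blast
  then have "act (f ^ Suc n) x \<ominus> act b v \<in> loc_span B f V"
    using div.hyps by (simp add: act_mult act_commute)
  then show ?case using \<open>b \<in> B\<close> by blast
qed

text \<open>Nakayama's lemma, with the determinant replaced by an induction on the number of generators.\<close>

lemma power_diff_multiple_in_annih: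
  assumes B: "is_subring B" and f: "f \<in> B - annih" and g: "g \<in> B - annih"
    and V: "finite V" "V \<subseteq> carrier M" and gen: "carrier M \<subseteq> loc_span B f V"
  shows "\<exists>n. \<exists>c\<in>B. f ^ n - g * c \<in> annih"
proof -
  note c = is_subring_closed[OF B]
  \<comment> \<open>The generalisation fit for induction: some element congruent to a power of
    \<open>f\<close> modulo \<open>g\<close> maps the module into the span of \<open>V\<close>. It
    starts with the element 1, where \<open>k = 0\<close> and \<open>b = 0\<close>, and ends with
    empty \<open>V\<close>, where the element annihilates the module.\<close>
  have "\<exists>n. \<exists>c\<in>B. f ^ n - g * c \<in> annih"
    if "b \<in> B" "\<And>x. x \<in> carrier M \<Longrightarrow> act (f ^ k - g * b) x \<in> loc_span B f V" for k b
    using V that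
  proof (induction V arbitrary: k b rule: finite_induct)
    case empty
    have "x = \<zero>" if "x \<in> loc_span B f {}" for x
      using that
    proof induction
      case (div x) then show ?case using inj f by auto
    qed auto
    then have "f ^ k - g * b \<in> annih" using empty by (auto simp: annih_def)
    then show ?case using empty by blast
  next
    case (insert v V)
    define h where "h = f ^ k - g * b"
    have hB: "h \<in> B" unfolding h_def using insert.prems f g by (intro c(4) c(6) c(7)) auto
    have v: "v \<in> carrier M" using insert.prems by auto
    \<comment> \<open>Divisibility of the module by \<open>g\<close> is the hypothesis of Nakayama's
      lemma; \<open>surj\<close> provides it for \<open>v\<close>.\<close>
    obtain w where w: "w \<in> carrier M" "v = act g w" using surj[of g v] g v by blast
    have "act h w \<in> loc_span B f (insert v V)" using insert.prems w by (auto simp: h_def)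
    then obtain n d where d: "d \<in> B" "act (f ^ n) (act h w) \<ominus> act d v \<in> loc_span B f V"
      using loc_span_insert_decompose[OF B _ insert.prems(1)] f by blast
    \<comment> \<open>Modulo the span of \<open>V\<close>, \<open>f ^ n\<close> times
      \<open>act h w\<close> is \<open>act d v\<close>. Acting with \<open>g\<close> replaces
      \<open>w\<close> by \<open>v\<close>, so this element sends \<open>v\<close> into the span,
      and it is still a power of \<open>f\<close> modulo \<open>g\<close>.\<close>
    define h' where "h' = f ^ n * h - g * d"
    have h'B: "h' \<in> B" unfolding h'_def using hB d f g by (intro c(4) c(6) c(7)) auto
    have "act (f ^ n * h) v = act g (act (f ^ n) (act h w))"
      unfolding w(2) using w(1) by (simp add: act_mult[symmetric] mult_ac)
    then have "act h' v = act g (act (f ^ n) (act h w) \<ominus> act d v)"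
      using w(1) v by (simp add: h'_def act_diff_left act_diff_right act_mult)
    also have "\<dots> \<in> loc_span B f V" using d g by (intro loc_span.act) auto
    finally have h'v: "act h' v \<in> loc_span B f V" .
    have h'_mem: "act h' x \<in> loc_span B f V" if "x \<in> loc_span B f (insert v V)" for x
    proof -
      have "act h' x \<in> loc_span B (f * 1) V"
        by (rule loc_span_map[OF that])
          (use insert.prems h'v h'B c(2) in \<open>auto simp: act_add_right act_commute intro: loc_span.act loc_span.gen\<close>)
      then show ?thesis by simp
    qed
    \<comment> \<open>The cofactor of \<open>g\<close> when \<open>h' * h\<close> is expanded. Here
      \<open>h\<close> maps the module into the span of \<open>insert v V\<close>, and
      \<open>h'\<close> pushes that span into the one of \<open>V\<close>.\<close>
    define b' where "b' = f ^ k * (f ^ n * b + d) + b * h'"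
    have eq: "h' * h = f ^ (k + n + k) - g * b'"
      unfolding b'_def h'_def h_def by (simp add: algebra_simps power_add)
    have "act (f ^ (k + n + k) - g * b') x \<in> loc_span B f V" if "x \<in> carrier M" for x
      using h'_mem insert.prems(3)[OF that] that unfolding eq[symmetric] by (simp add: act_mult h_def)
    moreover have "b' \<in> B" unfolding b'_def using f d h'B insert.prems by (intro c(5) c(6) c(7)) auto
    ultimately show ?case using insert.IH insert.prems by blast
  qed
  from this[of 0 0] show ?thesis using gen c(1) by auto
qed

text \<open>Modulo the prime ideal \<open>annih\<close>, 1 + X F is coprime to F. If it divided a
  power of F, it would be a unit of a polynomial ring over a domain, although its degree is
  positive.\<close>

lemma coeff_power_diff_notin_annih:
  assumes "lead_coeff F \<notin> annih" "\<And>i. coeff (F ^ n - (1 + pCons 0 F) * C) i \<in> annih"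
  shows False
proof -
  text \<open>Multiplying by \<open>X\<^sup>n\<close> shows that \<open>1 + X F\<close> divides \<open>(-1)\<^sup>n\<close> modulo the prime ideal.\<close>
  define t :: "'c poly" where "t = [:0, 1:]"
  define Y where "Y = t * F"
  have XF: "pCons 0 F = Y" by (simp add: t_def Y_def)
  \<comment> \<open>An inverse up to sign: the geometric sum contributes
    \<open>1 - (- Y) ^ n\<close>, and the assumed factorisation, scaled by \<open>t ^ n\<close>,
    restores the missing \<open>Y ^ n\<close>.\<close>
  define D where "D = (- 1) ^ n * (\<Sum>i<n. (- Y) ^ i) + t ^ n * C"
  have "(1 + Y) * D = (- 1) ^ n * ((1 + Y) * (\<Sum>i<n. (- Y) ^ i)) + t ^ n * ((1 + Y) * C)"
    by (simp add: D_def algebra_simps)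
  also have "(1 + Y) * (\<Sum>i<n. (- Y) ^ i) = 1 - (- Y) ^ n"
    using one_diff_power_eq[of "- Y" n] by simp
  also have "(- 1) ^ n * (1 - (- Y) ^ n) = (- 1) ^ n - t ^ n * F ^ n"
    by (simp add: right_diff_distrib power_mult_distrib[symmetric] Y_def)
  finally have "(1 + pCons 0 F) * D - (- 1) ^ n = - (t ^ n * (F ^ n - (1 + pCons 0 F) * C))"
    by (simp add: XF right_diff_distrib)
  moreover have "coeff (t ^ n * G) i \<in> annih" if "\<And>i. coeff G i \<in> annih" for G i
    by (rule coeff_mult_in_annih[OF that])
  ultimately have *: "coeff ((1 + pCons 0 F) * D - (- 1) ^ n) i \<in> annih" for i
    using assms(2) annih_closed(2) by (metis coeff_minus)
  have sub: "is_subring (UNIV :: 'c set)" by (simp add: is_subring_def)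
  have const: "coeff ((- 1 :: 'c poly) ^ n) i = (if i = 0 then (- 1) ^ n else 0)" for i
    by (simp add: minus_one_power_iff)
  have nD: "\<exists>i. coeff D i \<notin> annih"
  proof (rule ccontr)
    assume "\<not> ?thesis"
    then have "coeff ((1 + pCons 0 F) * D) 0 \<in> annih" by (intro coeff_mult_in_annih) auto
    then have "(- 1) ^ n \<in> annih" using *[of 0] const[of 0] annih_diff_iff by (metis coeff_diff)
    then show False using annih_closed(2) annih_power one_notin_annih by fastforce
  qed
  obtain D' where D': "lead_coeff D' \<notin> annih" "\<And>i. coeff (D - D') i \<in> annih"
    using exists_lead_coeff_notin_annih[OF sub _ nD] by (auto simp: polys_over_def)
  have F0: "F \<noteq> 0" using assms(1) annih_closed(1) by auto
  have dF: "degree (1 + pCons 0 F) = Suc (degree F)"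
    using F0 by (subst degree_add_eq_right) auto
  \<comment> \<open>The product of the leading coefficients sits in positive degree, where the
    constant \<open>(- 1) ^ n\<close> contributes nothing, so it would have to lie in
    \<open>annih\<close>.\<close>
  have top: "coeff ((1 + pCons 0 F) * D') (Suc (degree F) + degree D') = lead_coeff F * lead_coeff D'"
    using coeff_mult_degree_sum[of "1 + pCons 0 F" D'] by (simp add: dF)
  have "coeff ((1 + pCons 0 F) * (D - D')) i \<in> annih" for i
    by (rule coeff_mult_in_annih[OF D'(2)])
  moreover have "(1 + pCons 0 F) * D' - (- 1) ^ n = (1 + pCons 0 F) * D - (- 1) ^ n - (1 + pCons 0 F) * (D - D')"
    by (simp add: algebra_simps)
  ultimately have "coeff ((1 + pCons 0 F) * D' - (- 1) ^ n) i \<in> annih" for i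
    using annih_closed(4)[OF *[of i]] by (simp only: coeff_diff)
  from this[of "Suc (degree F) + degree D'"] have "coeff ((1 + pCons 0 F) * D') (Suc (degree F) + degree D') \<in> annih"
    by (simp add: const)
  then show False using top annih_prime assms(1) D'(1) by metis
qed

end

context simple_action
begin

lemma loc_span_mono: "Q \<subseteq> Q' \<Longrightarrow> loc_span Q f V \<subseteq> loc_span Q' f V"
proof
  fix x assume Q: "Q \<subseteq> Q'" and "x \<in> loc_span Q f V"
  from this(2) show "x \<in> loc_span Q' f V"
    by induction (use Q in \<open>auto intro: loc_span.zero loc_span.gen loc_span.add loc_span.act loc_span.div\<close>)
qed

lemma loc_span_cong: "f - f' \<in> annih \<Longrightarrow> loc_span Q f V \<subseteq> loc_span Q f' V"
proof
  fix x assume f: "f - f' \<in> annih" and "x \<in> loc_span Q f V"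
  from this(2) show "x \<in> loc_span Q f' V"
  proof induction
    case (div x)
    have "act f x = act (f - f') x \<oplus> act f' x" using act_add_left[OF div.hyps(1), of "f - f'" f'] by simp
    also have "\<dots> = act f' x" using f div.hyps(1) by (simp add: annih_def)
    finally show ?case using div loc_span.div by metis
  qed (auto intro: loc_span.zero loc_span.gen loc_span.add loc_span.act)
qed

text \<open>Elements of \<open>Z\<close> that are not yet algebraic are adjoined one at a time. Only
  the last one, \<open>t\<close>, is remembered, since one variable over a subring is all that the
  contradiction in \<open>algebraic_if_finitely_generated\<close> uses.\<close>

lemma exists_purely_transcendental_subring:
  assumes "finite Z" "is_subring B0"
  shows "\<exists>B. is_subring B \<and> B0 \<subseteq> B \<and> (\<forall>z\<in>Z. algebraic_over B z) \<and>
    (B = B0 \<or> (\<exists>B' t. is_subring B' \<and> B = adjoin B' t \<and> \<not> algebraic_over B' t))"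
  using assms(1)
proof induction
  case empty
  then show ?case using assms(2) by auto
next
  case (insert z Z)
  then obtain B where B: "is_subring B" "B0 \<subseteq> B" "\<forall>z\<in>Z. algebraic_over B z"
    "B = B0 \<or> (\<exists>B' t. is_subring B' \<and> B = adjoin B' t \<and> \<not> algebraic_over B' t)" by blast
  show ?case
  proof (cases "algebraic_over B z")
    case True
    then show ?thesis using B by blast
  next
    case False
    have "B \<subseteq> adjoin B z" "is_subring (adjoin B z)" "z \<in> adjoin B z"
      using B(1) by (simp_all add: subset_adjoin is_subring_adjoin mem_adjoin)
    moreover from this have "algebraic_over (adjoin B z) y" if "y \<in> insert z Z" for y
      using that B(3) algebraic_over_mono[of B "adjoin B z"] algebraic_over_mem[OF _ one_notin_annih] by blast
    ultimately show ?thesis using B(1,2) False by (intro exI[of _ "adjoin B z"]) blast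
  qed
qed

text \<open>Zariski's lemma for the module: if \<open>t\<close> were transcendental over \<open>B'\<close>, then \<open>M\<close> would be finitely
  generated over a localisation \<open>B'[t]\<^sub>f\<close>, and \<open>1 + t f\<close> would have to be invertible there.\<close>

lemma algebraic_if_finitely_generated:
  assumes B0: "is_subring B0" and Z: "finite Z" and V: "finite V" "V \<subseteq> carrier M"
    and gen: "carrier M \<subseteq> loc_span (Z \<union> B0) 1 V" and z: "z \<in> Z"
  shows "algebraic_over B0 z"
proof -
  obtain B where B: "is_subring B" "B0 \<subseteq> B" "\<And>z. z \<in> Z \<Longrightarrow> algebraic_over B z"
    "B = B0 \<or> (\<exists>B' t. is_subring B' \<and> B = adjoin B' t \<and> \<not> algebraic_over B' t)"
    using exists_purely_transcendental_subring[OF Z B0] by blast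
  have "B = B0"
  proof (rule ccontr)
    assume "B \<noteq> B0"
    with B(4) obtain B' t where B': "is_subring B'" "B = adjoin B' t" "\<not> algebraic_over B' t" by blast
    note pc = polys_over_closed[OF B'(1)]
    have "1 \<in> B - annih" using B(1) one_notin_annih is_subring_closed(2) by auto
    from loc_span_remove_all_algebraic[OF B(1) Z B(3) V this]
    obtain f' V' where f': "f' \<in> B - annih" and V': "finite V'" "V' \<subseteq> carrier M"
      and sub: "loc_span (Z \<union> B) 1 V \<subseteq> loc_span B f' V'" by blast
    from f' B'(2) obtain F0 where F0: "F0 \<in> polys_over B'" "f' = poly F0 t" by (auto simp: adjoin_def)
    have "\<exists>i. coeff F0 i \<notin> annih" using f' F0(2) poly_in_annih[of F0 t] by auto
    from exists_lead_coeff_notin_annih[OF B'(1) F0(1) this]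
    obtain F where F: "F \<in> polys_over B'" "lead_coeff F \<notin> annih" "\<And>i. coeff (F0 - F) i \<in> annih" by blast
    \<comment> \<open>As in Euclid's proof of the infinitude of primes, \<open>g\<close> is coprime
      to the denominator \<open>f\<close>, so inverting \<open>f\<close> cannot make
      \<open>g\<close> invertible.\<close>
    define f g where "f = poly F t" and "g = 1 + t * f"
    have ff': "f' - f \<in> annih" using poly_in_annih[OF F(3), of t] by (simp add: F0 f_def)
    have f: "f \<in> B - annih" using F(1) f' annih_diff_iff[OF ff'] by (auto simp: f_def B'(2) adjoin_def)
    have gF: "1 + pCons 0 F \<in> polys_over B'"
      using F(1) is_subring_closed(1)[OF B'(1)] by (intro pc(5) pc(2) pc(8))
    have g_poly: "poly (1 + pCons 0 F) t = g" by (simp add: g_def f_def)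
    have "F \<noteq> 0" using F(2) annih_closed(1) by auto
    then have "coeff (1 + pCons 0 F) (Suc (degree F)) \<notin> annih" using F(2) by (simp add: coeff_1)
    then have "g \<notin> annih" using B'(3) gF g_poly unfolding algebraic_over_def by blast
    moreover have "g \<in> B" unfolding B'(2) adjoin_def using gF g_poly by (metis imageI)
    ultimately have g: "g \<in> B - annih" by simp
    have "carrier M \<subseteq> loc_span (Z \<union> B) 1 V"
      using gen loc_span_mono[of "Z \<union> B0" "Z \<union> B" 1 V] B(2) by blast
    then have "carrier M \<subseteq> loc_span B f V'" using sub loc_span_cong[OF ff', of B V'] by blast
    from power_diff_multiple_in_annih[OF B(1) f g V' this]
    obtain n c where "c \<in> B" and c: "f ^ n - g * c \<in> annih" by blast
    then obtain C where C: "C \<in> polys_over B'" "c = poly C t" by (auto simp: B'(2) adjoin_def)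
    have "F ^ n - (1 + pCons 0 F) * C \<in> polys_over B'"
      using F(1) C(1) gF by (intro pc(3) pc(4) pc(6))
    moreover have "poly (F ^ n - (1 + pCons 0 F) * C) t \<in> annih"
      using c by (simp add: g_poly[symmetric] f_def C(2))
    \<comment> \<open>A relation between values at \<open>t\<close> lifts to all coefficients
      because \<open>t\<close> is transcendental over \<open>B'\<close>.\<close>
    ultimately have "coeff (F ^ n - (1 + pCons 0 F) * C) i \<in> annih" for i
      using B'(3) unfolding algebraic_over_def by blast
    with F(2) show False by (rule coeff_power_diff_notin_annih)
  qed
  with B(3) z show ?thesis by blast
qed

text \<open>An equation for \<open>z\<close> splits into linear factors over \<open>'k\<close>. Its
  value at \<open>z\<close> lies in the prime ideal \<open>annih\<close>, hence so does some factor
  \<open>z - \<kappa> c\<close>.\<close>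

lemma algebraic_over_range_imp_scalar:
  fixes \<kappa> :: "'k::alg_closed_field \<Rightarrow> 'c"
  assumes \<kappa>: "\<And>a b. \<kappa> (a + b) = \<kappa> a + \<kappa> b" "\<And>a b. \<kappa> (a * b) = \<kappa> a * \<kappa> b" "\<kappa> 1 = 1"
    and z: "algebraic_over (range \<kappa>) z"
  shows "\<exists>c. z - \<kappa> c \<in> annih"
proof -
  have \<kappa>0: "\<kappa> 0 = 0" using \<kappa>(1)[of 0 0] by simp
  have unit: "\<kappa> a \<notin> annih" if "a \<noteq> 0" for a
    using annih_closed(5)[of "\<kappa> a" "\<kappa> (inverse a)"] \<kappa>(2)[of a "inverse a"] \<kappa>(3) that one_notin_annih by auto
  define e where "e p = poly (map_poly \<kappa> p) z" for p
  have e_pCons: "e (pCons a p) = \<kappa> a + z * e p" for a p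
    by (simp add: e_def map_poly_pCons \<kappa>0)
  have e_smult: "e (smult a p) = \<kappa> a * e p" for a p
    by (induction p) (simp_all add: e_pCons \<kappa>(2) algebra_simps, simp add: e_def)
  have e_add: "e (p + r) = e p + e r" for p r
    by (induction p r rule: poly_induct2) (simp_all add: e_pCons \<kappa>(1) algebra_simps, simp add: e_def)
  obtain p where p: "p \<in> polys_over (range \<kappa>)" "\<exists>i. coeff p i \<notin> annih" "poly p z \<in> annih"
    using z by (auto simp: algebraic_over_def)
  \<comment> \<open>Roots are available for polynomials over \<open>'k\<close>, so the coefficients
    are pulled back along the injective map \<open>\<kappa>\<close>.\<close>
  define p0 where "p0 = map_poly (inv_into UNIV \<kappa>) p"
  have "inj \<kappa>"
  proof (rule injI)
    fix a b assume "\<kappa> a = \<kappa> b"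
    then have "\<kappa> (a - b) = 0" using \<kappa>(1)[of "a - b" b] by simp
    then show "a = b" using unit[of "a - b"] annih_closed(1) by auto
  qed
  then have "inv_into UNIV \<kappa> 0 = 0" using \<kappa>0 inv_f_f by metis
  then have "map_poly \<kappa> p0 = p" using p(1)
    by (intro poly_eqI) (simp add: p0_def coeff_map_poly \<kappa>0 polys_over_def f_inv_into_f)
  then have "e p0 \<in> annih" "p0 \<noteq> 0" using p annih_closed(1) by (auto simp: e_def)
  then show ?thesis
  proof (induction "degree p0" arbitrary: p0 rule: less_induct)
    case less
    show ?case
    proof (cases "degree p0 = 0")
      case True
      then obtain a where "p0 = [:a:]" using degree_eq_zeroE by blast
      then have "\<kappa> a \<in> annih" "a \<noteq> 0" using less.prems by (auto simp: e_def map_poly_pCons \<kappa>0)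
      with unit show ?thesis by blast
    next
      case False
      then obtain c where "poly p0 c = 0" using alg_closed_imp_poly_has_root by blast
      then obtain r where r: "p0 = [:- c, 1:] * r" using poly_eq_0_iff_dvd by blast
      then have "r \<noteq> 0" using less.prems by auto
      then have "degree r < degree p0" by (subst r, subst degree_mult_eq) auto
      \<comment> \<open>Multiplication by X - c is spelt out as a shift plus a scalar multiple, so
        the rules of \<open>e\<close> for sums, scalar multiples and shifts suffice to evaluate
        it.\<close>
      have "p0 = smult (- c) r + pCons 0 r" unfolding r by simp
      then have "e p0 = \<kappa> (- c) * e r + z * e r" by (simp only: e_add e_smult e_pCons \<kappa>0 add_0)
      also have "\<kappa> (- c) = - \<kappa> c" using \<kappa>(1)[of "- c" c] \<kappa>0 by (simp add: add_eq_0_iff)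
      finally have "e p0 = (z - \<kappa> c) * e r" by (simp add: algebra_simps)
      with less.prems have "z - \<kappa> c \<in> annih \<or> e r \<in> annih" using annih_prime by metis
      with less.hyps[OF \<open>degree r < degree p0\<close>] \<open>r \<noteq> 0\<close> show ?thesis by blast
    qed
  qed
qed

end

section \<open>Extending an action by a commuting operator\<close>

text \<open>Horner evaluation in which the variable acts as \<open>U\<close>. Coefficients may come
  from any commutative ring type, and \<open>'p poly\<close> is one again, so several commuting
  operators can be adjoined by iteration.\<close>

definition poly_act :: "('v, 'm) ring_scheme \<Rightarrow> ('p::comm_ring_1 \<Rightarrow> 'v \<Rightarrow> 'v) \<Rightarrow> ('v \<Rightarrow> 'v) \<Rightarrow> 'p poly \<Rightarrow> 'v \<Rightarrow> 'v" where
  "poly_act M act U p v = fold_coeffs (\<lambda>a w. act a v \<oplus>\<^bsub>M\<^esub> U w) p \<zero>\<^bsub>M\<^esub>"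

definition additive_on :: "('v, 'm) ring_scheme \<Rightarrow> ('v \<Rightarrow> 'v) \<Rightarrow> bool" where
  "additive_on M U \<longleftrightarrow> (\<forall>x\<in>carrier M. U x \<in> carrier M) \<and>
     (\<forall>x\<in>carrier M. \<forall>y\<in>carrier M. U (x \<oplus>\<^bsub>M\<^esub> y) = U x \<oplus>\<^bsub>M\<^esub> U y)"

definition commuting_on :: "('v, 'm) ring_scheme \<Rightarrow> ('v \<Rightarrow> 'v) \<Rightarrow> ('v \<Rightarrow> 'v) \<Rightarrow> bool" where
  "commuting_on M U T \<longleftrightarrow> (\<forall>x\<in>carrier M. U (T x) = T (U x))"

context comm_ring_action
begin

lemma additive_on_zero: "additive_on M U \<Longrightarrow> U \<zero> = \<zero>"
  unfolding additive_on_def by (metis add.l_cancel_one' l_zero zero_closed)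

lemma poly_act_pCons:
  assumes U: "additive_on M U" and v: "v \<in> carrier M"
  shows "poly_act M act U (pCons a p) v = act a v \<oplus> U (poly_act M act U p v)"
proof (cases "p = 0 \<and> a = 0")
  case True
  then show ?thesis using additive_on_zero[OF U] v by (simp add: poly_act_def)
next
  case False
  then show ?thesis
    by (cases "p = 0") (simp_all add: poly_act_def)
qed

lemma poly_act_0: "poly_act M act U 0 v = \<zero>"
  by (simp add: poly_act_def)

lemma poly_act_commutes:
  assumes U: "additive_on M U" and T: "additive_on M T" "commuting_on M T U" "\<And>a. commuting_on M T (act a)"
  shows "commuting_on M T (poly_act M act U p)"
proof -
  have c: "poly_act M act U p x \<in> carrier M" if "x \<in> carrier M" for p x
    by (induction p) (use U that in \<open>auto simp: poly_act_0 poly_act_pCons additive_on_def\<close>)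
  show ?thesis
    by (induction p)
      (use U T c additive_on_zero[OF T(1)] in \<open>auto simp: commuting_on_def poly_act_0 poly_act_pCons additive_on_def\<close>)
qed

lemma comm_ring_action_poly_act:
  assumes U: "additive_on M U" "\<And>a. commuting_on M U (act a)"
  shows "comm_ring_action M (poly_act M act U)"
proof -
  let ?P = "poly_act M act U"
  have Uc: "x \<in> carrier M \<Longrightarrow> U x \<in> carrier M"
    and Ua: "x \<in> carrier M \<Longrightarrow> y \<in> carrier M \<Longrightarrow> U (x \<oplus> y) = U x \<oplus> U y"
    and Um: "x \<in> carrier M \<Longrightarrow> U (act a x) = act a (U x)" for x y a
    using U by (auto simp: additive_on_def commuting_on_def)
  note P = poly_act_pCons[OF U(1)]
  have c: "?P p x \<in> carrier M" if "x \<in> carrier M" for p x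
    by (induction p) (use that in \<open>auto simp: poly_act_0 P Uc\<close>)
  have add: "?P (p + r) x = ?P p x \<oplus> ?P r x" if "x \<in> carrier M" for p r x
    by (induction p r rule: poly_induct2)
      (use that c in \<open>simp_all add: poly_act_0 P act_add_left Ua Uc a_ac\<close>)
  have smult: "?P (smult a p) x = act a (?P p x)" if "x \<in> carrier M" for a p x
    by (induction p) (use that c in \<open>simp_all add: poly_act_0 P act_add_right act_mult Um Uc\<close>)
  have mult: "?P (p * r) x = ?P p (?P r x)" if "x \<in> carrier M" for p r x
    by (induction p) (use that c in \<open>simp_all add: poly_act_0 P add smult mult_pCons_left Uc\<close>)
  show ?thesis
  proof unfold_locales
    fix x y p assume "x \<in> carrier M" "y \<in> carrier M"
    then show "?P p (x \<oplus> y) = ?P p x \<oplus> ?P p y"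
      by (induction p) (simp_all add: poly_act_0 P act_add_right Ua Uc a_ac c)
  qed (use c add mult additive_on_zero[OF U(1)] in \<open>auto simp: P poly_act_0 one_pCons\<close>)
qed

lemma poly_act_const:
  "additive_on M U \<Longrightarrow> x \<in> carrier M \<Longrightarrow> poly_act M act U [:a:] x = act a x"
  using additive_on_zero[of U] by (simp add: poly_act_pCons poly_act_0)

lemma poly_act_X:
  "additive_on M U \<Longrightarrow> x \<in> carrier M \<Longrightarrow> poly_act M act U [:0, 1:] x = U x"
  using additive_on_zero[of U] by (simp add: poly_act_pCons poly_act_0 additive_on_def)

end

text \<open>Linear factors of \<open>p\<close> are split off until the cofactor no longer kills
  \<open>x\<close>. The eigenvector has the form \<open>act r x\<close>, so it inherits the
  eigenvalue equations of \<open>x\<close> for additive operators that commute with the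
  action.\<close>

lemma exists_eigenvector:
  fixes act :: "'k::alg_closed_field poly \<Rightarrow> 'v \<Rightarrow> 'v"
  assumes "comm_ring_action M act" and x: "x \<in> carrier M" "x \<noteq> \<zero>\<^bsub>M\<^esub>"
    and "p \<noteq> 0" "act p x = \<zero>\<^bsub>M\<^esub>"
  shows "\<exists>r c. act r x \<noteq> \<zero>\<^bsub>M\<^esub> \<and> act [:- c, 1:] (act r x) = \<zero>\<^bsub>M\<^esub>"
  using assms(4,5)
proof (induction "degree p" arbitrary: p rule: less_induct)
  case less
  interpret comm_ring_action M act by fact
  show ?case
  proof (cases "degree p = 0")
    case True
    then obtain a where a: "p = [:a:]" using degree_eq_zeroE by blast
    then have "[:inverse a:] * p = 1" using less.prems(1) by (simp add: one_pCons)
    then have "x = act [:inverse a:] (act p x)" using x by (metis act_mult act_one)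
    with less.prems(2) x(2) show ?thesis by simp
  next
    case False
    then obtain c where "poly p c = 0" using alg_closed_imp_poly_has_root by blast
    then obtain r where r: "p = [:- c, 1:] * r" using poly_eq_0_iff_dvd by blast
    then have "r \<noteq> 0" using less.prems(1) by auto
    then have "degree r < degree p" by (subst r, subst degree_mult_eq) auto
    moreover have "act [:- c, 1:] (act r x) = \<zero>\<^bsub>M\<^esub>" using less.prems(2) x by (simp only: r act_mult)
    ultimately show ?thesis using less.hyps[of r] \<open>r \<noteq> 0\<close> by blast
  qed
qed

section \<open>Powers, commutation and orbits of operators\<close>

context comm_ring_action
begin

lemma funpow_closed: "additive_on M S \<Longrightarrow> x \<in> carrier M \<Longrightarrow> (S ^^ i) x \<in> carrier M"
  by (induction i) (auto simp: additive_on_def)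

lemma additive_on_funpow: "additive_on M S \<Longrightarrow> additive_on M (S ^^ i)"
  by (induction i) (auto simp: additive_on_def)

lemma additive_on_comp: "additive_on M S \<Longrightarrow> additive_on M S' \<Longrightarrow> additive_on M (\<lambda>x. S (S' x))"
  by (auto simp: additive_on_def)

lemma additive_on_minus:
  assumes "additive_on M S" "x \<in> carrier M" shows "S (\<ominus> x) = \<ominus> S x"
proof -
  have "S (\<ominus> x) \<oplus> S x = \<zero>"
    using assms additive_on_zero[OF assms(1)] l_neg[OF assms(2)] unfolding additive_on_def by (metis a_inv_closed)
  then show ?thesis using assms by (intro minus_equality[symmetric]) (auto simp: additive_on_def)
qed

lemma additive_on_diff: "additive_on M S \<Longrightarrow> additive_on M S' \<Longrightarrow> additive_on M (\<lambda>x. S x \<ominus> S' x)"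
  by (auto simp: additive_on_def minus_eq minus_add a_ac)

lemma commuting_on_funpow:
  "additive_on M S \<Longrightarrow> commuting_on M C S \<Longrightarrow> commuting_on M C (S ^^ i)"
  by (induction i) (auto simp: commuting_on_def funpow_closed)

lemma commuting_on_comp:
  "additive_on M S' \<Longrightarrow> commuting_on M C S \<Longrightarrow> commuting_on M C S' \<Longrightarrow> commuting_on M C (\<lambda>x. S (S' x))"
  by (auto simp: commuting_on_def additive_on_def)

lemma commuting_on_diff:
  "additive_on M C \<Longrightarrow> additive_on M S \<Longrightarrow> additive_on M S' \<Longrightarrow> commuting_on M C S \<Longrightarrow> commuting_on M C S'
    \<Longrightarrow> commuting_on M C (\<lambda>x. S x \<ominus> S' x)"
  using additive_on_minus[of C] by (auto simp: commuting_on_def additive_on_def minus_eq)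

definition orbit :: "('a \<Rightarrow> 'a) \<Rightarrow> nat \<Rightarrow> 'a set \<Rightarrow> 'a set" where
  "orbit S m V = (\<lambda>(i, v). (S ^^ i) v) ` ({..<m} \<times> V)"

lemma orbit_closed: "additive_on M S \<Longrightarrow> V \<subseteq> carrier M \<Longrightarrow> orbit S m V \<subseteq> carrier M"
  by (auto simp: orbit_def intro: funpow_closed)

text \<open>Since \<open>S ^^ m\<close> is the action of the ring element \<open>z\<close>, the
  powers of \<open>S\<close> below \<open>m\<close> generate as much as all powers do. With
  denominator 1 the span is the ordinary span over the ring generated by \<open>Q\<close>.\<close>

lemma
  assumes V: "V \<subseteq> carrier M" and S: "additive_on M S" "\<And>p. commuting_on M S (act p)"
    and z: "z \<in> Q" "\<And>x. x \<in> carrier M \<Longrightarrow> (S ^^ m) x = act z x" and m: "m > 0" and Q: "1 \<in> Q"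
  shows loc_span_orbit_closed: "x \<in> loc_span Q 1 (orbit S m V) \<Longrightarrow> S x \<in> loc_span Q 1 (orbit S m V)"
    and loc_span_orbit_funpow: "x \<in> loc_span Q 1 V \<Longrightarrow> (S ^^ i) x \<in> loc_span Q 1 (orbit S m V)"
    and loc_span_orbit_map: "x \<in> loc_span Q 1 (orbit S m V) \<Longrightarrow> additive_on M U \<Longrightarrow> (\<And>p. commuting_on M U (act p)) \<Longrightarrow>
      (\<And>v i. v \<in> V \<Longrightarrow> U ((S ^^ i) v) \<in> loc_span Q 1 (orbit S m V)) \<Longrightarrow> U x \<in> loc_span Q 1 (orbit S m V)"
proof -
  let ?R = "loc_span Q 1 (orbit S m V)"
  note oc = orbit_closed[OF S(1) V]
  have map: "U x \<in> ?R" if "x \<in> loc_span Q 1 W" "W \<subseteq> carrier M" "additive_on M U" "\<And>p. commuting_on M U (act p)"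
      "\<And>v. v \<in> W \<Longrightarrow> U v \<in> ?R" for U W x
  proof -
    have "U x \<in> loc_span Q (1 * 1) (orbit S m V)"
      by (rule loc_span_map[OF that(1,2) oc])
        (use that Q in \<open>auto simp: additive_on_def commuting_on_def intro: loc_span.act\<close>)
    then show ?thesis by simp
  qed
  have mem: "(S ^^ i) v \<in> ?R" if "i < m" "v \<in> V" for i v
    using that by (intro loc_span.gen) (auto simp: orbit_def)
  have S_closed: "S x \<in> ?R" if "x \<in> ?R" for x
  proof (rule map[OF that oc S])
    fix w assume "w \<in> orbit S m V"
    then obtain i v where w: "i < m" "v \<in> V" "w = (S ^^ i) v" by (auto simp: orbit_def)
    show "S w \<in> ?R"
    proof (cases "Suc i = m")
      case True
      then have "S w = act z v" using z(2)[of v] w V by auto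
      then show ?thesis using mem[OF m w(2)] z(1) by (auto intro: loc_span.act)
    next
      case False
      then show ?thesis using mem[of "Suc i" v] w by auto
    qed
  qed
  then show "x \<in> ?R \<Longrightarrow> S x \<in> ?R" .
  have i_closed: "(S ^^ i) x \<in> ?R" if "x \<in> ?R" for x i
    by (induction i) (use that S_closed in auto)
  show "(S ^^ i) x \<in> ?R" if "x \<in> loc_span Q 1 V" for x i
  proof (rule i_closed)
    show "x \<in> ?R"
      by (rule map[OF that V, where U = "\<lambda>x. x"])
        (use mem[OF m] in \<open>auto simp: additive_on_def commuting_on_def\<close>)
  qed
  show "U x \<in> ?R" if "x \<in> ?R" "additive_on M U" "\<And>p. commuting_on M U (act p)"
      "\<And>v i. v \<in> V \<Longrightarrow> U ((S ^^ i) v) \<in> ?R" for x U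
    by (rule map[OF that(1) oc that(2,3)]) (use that(4) in \<open>auto simp: orbit_def\<close>)
qed

end

section \<open>Representations of the algebra of quantum matrices\<close>

text \<open>\<open>T g x\<close> stands for the right action of a generator on \<open>x\<close>, so
  operators compose in the reverse order: the product Z12 Z11 acts as \<open>T Z12\<close> first and
  \<open>T Z11\<close> second.\<close>

locale mat2_rep = comm_ring_action M scal
  for M :: "('v, 'm) ring_scheme" (structure) and scal :: "'k::field \<Rightarrow> 'v \<Rightarrow> 'v" +
  fixes q :: 'k and m :: nat and T :: "gen \<Rightarrow> 'v \<Rightarrow> 'v"
  assumes T_additive: "additive_on M (T g)" and T_scal: "x \<in> carrier M \<Longrightarrow> T g (scal c x) = scal c (T g x)"
    and rel1: "x \<in> carrier M \<Longrightarrow> T Z11 (T Z12 x) = T Z12 (T Z11 x)"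
    and rel2: "x \<in> carrier M \<Longrightarrow> T Z11 (T Z21 x) = scal q (T Z21 (T Z11 x))"
    and rel3: "x \<in> carrier M \<Longrightarrow> T Z21 (T Z22 x) = T Z22 (T Z21 x)"
    and rel4: "x \<in> carrier M \<Longrightarrow> T Z12 (T Z22 x) = scal q (T Z22 (T Z12 x))"
    and rel5: "x \<in> carrier M \<Longrightarrow> T Z12 (T Z21 x) = scal q (T Z21 (T Z12 x))"
    and rel6: "x \<in> carrier M \<Longrightarrow> T Z11 (T Z22 x) = T Z22 (T Z11 x) \<oplus> scal (q - 1) (T Z21 (T Z12 x))"
    and prim: "primitive_root_of_unity m q"
begin

lemma m_pos: "m > 0" and q_m: "q ^ m = 1" and q_nz: "q \<noteq> 0"
  using prim by (auto simp: primitive_root_of_unity_def power_0_left)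

lemma T_closed [simp]: "x \<in> carrier M \<Longrightarrow> T g x \<in> carrier M"
  using T_additive by (simp add: additive_on_def)

lemma T_add: "x \<in> carrier M \<Longrightarrow> y \<in> carrier M \<Longrightarrow> T g (x \<oplus> y) = T g x \<oplus> T g y"
  using T_additive by (simp add: additive_on_def)

lemma T_minus: "x \<in> carrier M \<Longrightarrow> T g (\<ominus> x) = \<ominus> T g x"
  using T_additive additive_on_minus by blast

lemma T_diff: "x \<in> carrier M \<Longrightarrow> y \<in> carrier M \<Longrightarrow> T g (x \<ominus> y) = T g x \<ominus> T g y"
  by (simp add: minus_eq T_add T_minus)

lemma Tpow_closed [simp]: "x \<in> carrier M \<Longrightarrow> (T g ^^ n) x \<in> carrier M"
  using funpow_closed T_additive by blast

lemma scal_scal: "x \<in> carrier M \<Longrightarrow> scal a (scal b x) = scal (a * b) x"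
  by (simp add: act_mult)

lemma scal_cancel: "a \<noteq> 0 \<Longrightarrow> x \<in> carrier M \<Longrightarrow> y \<in> carrier M \<Longrightarrow> scal a x = scal a y \<Longrightarrow> x = y"
  by (metis act_mult act_one left_inverse)

lemma scal_eq_zero: "a \<noteq> 0 \<Longrightarrow> x \<in> carrier M \<Longrightarrow> scal a x = \<zero> \<longleftrightarrow> x = \<zero>"
  using scal_cancel[of a x \<zero>] by auto

text \<open>\<open>V\<close> is the operator of Z12 Z21, and \<open>D\<close> is the one of det_q.
  Both are normal, and the torsionfreeness hypotheses refer to them.\<close>

definition V :: "'v \<Rightarrow> 'v" where "V x = T Z21 (T Z12 x)"

definition D :: "'v \<Rightarrow> 'v" where "D x = T Z22 (T Z11 x) \<ominus> T Z21 (T Z12 x)"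

lemma V_closed [simp]: "x \<in> carrier M \<Longrightarrow> V x \<in> carrier M" by (simp add: V_def)
lemma D_closed [simp]: "x \<in> carrier M \<Longrightarrow> D x \<in> carrier M" by (simp add: D_def)

lemma D_eq: "x \<in> carrier M \<Longrightarrow> D x = T Z22 (T Z11 x) \<ominus> V x" by (simp add: D_def V_def)

lemma V_additive: "additive_on M V"
  unfolding V_def[abs_def] by (rule additive_on_comp[OF T_additive T_additive])

lemma D_additive: "additive_on M D"
  unfolding D_def[abs_def] 
  by (rule additive_on_diff[OF additive_on_comp[OF T_additive T_additive] additive_on_comp[OF T_additive T_additive]])

lemma V_scal: "x \<in> carrier M \<Longrightarrow> V (scal c x) = scal c (V x)"
  by (simp add: V_def T_scal)

lemma D_scal: "x \<in> carrier M \<Longrightarrow> D (scal c x) = scal c (D x)"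
  by (simp add: D_def T_scal act_diff_right)

lemma Z11_Z22: "x \<in> carrier M \<Longrightarrow> T Z22 (T Z11 x) = D x \<oplus> V x"
  by (simp add: D_eq minus_eq a_assoc l_neg)

lemma Z22_Z11:
  assumes "x \<in> carrier M" shows "T Z11 (T Z22 x) = D x \<oplus> scal q (V x)"
proof -
  have "scal q (V x) = V x \<oplus> scal (q - 1) (V x)" using assms act_add_left[of "V x" 1 "q - 1"] by simp
  then show ?thesis using assms by (simp add: rel6 Z11_Z22 V_def[symmetric] a_assoc)
qed

lemma V_T:
  assumes "x \<in> carrier M"
  shows "T Z11 (V x) = scal q (V (T Z11 x))" "T Z12 (V x) = scal q (V (T Z12 x))"
    "V (T Z21 x) = scal q (T Z21 (V x))" "V (T Z22 x) = scal q (T Z22 (V x))"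
  using assms by (simp_all add: V_def rel1 rel2 rel3 rel4 rel5 T_scal)

lemma D_T:
  assumes "x \<in> carrier M"
  shows "T Z11 (D x) = D (T Z11 x)" "T Z12 (D x) = scal q (D (T Z12 x))"
    "D (T Z21 x) = scal q (T Z21 (D x))" "D (T Z22 x) = T Z22 (D x)"
proof -
  show "T Z12 (D x) = scal q (D (T Z12 x))"
    using assms by (simp add: D_eq T_diff rel4 rel1 V_T act_diff_right)
  show "D (T Z21 x) = scal q (T Z21 (D x))"
    using assms by (simp add: D_eq T_diff rel2 rel3 V_T act_diff_right T_scal)
  \<comment> \<open>Commutation of \<open>D\<close> with Z11 and Z22 comes from associativity: Z11
    Z22 Z11 is evaluated once with \<open>Z11_Z22\<close> and once with \<open>Z22_Z11\<close>, and
    the terms with \<open>V\<close> cancel by \<open>V_T\<close>. The product Z22 Z11 Z22 is treated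
    alike.\<close>
  have "T Z11 (T Z22 (T Z11 x)) = T Z11 (D x) \<oplus> T Z11 (V x)"
    using assms by (simp add: Z11_Z22 T_add)
  moreover have "T Z11 (T Z22 (T Z11 x)) = D (T Z11 x) \<oplus> scal q (V (T Z11 x))"
    using assms by (simp add: Z22_Z11)
  ultimately show "T Z11 (D x) = D (T Z11 x)" using assms by (simp add: V_T)
  have "T Z22 (T Z11 (T Z22 x)) = D (T Z22 x) \<oplus> V (T Z22 x)"
    using assms by (simp add: Z11_Z22)
  moreover have "T Z22 (T Z11 (T Z22 x)) = T Z22 (D x) \<oplus> T Z22 (scal q (V x))"
    using assms by (simp add: Z22_Z11 T_add)
  ultimately show "D (T Z22 x) = T Z22 (D x)" using assms by (simp add: V_T T_scal)
qed

text \<open>The factors are restricted to m-th roots of unity so that they disappear in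
  \<open>U ^^ m\<close>, which thus becomes central.\<close>

definition normal_op :: "('v \<Rightarrow> 'v) \<Rightarrow> bool" where
  "normal_op U \<longleftrightarrow> additive_on M U \<and> (\<forall>c. \<forall>x\<in>carrier M. U (scal c x) = scal c (U x)) \<and>
     (\<forall>g. \<exists>c. c ^ m = 1 \<and> (\<forall>x\<in>carrier M. U (T g x) = scal c (T g (U x))))"

lemma normal_opI:
  assumes U: "additive_on M U" "\<And>c x. x \<in> carrier M \<Longrightarrow> U (scal c x) = scal c (U x)"
    and T: "\<And>g. \<exists>c\<in>{1, q, inverse q}. \<forall>x\<in>carrier M. U (T g x) = scal c (T g (U x))"
  shows "normal_op U"
proof -
  have "c ^ m = 1" if "c \<in> {1, q, inverse q}" for c using that q_m by (auto simp: power_inverse)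
  then show ?thesis using U T unfolding normal_op_def by meson
qed

lemma normal_op_V: "normal_op V"
proof (rule normal_opI[OF V_additive V_scal])
  show "\<exists>c\<in>{1, q, inverse q}. \<forall>x\<in>carrier M. V (T g x) = scal c (T g (V x))" for g
    by (cases g) (simp_all add: V_T scal_scal q_nz)
qed

lemma normal_op_D: "normal_op D"
proof (rule normal_opI[OF D_additive D_scal])
  show "\<exists>c\<in>{1, q, inverse q}. \<forall>x\<in>carrier M. D (T g x) = scal c (T g (D x))" for g
    by (cases g) (simp_all add: D_T scal_scal q_nz)
qed

lemma normal_op_Z12: "normal_op (T Z12)"
proof (rule normal_opI[OF T_additive T_scal])
  show "\<exists>c\<in>{1, q, inverse q}. \<forall>x\<in>carrier M. T Z12 (T g x) = scal c (T g (T Z12 x))" for g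
    by (cases g) (simp_all add: rel1 rel4 rel5)
qed

lemma normal_op_Z21: "normal_op (T Z21)"
proof (rule normal_opI[OF T_additive T_scal])
  show "\<exists>c\<in>{1, q, inverse q}. \<forall>x\<in>carrier M. T Z21 (T g x) = scal c (T g (T Z21 x))" for g
    by (cases g) (simp_all add: rel2 rel3 rel5 scal_scal q_nz)
qed

lemma normal_op_funpow:
  assumes "additive_on M U" "x \<in> carrier M" "\<And>c x. x \<in> carrier M \<Longrightarrow> U (scal c x) = scal c (U x)"
    "\<And>x. x \<in> carrier M \<Longrightarrow> U (T g x) = scal c (T g (U x))"
  shows "(U ^^ n) (T g x) = scal (c ^ n) (T g ((U ^^ n) x))"
proof (induction n)
  case (Suc n)
  have "(U ^^ n) x \<in> carrier M" "U ((U ^^ n) x) \<in> carrier M"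
    using assms(1,2) funpow_closed[OF assms(1,2)] by (auto simp: additive_on_def)
  with Suc show ?case using assms(3,4) by (simp add: scal_scal mult.commute)
qed (use assms in simp)

definition central_op :: "('v \<Rightarrow> 'v) \<Rightarrow> bool" where
  "central_op U \<longleftrightarrow> additive_on M U \<and> (\<forall>c. commuting_on M U (scal c)) \<and> (\<forall>g. commuting_on M U (T g))"

lemma central_op_if_normal_op:
  assumes "normal_op U" shows "central_op (U ^^ m)"
proof -
  have U: "additive_on M U" "\<And>c x. x \<in> carrier M \<Longrightarrow> U (scal c x) = scal c (U x)"
    using assms by (auto simp: normal_op_def)
  have "commuting_on M (U ^^ m) (T g)" for g
  proof -
    obtain c where "c ^ m = 1" "\<And>x. x \<in> carrier M \<Longrightarrow> U (T g x) = scal c (T g (U x))"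
      using assms unfolding normal_op_def by blast
    then show ?thesis
      using normal_op_funpow[OF U(1) _ U(2), of _ g c m] by (simp add: commuting_on_def funpow_closed U)
  qed
  moreover have "commuting_on M (U ^^ m) (scal c)" for c
    using commuting_on_funpow[OF U(1), of "scal c" m] U(2) by (auto simp: commuting_on_def)
  ultimately show ?thesis using additive_on_funpow[OF U(1)] by (simp add: central_op_def)
qed

text \<open>Z11 is not normal in general, so the centrality of its m-th power needs its own
  argument: the correction term carries the factor \<open>q ^ Suc n - 1\<close>, which vanishes for
  \<open>Suc n = m\<close>.\<close>

lemma Z22_funpow_Z11:
  assumes "x \<in> carrier M"
  shows "(T Z11 ^^ Suc n) (T Z22 x) = T Z22 ((T Z11 ^^ Suc n) x) \<oplus> scal (q ^ Suc n - 1) (V ((T Z11 ^^ n) x))"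
proof (induction n)
  case 0
  then show ?case using assms by (simp add: rel6 V_def)
next
  case (Suc n)
  have "(T Z11 ^^ Suc (Suc n)) (T Z22 x) = T Z11 ((T Z11 ^^ Suc n) (T Z22 x))" by simp
  also have "\<dots> = T Z11 (T Z22 ((T Z11 ^^ Suc n) x)) \<oplus> scal (q ^ Suc n - 1) (T Z11 (V ((T Z11 ^^ n) x)))"
    unfolding Suc using assms by (simp add: T_add T_scal)
  also have "\<dots> = T Z22 ((T Z11 ^^ Suc (Suc n)) x) \<oplus>
      (scal (q - 1) (V ((T Z11 ^^ Suc n) x)) \<oplus> scal ((q ^ Suc n - 1) * q) (V ((T Z11 ^^ Suc n) x)))"
    using assms by (simp add: rel6 V_T scal_scal V_def[symmetric] a_assoc)
  also have "\<dots> = T Z22 ((T Z11 ^^ Suc (Suc n)) x) \<oplus> scal (q - 1 + (q ^ Suc n - 1) * q) (V ((T Z11 ^^ Suc n) x))"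
    using assms by (simp add: act_add_left)
  also have "q - 1 + (q ^ Suc n - 1) * q = q ^ Suc (Suc n) - 1" by (simp add: algebra_simps)
  finally show ?case .
qed

lemma Z22_funpow_V:
  "x \<in> carrier M \<Longrightarrow> V ((T Z22 ^^ n) x) = scal (q ^ n) ((T Z22 ^^ n) (V x))"
  by (induction n) (simp_all add: V_T T_scal scal_scal mult.commute)

text \<open>The mirror image of \<open>Z22_funpow_Z11\<close>, for the centrality of the m-th power
  of Z22. It also yields the coefficients with which Z11 lowers the first index in the second
  family.\<close>

lemma Z22_funpow_Z11':
  assumes "x \<in> carrier M"
  shows "T Z11 ((T Z22 ^^ Suc n) x) = (T Z22 ^^ Suc n) (T Z11 x) \<oplus> scal (q ^ Suc n - 1) ((T Z22 ^^ n) (V x))"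
proof (induction n)
  case 0
  then show ?case using assms by (simp add: rel6 V_def)
next
  case (Suc n)
  have "T Z11 ((T Z22 ^^ Suc (Suc n)) x) = T Z11 (T Z22 ((T Z22 ^^ Suc n) x))" by simp
  also have "\<dots> = T Z22 (T Z11 ((T Z22 ^^ Suc n) x)) \<oplus> scal (q - 1) (V ((T Z22 ^^ Suc n) x))"
    using assms by (subst rel6) (simp_all add: V_def)
  also have "\<dots> = (T Z22 ^^ Suc (Suc n)) (T Z11 x) \<oplus>
      (scal (q ^ Suc n - 1) ((T Z22 ^^ Suc n) (V x)) \<oplus> scal ((q - 1) * q ^ Suc n) ((T Z22 ^^ Suc n) (V x)))"
    unfolding Suc using assms by (simp add: T_add T_scal Z22_funpow_V[of _ "Suc n", simplified] scal_scal a_assoc)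
  also have "\<dots> = (T Z22 ^^ Suc (Suc n)) (T Z11 x) \<oplus> scal (q ^ Suc n - 1 + (q - 1) * q ^ Suc n) ((T Z22 ^^ Suc n) (V x))"
    using assms V_closed by (simp only: act_add_left Tpow_closed)
  also have "q ^ Suc n - 1 + (q - 1) * q ^ Suc n = q ^ Suc (Suc n) - 1" by (simp add: algebra_simps)
  finally show ?case .
qed

lemma T_funpow_scal: "x \<in> carrier M \<Longrightarrow> (T g ^^ n) (scal c x) = scal c ((T g ^^ n) x)"
  by (induction n) (simp_all add: T_scal)

lemma funpow_swap:
  assumes "\<And>x. x \<in> carrier M \<Longrightarrow> T g (T h x) = scal c (T h (T g x))" "x \<in> carrier M"
  shows "T g ((T h ^^ n) x) = scal (c ^ n) ((T h ^^ n) (T g x))" "(T g ^^ n) (T h x) = scal (c ^ n) (T h ((T g ^^ n) x))"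
  by (induction n) (simp_all add: assms T_scal scal_scal mult.commute)

lemma central_op_Z11: "central_op (T Z11 ^^ m)"
proof -
  obtain n where n: "m = Suc n" using m_pos by (cases m) auto
  have "commuting_on M (T Z11 ^^ m) (T g)" for g
  proof (cases g)
    case Z11 then show ?thesis by (simp add: commuting_on_def funpow_swap1)
  next
    case Z12 then show ?thesis using funpow_swap(2)[of Z11 Z12 1] by (simp add: commuting_on_def rel1)
  next
    case Z21 then show ?thesis using funpow_swap(2)[of Z11 Z21 q _ m] by (simp add: commuting_on_def rel2 q_m)
  next
    case Z22
    then show ?thesis using q_m Z22_funpow_Z11[of _ n] by (simp only: commuting_on_def n) simp
  qed
  moreover have "commuting_on M (T Z11 ^^ m) (scal c)" for c
    by (simp add: commuting_on_def T_funpow_scal)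
  ultimately show ?thesis using additive_on_funpow[OF T_additive] by (simp add: central_op_def)
qed

lemma central_op_Z22: "central_op (T Z22 ^^ m)"
proof -
  obtain n where n: "m = Suc n" using m_pos by (cases m) auto
  have "commuting_on M (T Z22 ^^ m) (T g)" for g
  proof (cases g)
    case Z22 then show ?thesis by (simp add: commuting_on_def funpow_swap1)
  next
    case Z12 then show ?thesis using funpow_swap(1)[of Z12 Z22 q _ m] by (simp add: commuting_on_def rel4 q_m)
  next
    case Z21 then show ?thesis using funpow_swap(1)[of Z21 Z22 1] by (simp add: commuting_on_def rel3)
  next
    case Z11
    then show ?thesis using q_m Z22_funpow_Z11'[of _ n] by (simp only: commuting_on_def n) simp
  qed
  moreover have "commuting_on M (T Z22 ^^ m) (scal c)" for c
    by (simp add: commuting_on_def T_funpow_scal)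
  ultimately show ?thesis using additive_on_funpow[OF T_additive] by (simp add: central_op_def)
qed

end

context mat2_rep
begin

text \<open>Linear independence of the vectors \<open>E s\<close> comes for free later: one nonzero
  vector is enough when the module with the formulas \<open>G\<close> is simple. A zero image is
  covered by \<open>c = 0\<close>.\<close>

definition realises :: "(gen \<Rightarrow> nat \<times> nat \<Rightarrow> 'k vec) \<Rightarrow> (nat \<times> nat \<Rightarrow> 'v) \<Rightarrow> bool" where
  "realises G E \<longleftrightarrow> (\<forall>s\<in>basis_index m. E s \<in> carrier M) \<and> E (0, 0) \<noteq> \<zero> \<and>
     (\<forall>g. \<forall>s\<in>basis_index m. \<exists>c. \<exists>t\<in>basis_index m. G g s = evec c t \<and> T g (E s) = scal c (E t))"

lemma realises_closed: "realises G E \<Longrightarrow> s \<in> basis_index m \<Longrightarrow> E s \<in> carrier M"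
  and realises_nonzero: "realises G E \<Longrightarrow> E (0, 0) \<noteq> \<zero>"
  and realises_gen: "realises G E \<Longrightarrow> s \<in> basis_index m \<Longrightarrow> \<exists>c. \<exists>t\<in>basis_index m. G g s = evec c t \<and> T g (E s) = scal c (E t)"
  unfolding realises_def by blast+

lemma realisesI:
  assumes "\<And>a b. E (a, b) \<in> carrier M" "E (0, 0) \<noteq> \<zero>"
    "\<And>g a b. a < m \<Longrightarrow> b < m \<Longrightarrow> \<exists>c a' b'. a' < m \<and> b' < m \<and> G g (a, b) = evec c (a', b') \<and> T g (E (a, b)) = scal c (E (a', b'))"
  shows "realises G E"
proof -
  have "\<exists>c. \<exists>t\<in>basis_index m. G g s = evec c t \<and> T g (E s) = scal c (E t)" if s: "s \<in> basis_index m" for g s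
  proof -
    obtain a b where ab: "s = (a, b)" "a < m" "b < m" using s by (auto simp: basis_index_def)
    obtain c a' b' where "a' < m" "b' < m" "G g (a, b) = evec c (a', b')" "T g (E (a, b)) = scal c (E (a', b'))"
      using assms(3)[OF ab(2,3)] by blast
    then show ?thesis unfolding ab(1) by (intro exI[of _ c] bexI[of _ "(a', b')"]) (auto simp: basis_index_def)
  qed
  then show ?thesis using assms(1,2) by (auto simp: realises_def)
qed

end

section \<open>Central powers act as scalars\<close>

locale simple_mat2_rep = mat2_rep M scal q m T
  for M :: "('v, 'm) ring_scheme" (structure) and scal :: "'k::alg_closed_field \<Rightarrow> 'v \<Rightarrow> 'v"
    and q :: 'k and m :: nat and T :: "gen \<Rightarrow> 'v \<Rightarrow> 'v" +
  assumes nontrivial: "carrier M \<noteq> {\<zero>}"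
    and simple: "\<And>H. H \<subseteq> carrier M \<Longrightarrow> \<zero> \<in> H \<Longrightarrow> (\<And>x y. x \<in> H \<Longrightarrow> y \<in> H \<Longrightarrow> x \<oplus> y \<in> H) \<Longrightarrow>
      (\<And>c x. x \<in> H \<Longrightarrow> scal c x \<in> H) \<Longrightarrow> (\<And>g x. x \<in> H \<Longrightarrow> T g x \<in> H) \<Longrightarrow> H = {\<zero>} \<or> H = carrier M"
    and D_inj: "x \<in> carrier M \<Longrightarrow> D x = \<zero> \<Longrightarrow> x = \<zero>"
    and V_inj: "x \<in> carrier M \<Longrightarrow> V x = \<zero> \<Longrightarrow> x = \<zero>"
begin

definition central_powers :: "('v \<Rightarrow> 'v) set" where
  "central_powers = {T Z11 ^^ m, T Z12 ^^ m, T Z21 ^^ m, T Z22 ^^ m, D ^^ m, V ^^ m}"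

lemma central_powers_central: "U \<in> central_powers \<Longrightarrow> central_op U"
  unfolding central_powers_def
  using central_op_Z11 central_op_Z22 central_op_if_normal_op normal_op_V normal_op_D normal_op_Z12 normal_op_Z21
  by blast

text \<open>Such operators keep commuting with the acting ring while central powers are adjoined to
  it. The generators and the central powers themselves are of this kind.\<close>

definition compatible :: "('v \<Rightarrow> 'v) \<Rightarrow> bool" where
  "compatible C \<longleftrightarrow> additive_on M C \<and> (\<forall>c. commuting_on M C (scal c)) \<and> (\<forall>U\<in>central_powers. commuting_on M C U)"

lemma compatible_T: "compatible (T g)"
  using central_powers_central T_additive T_scal
  by (auto simp: compatible_def central_op_def commuting_on_def)

lemma compatible_central_power:
  assumes "U \<in> central_powers" shows "compatible U"
proof -
  have U: "additive_on M U" "\<And>c. commuting_on M U (scal c)" "\<And>g. commuting_on M U (T g)"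
    using central_powers_central[OF assms] by (auto simp: central_op_def)
  have "commuting_on M U V"
    unfolding V_def[abs_def] by (rule commuting_on_comp[OF T_additive U(3) U(3)])
  moreover have "commuting_on M U D"
    unfolding D_def[abs_def]
    by (rule commuting_on_diff[OF U(1) additive_on_comp[OF T_additive T_additive] additive_on_comp[OF T_additive T_additive]
        commuting_on_comp[OF T_additive U(3) U(3)] commuting_on_comp[OF T_additive U(3) U(3)]])
  ultimately have "commuting_on M U U'" if "U' \<in> central_powers" for U'
    using that U(3) commuting_on_funpow[of _ U m] T_additive V_additive D_additive
    unfolding central_powers_def by auto
  then show ?thesis using U by (simp add: compatible_def)
qed

text \<open>The invariant of this iteration: \<open>\<kappa>\<close> embeds the scalars into the
  acting ring, and \<open>L\<close> collects the operators already represented by ring elements.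
  Commutation with all compatible operators covers both the next power to be adjoined and the
  generators.\<close>

definition good_action :: "('p::comm_ring_1 \<Rightarrow> 'v \<Rightarrow> 'v) \<Rightarrow> ('k \<Rightarrow> 'p) \<Rightarrow> ('v \<Rightarrow> 'v) set \<Rightarrow> bool" where
  "good_action act \<kappa> L \<longleftrightarrow> comm_ring_action M act \<and> (\<forall>C p. compatible C \<longrightarrow> commuting_on M C (act p)) \<and>
     (\<forall>a b. \<kappa> (a + b) = \<kappa> a + \<kappa> b) \<and> (\<forall>a b. \<kappa> (a * b) = \<kappa> a * \<kappa> b) \<and> \<kappa> 1 = 1 \<and>
     (\<forall>c. \<forall>x\<in>carrier M. act (\<kappa> c) x = scal c x) \<and>
     (\<forall>U\<in>L. \<exists>z. \<forall>x\<in>carrier M. act z x = U x)"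

lemma good_action_scal: "good_action scal (\<lambda>c. c) {}"
  unfolding good_action_def compatible_def using comm_ring_action_axioms by auto

lemma good_action_poly_act:
  assumes "good_action act \<kappa> L" "U \<in> central_powers"
  shows "good_action (poly_act M act U) (\<lambda>c. [:\<kappa> c:]) (insert U L)"
proof -
  interpret A: comm_ring_action M act using assms(1) by (simp add: good_action_def)
  have U: "compatible U" by (rule compatible_central_power[OF assms(2)])
  then have Ua: "additive_on M U" by (simp add: compatible_def)
  have Uc: "commuting_on M U (act p)" for p using assms(1) U by (simp add: good_action_def)
  have "commuting_on M C (poly_act M act U p)" if C: "compatible C" for C p
    using C assms by (intro A.poly_act_commutes[OF Ua]) (auto simp: compatible_def good_action_def)
  moreover have "\<exists>z. \<forall>x\<in>carrier M. poly_act M act U z x = U' x" if U': "U' \<in> insert U L" for U'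
  proof (cases "U' = U")
    case True
    then show ?thesis using A.poly_act_X[OF Ua] by blast
  next
    case False
    then obtain z where "\<forall>x\<in>carrier M. act z x = U' x" using U' assms(1) unfolding good_action_def by blast
    then show ?thesis using A.poly_act_const[OF Ua] by metis
  qed
  ultimately show ?thesis
    using assms(1) A.comm_ring_action_poly_act[OF Ua Uc] A.poly_act_const[OF Ua]
    by (simp add: good_action_def one_pCons)
qed

text \<open>Schur's lemma: kernel and image of \<open>act p\<close> are stable under scalars and
  generators, hence trivial or everything.\<close>

lemma simple_action_if_good:
  assumes "good_action act \<kappa> L" shows "simple_action M act"
proof -
  interpret A: comm_ring_action M act using assms by (simp add: good_action_def)
  have comm: "act p (T g x) = T g (act p x)" if "x \<in> carrier M" for p g x
    using assms compatible_T[of g] that unfolding good_action_def commuting_on_def by metis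
  have sc: "act p (scal c x) = scal c (act p x)" if "x \<in> carrier M" for p c x
    using assms that A.act_commute[OF that, of p "\<kappa> c"] by (simp add: good_action_def)
  have ker: "{x \<in> carrier M. act p x = \<zero>} = {\<zero>} \<or> {x \<in> carrier M. act p x = \<zero>} = carrier M" for p
    by (rule simple) (use additive_on_zero[OF T_additive] in \<open>auto simp: A.act_add_right comm sc\<close>)
  have im: "act p ` carrier M = {\<zero>} \<or> act p ` carrier M = carrier M" for p
  proof (rule simple)
    show "\<zero> \<in> act p ` carrier M" using A.act_zero_right zero_closed by (metis imageI)
    show "x \<oplus> y \<in> act p ` carrier M" if "x \<in> act p ` carrier M" "y \<in> act p ` carrier M" for x y
      using that A.act_add_right by (auto simp: image_iff) (metis a_closed)
    show "scal c x \<in> act p ` carrier M" if "x \<in> act p ` carrier M" for c x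
      using that sc by (auto simp: image_iff) (metis act_closed)
    show "T g x \<in> act p ` carrier M" if "x \<in> act p ` carrier M" for g x
      using that comm by (auto simp: image_iff) (metis T_closed)
  qed auto
  show ?thesis
  proof unfold_locales
    show "carrier M \<noteq> {\<zero>}" by (rule nontrivial)
    fix p x assume p: "p \<notin> A.annih" and x: "x \<in> carrier M"
    then obtain y where y: "y \<in> carrier M" "act p y \<noteq> \<zero>" by (auto simp: A.annih_def)
    then have "{x \<in> carrier M. act p x = \<zero>} \<noteq> carrier M" by blast
    with ker[of p] x show "x = \<zero>" if "act p x = \<zero>" using that by blast
    have "act p ` carrier M \<noteq> {\<zero>}" using y by blast
    with im[of p] x show "\<exists>y\<in>carrier M. x = act p y" by blast
  qed
qed

text \<open>Over the scalars and central powers, the module is spanned by the images of one vector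
  under ordered monomials with exponents below \<open>m\<close>. This finiteness is what Zariski's
  lemma requires.\<close>

lemma central_power_scalar_if_good:
  fixes act :: "'p::comm_ring_1 \<Rightarrow> 'v \<Rightarrow> 'v"
  assumes good: "good_action act \<kappa> central_powers" and U: "U \<in> central_powers"
  shows "\<exists>c. \<forall>x\<in>carrier M. U x = scal c x"
proof -
  interpret A: simple_action M act by (rule simple_action_if_good[OF good])
  have \<kappa>: "\<And>a b. \<kappa> (a + b) = \<kappa> a + \<kappa> b" "\<And>a b. \<kappa> (a * b) = \<kappa> a * \<kappa> b" "\<kappa> 1 = 1"
    "\<And>c x. x \<in> carrier M \<Longrightarrow> act (\<kappa> c) x = scal c x"
    using good by (auto simp: good_action_def)
  have "\<forall>U\<in>central_powers. \<exists>z. \<forall>x\<in>carrier M. act z x = U x" using good by (simp add: good_action_def)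
  then obtain z where z: "\<And>U x. U \<in> central_powers \<Longrightarrow> x \<in> carrier M \<Longrightarrow> act (z U) x = U x" by metis
  define Q where "Q = z ` central_powers \<union> range \<kappa>"
  have "\<kappa> (a - b) = \<kappa> a - \<kappa> b" for a b using \<kappa>(1)[of "a - b" b] by simp
  then have sub: "is_subring (range \<kappa>)"
    unfolding is_subring_def using \<kappa>(2,3) by (auto simp: image_iff) metis+
  have Q1: "1 \<in> Q" using \<kappa>(3) by (force simp: Q_def)
  have T_comm: "commuting_on M (T g) (act p)" for g p
    using good compatible_T by (simp add: good_action_def)
  have zQ: "z U \<in> Q" if "U \<in> central_powers" for U using that by (simp add: Q_def)
  define W where "W = A.loc_span Q 1"
  have W_scal: "scal c x \<in> W B" if "x \<in> W B" "x \<in> carrier M" for c x B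
  proof -
    have "act (\<kappa> c) x \<in> A.loc_span Q 1 B" using that(1) unfolding W_def by (intro A.loc_span.act) (auto simp: Q_def)
    then show ?thesis using \<kappa>(4)[OF that(2)] by (simp add: W_def)
  qed
  have Wc: "x \<in> carrier M" if "x \<in> W B" "B \<subseteq> carrier M" for x B
    using that A.loc_span_closed unfolding W_def by blast
  have pow: "(T h ^^ m) \<in> central_powers" for h by (cases h) (simp_all add: central_powers_def)
  have orb_closed: "T h x \<in> W (orbit (T h) m B)" if "B \<subseteq> carrier M" "x \<in> W (orbit (T h) m B)" for h x B
    using A.loc_span_orbit_closed[OF that(1) T_additive T_comm zQ[OF pow] z[OF pow, symmetric] m_pos Q1] that(2)
    unfolding W_def by blast
  have orb_pow: "(T h ^^ i) x \<in> W (orbit (T h) m B)" if "B \<subseteq> carrier M" "x \<in> W B" for h x B i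
    using A.loc_span_orbit_funpow[OF that(1) T_additive T_comm zQ[OF pow] z[OF pow, symmetric] m_pos Q1] that(2)
    unfolding W_def by blast
  have orb_map: "T g x \<in> W (orbit (T h) m B)"
    if "B \<subseteq> carrier M" "x \<in> W (orbit (T h) m B)" "\<And>v i. v \<in> B \<Longrightarrow> T g ((T h ^^ i) v) \<in> W (orbit (T h) m B)" for g h x B
    using A.loc_span_orbit_map[OF that(1) T_additive T_comm zQ[OF pow] z[OF pow, symmetric] m_pos Q1 _ T_additive T_comm]
      that(2,3) unfolding W_def by blast
  have genW: "v \<in> W B" if "v \<in> B" for v B using that A.loc_span.gen unfolding W_def by blast
  have orb_normal: "T g x \<in> W (orbit (T h) m B)"
    if B: "B \<subseteq> carrier M" and x: "x \<in> W (orbit (T h) m B)" and g: "\<And>x. x \<in> W B \<Longrightarrow> T g x \<in> W B"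
      and c: "\<And>x. x \<in> carrier M \<Longrightarrow> T g (T h x) = scal c (T h (T g x))" for g h x B c
  proof (rule orb_map[OF B x])
    fix v i assume v: "v \<in> B"
    then have vM: "v \<in> carrier M" using B by auto
    have "(T h ^^ i) (T g v) \<in> W (orbit (T h) m B)" using orb_pow[OF B g[OF genW[OF v]]] .
    then show "T g ((T h ^^ i) v) \<in> W (orbit (T h) m B)"
      using funpow_swap(1)[OF c vM, of i] W_scal vM by simp
  qed
  obtain v0 where v0: "v0 \<in> carrier M" "v0 \<noteq> \<zero>" using nontrivial zero_closed by blast
  \<comment> \<open>The order of the letters is chosen so that each new letter commutes with the
    earlier ones up to a scalar, with one exception: moving Z22 past Z11 leaves a multiple of Z12
    Z21. Since Z11 comes last, Z12 and Z21 are already known to preserve the span when this term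
    appears.\<close>
  define V1 where "V1 = orbit (T Z22) m {v0}"
  define V2 where "V2 = orbit (T Z12) m V1"
  define V3 where "V3 = orbit (T Z21) m V2"
  define V4 where "V4 = orbit (T Z11) m V3"
  have V0M: "{v0} \<subseteq> carrier M" using v0 by simp
  have V1M: "V1 \<subseteq> carrier M" unfolding V1_def using orbit_closed[OF T_additive V0M] .
  have V2M: "V2 \<subseteq> carrier M" unfolding V2_def using orbit_closed[OF T_additive V1M] .
  have V3M: "V3 \<subseteq> carrier M" unfolding V3_def using orbit_closed[OF T_additive V2M] .
  have V4M: "V4 \<subseteq> carrier M" unfolding V4_def using orbit_closed[OF T_additive V3M] .
  have "finite V4" unfolding V4_def V3_def V2_def V1_def orbit_def by simp
  have swaps: "\<And>x. x \<in> carrier M \<Longrightarrow> T Z22 (T Z12 x) = scal (inverse q) (T Z12 (T Z22 x))"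
    "\<And>x. x \<in> carrier M \<Longrightarrow> T Z22 (T Z21 x) = scal 1 (T Z21 (T Z22 x))"
    "\<And>x. x \<in> carrier M \<Longrightarrow> T Z12 (T Z21 x) = scal q (T Z21 (T Z12 x))"
    "\<And>x. x \<in> carrier M \<Longrightarrow> T Z12 (T Z11 x) = scal 1 (T Z11 (T Z12 x))"
    "\<And>x. x \<in> carrier M \<Longrightarrow> T Z21 (T Z11 x) = scal (inverse q) (T Z11 (T Z21 x))"
    by (simp_all add: rel1 rel2 rel3 rel4 rel5 scal_scal q_nz)
  have W1: "T Z22 x \<in> W V1" if "x \<in> W V1" for x
    using orb_closed[OF V0M] that unfolding V1_def by blast
  have W2: "T Z12 x \<in> W V2" "T Z22 x \<in> W V2" if "x \<in> W V2" for x
    using orb_closed[OF V1M] orb_normal[OF V1M _ W1 swaps(1)] that unfolding V2_def by blast+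
  have W3: "T Z21 x \<in> W V3" "T Z12 x \<in> W V3" "T Z22 x \<in> W V3" if "x \<in> W V3" for x
    using orb_closed[OF V2M] orb_normal[OF V2M _ W2(1) swaps(3)] orb_normal[OF V2M _ W2(2) swaps(2)] that
    unfolding V3_def by blast+
  have W4: "T Z11 x \<in> W V4" "T Z12 x \<in> W V4" "T Z21 x \<in> W V4" if "x \<in> W V4" for x
    using orb_closed[OF V3M] orb_normal[OF V3M _ W3(2) swaps(4)] orb_normal[OF V3M _ W3(1) swaps(5)] that
    unfolding V4_def by blast+
  have W4': "T Z22 x \<in> W V4" if "x \<in> W V4" for x
    unfolding V4_def
  proof (rule orb_map[OF V3M])
    show "x \<in> W (orbit (T Z11) m V3)" using that by (simp add: V4_def)
    fix v i assume v: "v \<in> V3"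
    then have vM: "v \<in> carrier M" using V3M by auto
    have 1: "(T Z11 ^^ i) (T Z22 v) \<in> W V4" "(T Z11 ^^ i) v \<in> W V4" for i
      using orb_pow[OF V3M W3(3)[OF genW[OF v]]] orb_pow[OF V3M genW[OF v]] by (simp_all add: V4_def)
    show "T Z22 ((T Z11 ^^ i) v) \<in> W (orbit (T Z11) m V3)"
    proof (cases i)
      case 0
      then show ?thesis using 1(1)[of 0] by (simp add: V4_def)
    next
      case (Suc n)
      \<comment> \<open>\<open>?b\<close> is the correction term of \<open>Z22_funpow_Z11\<close>
        with the opposite sign; adding it to \<open>?a\<close> leaves the vector to be placed in the
        span.\<close>
      let ?a = "(T Z11 ^^ Suc n) (T Z22 v)" and ?b = "scal (1 - q ^ Suc n) (V ((T Z11 ^^ n) v))"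
      have "V ((T Z11 ^^ n) v) \<in> W V4" unfolding V_def by (intro W4 1)
      then have "?b \<in> W V4" by (rule W_scal) (use vM in simp)
      with 1(1)[of "Suc n"] have "?a \<oplus> ?b \<in> W V4" unfolding W_def by (intro A.loc_span.add)
      also have "?a \<oplus> ?b = T Z22 ((T Z11 ^^ Suc n) v) \<oplus>
          (scal (q ^ Suc n - 1) (V ((T Z11 ^^ n) v)) \<oplus> scal (1 - q ^ Suc n) (V ((T Z11 ^^ n) v)))"
        using vM by (subst Z22_funpow_Z11) (simp_all add: a_assoc)
      also have "\<dots> = T Z22 ((T Z11 ^^ Suc n) v)"
        using vM by (simp add: act_add_left[symmetric])
      finally show ?thesis by (simp add: Suc V4_def)
    qed
  qed
  have "W V4 = {\<zero>} \<or> W V4 = carrier M"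
  proof (rule simple)
    show "\<zero> \<in> W V4" "\<And>x y. x \<in> W V4 \<Longrightarrow> y \<in> W V4 \<Longrightarrow> x \<oplus> y \<in> W V4"
      unfolding W_def by (rule A.loc_span.zero, rule A.loc_span.add)
    show "T g x \<in> W V4" if "x \<in> W V4" for g x using that W4 W4' by (cases g) auto
    show "scal c x \<in> W V4" if "x \<in> W V4" for c x by (rule W_scal[OF that Wc[OF that V4M]])
    show "W V4 \<subseteq> carrier M" using Wc V4M by blast
  qed
  moreover have "v0 \<in> W V4"
  proof -
    have 0: "x \<in> W (orbit (T h) m B)" if "B \<subseteq> carrier M" "x \<in> W B" for h x B
    proof -
      have "(T h ^^ 0) x \<in> W (orbit (T h) m B)" by (rule orb_pow[OF that])
      then show ?thesis by simp
    qed
    have "v0 \<in> W {v0}" by (rule genW) simp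
    then have "v0 \<in> W V1" unfolding V1_def by (rule 0[OF V0M])
    then have "v0 \<in> W V2" unfolding V2_def by (rule 0[OF V1M])
    then have "v0 \<in> W V3" unfolding V3_def by (rule 0[OF V2M])
    then show ?thesis unfolding V4_def by (rule 0[OF V3M])
  qed
  ultimately have gen: "carrier M \<subseteq> A.loc_span (z ` central_powers \<union> range \<kappa>) 1 V4"
    using v0 by (auto simp: W_def Q_def)
  have "finite (z ` central_powers)" by (simp add: central_powers_def)
  from A.algebraic_if_finitely_generated[OF sub this \<open>finite V4\<close> V4M gen, of "z U"]
  have "A.algebraic_over (range \<kappa>) (z U)" using U by simp
  then obtain c where "z U - \<kappa> c \<in> A.annih" using A.algebraic_over_range_imp_scalar[OF \<kappa>(1,2,3)] by blast
  then have "U x = scal c x" if "x \<in> carrier M" for x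
    using that z[OF U that] \<kappa>(4)[OF that] A.act_add_left[OF that, of "z U - \<kappa> c" "\<kappa> c"]
    by (simp add: A.annih_def)
  then show ?thesis by blast
qed

text \<open>The commutative ring acting here is the sixfold iterated polynomial ring over \<open>'k\<close>, one variable for
  each central power.\<close>

lemma central_power_scalar:
  assumes "U \<in> central_powers" shows "\<exists>c. \<forall>x\<in>carrier M. U x = scal c x"
proof -
  note step = good_action_poly_act
  have mem: "T g ^^ m \<in> central_powers" "D ^^ m \<in> central_powers" "V ^^ m \<in> central_powers" for g
    by (cases g) (auto simp: central_powers_def)
  have all: "insert (T Z11 ^^ m) (insert (T Z12 ^^ m) (insert (T Z21 ^^ m) (insert (T Z22 ^^ m) (insert (D ^^ m)
      (insert (V ^^ m) {}))))) = central_powers"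
    by (simp add: central_powers_def)
  note good = step[OF step[OF step[OF step[OF step[OF step[OF good_action_scal mem(3)] mem(2)] mem(1)[of Z22]]
    mem(1)[of Z21]] mem(1)[of Z12]] mem(1)[of Z11], unfolded all]
  show ?thesis by (rule central_power_scalar_if_good[OF good assms])
qed

section \<open>Common eigenvectors and the two families\<close>

lemma funpow_eq_zero:
  assumes "additive_on M S" "\<And>x. x \<in> carrier M \<Longrightarrow> S x = \<zero> \<Longrightarrow> x = \<zero>" "x \<in> carrier M" "(S ^^ n) x = \<zero>"
  shows "x = \<zero>"
  using assms(4)
proof (induction n)
  case (Suc n)
  then show ?case using assms(2)[of "(S ^^ n) x"] funpow_closed[OF assms(1,3)] by simp
qed simp

lemma Z21_inj:
  assumes "x \<in> carrier M" "T Z21 x = \<zero>" shows "x = \<zero>"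
proof -
  have "scal q (V x) = T Z12 \<zero>" using assms rel5[OF assms(1)] by (simp add: V_def)
  then have "V x = \<zero>" using additive_on_zero[OF T_additive] scal_eq_zero q_nz assms(1) by simp
  then show ?thesis using V_inj assms(1) by blast
qed

text \<open>X^m - c annihilates every vector, so \<open>exists_eigenvector\<close> applies to
  \<open>x\<close>. The eigenvector of \<open>S\<close> is a polynomial in \<open>S\<close> applied
  to \<open>x\<close>, and \<open>C\<close> commutes with \<open>S\<close>, so the eigenvalue
  \<open>\<nu>\<close> is preserved.\<close>

lemma exists_eigenvector_of_root:
  assumes S: "additive_on M S" "\<And>c x. x \<in> carrier M \<Longrightarrow> S (scal c x) = scal c (S x)"
    and c: "\<forall>x\<in>carrier M. (S ^^ m) x = scal c x" and x: "x \<in> carrier M" "x \<noteq> \<zero>"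
    and C: "additive_on M C" "\<And>c x. x \<in> carrier M \<Longrightarrow> C (scal c x) = scal c (C x)" "commuting_on M C S" "C x = scal \<nu> x"
  shows "\<exists>y l. y \<in> carrier M \<and> y \<noteq> \<zero> \<and> S y = scal l y \<and> C y = scal \<nu> y"
proof -
  have S_scal: "commuting_on M S (scal c)" and C_scal: "commuting_on M C (scal c)" for c
    using S(2) C(2) by (auto simp: commuting_on_def)
  interpret P: comm_ring_action M "poly_act M scal S"
    by (rule comm_ring_action_poly_act[OF S(1) S_scal])
  have monom: "poly_act M scal S (monom 1 n) y = (S ^^ n) y" if "y \<in> carrier M" for n y
  proof (induction n)
    case (Suc n)
    have "S ((S ^^ n) y) \<in> carrier M" using S(1) funpow_closed[OF S(1) that] by (simp add: additive_on_def)
    with Suc show ?case using that by (simp add: monom_Suc poly_act_pCons[OF S(1)])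
  qed (use that poly_act_const[OF S(1) that, of 1] in \<open>simp add: monom_0\<close>)
  define p where "p = monom 1 m - [:c:]"
  have "coeff p m = 1" using m_pos by (cases m) (simp_all add: p_def)
  then have "p \<noteq> 0" by auto
  moreover have "poly_act M scal S p x = \<zero>"
    using x(1) c by (simp add: p_def P.act_diff_left monom poly_act_const[OF S(1)] minus_eq r_neg)
  ultimately obtain r l where r: "poly_act M scal S r x \<noteq> \<zero>"
    "poly_act M scal S [:- l, 1:] (poly_act M scal S r x) = \<zero>"
    using exists_eigenvector[OF P.comm_ring_action_axioms x] by blast
  define y where "y = poly_act M scal S r x"
  have y: "y \<in> carrier M" using x(1) by (simp add: y_def)
  have "[:- l, 1:] = [:0, 1:] - [:l:]" by simp
  then have "S y \<ominus> scal l y = \<zero>"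
    using r(2) y unfolding y_def[symmetric] by (simp only: P.act_diff_left poly_act_X[OF S(1)] poly_act_const[OF S(1)])
  then have "S y = scal l y"
    using y S(1) minus_equality[of "S y" "\<ominus> scal l y"] by (simp add: additive_on_def minus_eq)
  moreover have "C y = poly_act M scal S r (C x)"
    using poly_act_commutes[OF S(1) C(1,3) C_scal, of r] x(1) by (simp add: y_def commuting_on_def)
  then have "C y = scal \<nu> y"
    using P.act_commute[OF x(1), of r "[:\<nu>:]"] poly_act_const[OF S(1)] x(1) y C(4) by (simp add: y_def)
  ultimately show ?thesis using r(1) y unfolding y_def by blast
qed

lemma exists_common_eigenvector:
  "\<exists>e \<mu> \<nu>. e \<in> carrier M \<and> e \<noteq> \<zero> \<and> \<mu> \<noteq> 0 \<and> \<nu> \<noteq> 0 \<and> D e = scal \<mu> e \<and> V e = scal \<nu> e"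
proof -
  obtain x0 where x0: "x0 \<in> carrier M" "x0 \<noteq> \<zero>" using nontrivial zero_closed by blast
  obtain c where c: "\<forall>x\<in>carrier M. (V ^^ m) x = scal c x"
    using central_power_scalar[of "V ^^ m"] by (auto simp: central_powers_def)
  obtain d where d: "\<forall>x\<in>carrier M. (D ^^ m) x = scal d x"
    using central_power_scalar[of "D ^^ m"] by (auto simp: central_powers_def)
  \<comment> \<open>The identity with eigenvalue 1 stands in for \<open>C\<close> in the first
    application, where only an eigenvector of \<open>V\<close> is wanted.\<close>
  have "commuting_on M V (\<lambda>x. x)" "additive_on M (\<lambda>x. x)" by (auto simp: commuting_on_def additive_on_def)
  then obtain x \<nu> where x: "x \<in> carrier M" "x \<noteq> \<zero>" "V x = scal \<nu> x"
    using exists_eigenvector_of_root[OF V_additive V_scal c x0, of "\<lambda>x. x" 1] x0(1)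
    by (auto simp: commuting_on_def)
  have "commuting_on M V D"
  proof -
    have "V (T Z22 (T Z11 x) \<ominus> V x) = V (T Z22 (T Z11 x)) \<ominus> V (V x)" if "x \<in> carrier M" for x
      using that V_additive additive_on_minus[OF V_additive, of "V x"] by (simp add: additive_on_def minus_eq)
    then show ?thesis by (simp add: commuting_on_def D_eq V_T T_scal)
  qed
  from exists_eigenvector_of_root[OF D_additive D_scal d x(1,2) V_additive V_scal this x(3)]
  obtain e \<mu> where e: "e \<in> carrier M" "e \<noteq> \<zero>" "D e = scal \<mu> e" "V e = scal \<nu> e" by blast
  then have "\<mu> \<noteq> 0" "\<nu> \<noteq> 0" using D_inj[OF e(1)] V_inj[OF e(1)] by auto
  with e show ?thesis by blast
qed

text \<open>Z12 is recovered from \<open>V\<close>: applying Z21 and then Z12 is \<open>V\<close> up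
  to the factor \<open>q\<close>, and \<open>V\<close> is diagonal on the vectors
  \<open>(T Z21 ^^ b) z\<close>. At the bottom, \<open>z\<close> is rewritten as a multiple of
  \<open>(T Z21 ^^ m) z\<close>, whence the exponent \<open>m - 1\<close> and the factor
  \<open>inverse \<beta>\<close>.\<close>

lemma Z12_Z21_funpow:
  assumes z: "z \<in> carrier M" "V z = scal k z" and Y: "\<forall>x\<in>carrier M. (T Z21 ^^ m) x = scal \<beta> x" "\<beta> \<noteq> 0"
  shows "T Z12 ((T Z21 ^^ Suc b) z) = scal (q ^ Suc b * k) ((T Z21 ^^ b) z)"
    and "T Z12 z = scal (inverse \<beta> * k) ((T Z21 ^^ (m - 1)) z)"
proof -
  have "V ((T Z21 ^^ b) z) = scal (q ^ b * k) ((T Z21 ^^ b) z)" for b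
    by (induction b) (use z in \<open>simp_all add: V_T T_scal scal_scal mult_ac\<close>)
  then show *: "T Z12 ((T Z21 ^^ Suc b) z) = scal (q ^ Suc b * k) ((T Z21 ^^ b) z)" for b
    using z(1) by (simp add: rel5 V_def[symmetric] scal_scal mult.assoc)
  have "scal \<beta> (T Z12 z) = T Z12 ((T Z21 ^^ m) z)" using Y(1) z(1) by (simp add: T_scal)
  also have "\<dots> = scal k ((T Z21 ^^ (m - 1)) z)"
    using *[of "m - 1"] m_pos q_m by simp
  finally have "scal (inverse \<beta>) (scal \<beta> (T Z12 z)) = scal (inverse \<beta>) (scal k ((T Z21 ^^ (m - 1)) z))" by simp
  then show "T Z12 z = scal (inverse \<beta> * k) ((T Z21 ^^ (m - 1)) z)"
    using Y(2) z(1) by (simp add: scal_scal)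
qed

lemma realises_Z21:
  assumes z: "z \<in> carrier M" and Y: "\<forall>x\<in>carrier M. (T Z21 ^^ m) x = scal \<beta> x" and b: "b < m"
  shows "T Z21 ((T Z21 ^^ b) z) = (if b < m - 1 then (T Z21 ^^ (b + 1)) z else scal \<beta> z)"
proof (cases "b < m - 1")
  case False
  then have "Suc b = m" using b by simp
  then show ?thesis using Y z False by (metis funpow.simps(2) o_apply)
qed simp

text \<open>The last two parameters are the eigenvalues of det_q and Z12 Z21. Z11 raises the first
  index, keeps the eigenvalue of \<open>D\<close> and divides that of \<open>V\<close> by
  \<open>q\<close>; Z22 is then determined, because Z11 followed by Z22 is the sum of
  \<open>D\<close> and \<open>V\<close>.\<close>

lemma exists_N1_realisation:
  assumes e: "e \<in> carrier M" "e \<noteq> \<zero>" "D e = scal \<mu> e" "V e = scal \<nu> e"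
    and X: "\<forall>x\<in>carrier M. (T Z11 ^^ m) x = scal \<alpha> x" "\<alpha> \<noteq> 0"
    and Y: "\<forall>x\<in>carrier M. (T Z21 ^^ m) x = scal \<beta> x" "\<beta> \<noteq> 0"
  shows "\<exists>E. realises (N1_gen m q \<alpha> \<beta> \<mu> \<nu>) E"
proof -
  define x where "x a = (T Z11 ^^ a) e" for a
  define E where "E = (\<lambda>(a, b). (T Z21 ^^ b) (x a))"
  have xM [simp]: "x a \<in> carrier M" for a using e(1) by (simp add: x_def)
  have EM: "E (a, b) \<in> carrier M" for a b by (simp add: E_def)
  have XS: "T Z11 (x a) = x (Suc a)" for a by (simp add: x_def)
  have Vx: "V (x a) = scal (inverse q ^ a * \<nu>) (x a)" for a
  proof (induction a)
    case (Suc a)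
    have "V (T Z11 (x a)) = scal (inverse q) (T Z11 (V (x a)))" by (simp add: V_T scal_scal q_nz)
    then show ?case unfolding Suc by (simp add: T_scal scal_scal mult.assoc XS)
  qed (use e in \<open>simp add: x_def\<close>)
  have Dx: "D (x a) = scal \<mu> (x a)" for a
  proof (induction a)
    case (Suc a)
    have "D (T Z11 (x a)) = T Z11 (D (x a))" by (simp add: D_T)
    then show ?case unfolding Suc by (simp add: T_scal XS)
  qed (use e in \<open>simp add: x_def\<close>)
  have Xm: "x m = scal \<alpha> e" using X(1) e(1) by (simp add: x_def)
  have x0: "x 0 = e" by (simp add: x_def)
  have WX: "T Z22 (x (Suc a)) = scal (\<mu> + inverse q ^ a * \<nu>) (x a)" for a
    using Z11_Z22[OF xM, of a] by (simp add: XS Dx Vx act_add_left)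
  have powi_neg: "q powi (- int a) = inverse q ^ a" for a
    by (simp add: power_int_minus power_inverse)
  have powi_diff: "q powi (int b - int a) = q ^ b * inverse q ^ a" for a b
    using q_nz by (simp add: power_int_diff power_inverse divide_inverse)
  \<comment> \<open>\<open>x m\<close> is \<alpha> times \<open>e\<close>, so the image of
    \<open>e\<close> is read off from index \<open>m - 1\<close>, where q^(-(m - 1)) = q.\<close>
  have We: "T Z22 e = scal (inverse \<alpha> * (\<mu> + q * \<nu>)) (x (m - 1))"
  proof -
    have "inverse q ^ (m - 1) = q"
      using power_minus_mult[OF m_pos, of q] q_m inverse_unique[of "q ^ (m - 1)" q] by (simp add: power_inverse)
    then have "T Z22 (x m) = scal (\<mu> + q * \<nu>) (x (m - 1))" using WX[of "m - 1"] m_pos by simp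
    then have "scal \<alpha> (T Z22 e) = scal (\<mu> + q * \<nu>) (x (m - 1))" by (simp add: Xm T_scal e(1))
    then have "scal (inverse \<alpha>) (scal \<alpha> (T Z22 e)) = scal (inverse \<alpha>) (scal (\<mu> + q * \<nu>) (x (m - 1)))" by simp
    then show ?thesis using X(2) e(1) by (simp add: scal_scal)
  qed
  have "realises (N1_gen m q \<alpha> \<beta> \<mu> \<nu>) E"
  proof (rule realisesI)
    show "E (0, 0) \<noteq> \<zero>" using e by (simp add: E_def x_def)
    fix g a b assume ab: "a < m" "b < m"
    show "\<exists>c a' b'. a' < m \<and> b' < m \<and> N1_gen m q \<alpha> \<beta> \<mu> \<nu> g (a, b) = evec c (a', b') \<and> T g (E (a, b)) = scal c (E (a', b'))" (is "\<exists>c a' b'. ?P c a' b'")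
    proof -
      have wit: ?thesis if "?P c a' b'" for a' b' c using that by blast
      show ?thesis
      proof (cases g)
        case Z11
        have "T Z11 (E (a, b)) = scal (q ^ b) ((T Z21 ^^ b) (x (Suc a)))"
          using funpow_swap(1)[of Z11 Z21 q "x a" b] by (simp add: E_def rel2 XS)
        moreover have "x (Suc a) = scal \<alpha> (x 0)" if "\<not> a < m - 1"
        proof -
          have "Suc a = m" using that ab(1) by simp
          then show ?thesis using Xm x0 by simp
        qed
        ultimately have *: "T Z11 (E (a, b)) = (if a < m - 1 then scal (q ^ b) (E (a + 1, b)) else scal (q ^ b * \<alpha>) (E (0, b)))"
          by (simp add: E_def T_funpow_scal scal_scal)
        show ?thesis
        proof (cases "a < m - 1")
          case True
          then show ?thesis using ab m_pos *
            by (intro wit[of "a + 1" "b" "q ^ b"]) (simp add: Z11 EM)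
        next
          case False
          then show ?thesis using ab m_pos *
            by (intro wit[of "0" "b" "q ^ b * \<alpha>"]) (simp add: Z11 EM)
        qed
      next
        case Z21
        have *: "T Z21 (E (a, b)) = (if b < m - 1 then E (a, b + 1) else scal \<beta> (E (a, 0)))"
          by (simp only: E_def case_prod_conv funpow_0 realises_Z21[OF xM Y(1) ab(2)])
        show ?thesis
        proof (cases "b < m - 1")
          case True
          then show ?thesis using ab m_pos *
            by (intro wit[of "a" "b + 1" "1"]) (simp add: Z21 EM)
        next
          case False
          then show ?thesis using ab m_pos *
            by (intro wit[of "a" "0" "\<beta>"]) (simp add: Z21 EM)
        qed
      next
        case Z12
        show ?thesis
        proof (cases b)
          case 0
          have "T Z12 (E (a, b)) = scal (inverse \<beta> * \<nu> * q powi (- int a)) (E (a, m - 1))"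
            using Z12_Z21_funpow(2)[OF xM Vx Y, of a]
            by (simp only: E_def case_prod_conv 0 funpow_0 powi_neg mult_ac)
          then show ?thesis using ab
            by (intro wit[of a "m - 1" "inverse \<beta> * \<nu> * q powi (- int a)"]) (simp add: Z12 0)
        next
          case (Suc b')
          have "T Z12 (E (a, b)) = scal (q powi (int b - int a) * \<nu>) (E (a, b'))"
            using Z12_Z21_funpow(1)[OF xM Vx Y, of b' a] by (simp only: E_def case_prod_conv Suc powi_diff mult_ac)
          then show ?thesis using ab
            by (intro wit[of a b' "q powi (int b - int a) * \<nu>"]) (simp add: Z12 Suc)
        qed
      next
        case Z22
        have W: "T Z22 (E (a, b)) = (T Z21 ^^ b) (T Z22 (x a))"
          using funpow_swap(1)[of Z22 Z21 1 "x a" b] by (simp add: E_def rel3)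
        show ?thesis
        proof (cases a)
          case 0
          have "T Z22 (E (a, b)) = scal (inverse \<alpha> * (\<mu> + q * \<nu>)) (E (m - 1, b))"
            unfolding W by (simp only: 0 x0 We T_funpow_scal[OF xM] E_def case_prod_conv)
          then show ?thesis using ab
            by (intro wit[of "m - 1" b "inverse \<alpha> * (\<mu> + q * \<nu>)"]) (simp add: Z22 0)
        next
          case (Suc a')
          \<comment> \<open>The coefficient as written in \<open>N1_gen\<close>; it equals
            \<open>\<mu> + inverse q ^ a' * \<nu>\<close> because \<open>a = Suc a'\<close>.\<close>
          let ?c = "\<mu> + q * \<nu> - q * (1 - q powi (- int a)) * \<nu>"
          have "q * inverse q ^ a = inverse q ^ a'" using q_nz by (simp add: Suc)
          moreover have "q * (1 - inverse q ^ a) * \<nu> = q * \<nu> - q * inverse q ^ a * \<nu>"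
            by (simp add: algebra_simps)
          ultimately have c: "\<mu> + inverse q ^ a' * \<nu> = ?c" unfolding powi_neg by simp
          have "T Z22 (E (a, b)) = scal (\<mu> + inverse q ^ a' * \<nu>) (E (a', b))"
            unfolding W by (simp only: Suc WX T_funpow_scal[OF xM] E_def case_prod_conv)
          then have "T Z22 (E (a, b)) = scal ?c (E (a', b))" unfolding c .
          moreover have "N1_gen m q \<alpha> \<beta> \<mu> \<nu> Z22 (a, b) = evec ?c (a', b)" by (simp add: Suc)
          ultimately show ?thesis using ab Suc by (intro wit[of a' b ?c]) (simp only: Z22, simp)
        qed
      qed
    qed
  qed (rule EM)
  then show ?thesis by blast
qed

text \<open>A vector killed by Z11 is a lowest vector: Z22 raises the first index, and moving Z11
  past a power of Z22 leaves only the correction term with its factor \<open>q ^ Suc a - 1\<close>.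
  On such a vector det_q acts as -Z12 Z21, so a single eigenvalue \<open>\<nu>\<close> remains as
  parameter.\<close>

lemma exists_N2_realisation:
  assumes e: "e \<in> carrier M" "e \<noteq> \<zero>" "V e = scal \<nu> e" "T Z11 e = \<zero>"
    and W: "\<forall>x\<in>carrier M. (T Z22 ^^ m) x = scal \<gamma> x"
    and Y: "\<forall>x\<in>carrier M. (T Z21 ^^ m) x = scal \<beta> x" "\<beta> \<noteq> 0"
  shows "\<exists>E. realises (N2_gen m q 0 \<beta> \<gamma> \<nu>) E"
proof -
  define x where "x a = (T Z22 ^^ a) e" for a
  define E where "E = (\<lambda>(a, b). (T Z21 ^^ b) (x a))"
  have xM [simp]: "x a \<in> carrier M" for a using e(1) by (simp add: x_def)
  have EM: "E (a, b) \<in> carrier M" for a b by (simp add: E_def)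
  have Vx: "V (x a) = scal (q ^ a * \<nu>) (x a)" for a
    using e by (simp add: x_def Z22_funpow_V T_funpow_scal scal_scal)
  have x0: "x 0 = e" by (simp add: x_def)
  have WS: "T Z22 (x a) = x (Suc a)" for a by (simp add: x_def)
  have Wm: "x m = scal \<gamma> e" using W e(1) by (simp add: x_def)
  have XW: "T Z11 (x (Suc a)) = scal ((q ^ Suc a - 1) * \<nu>) (x a)" for a
  proof -
    have "(T Z22 ^^ Suc a) \<zero> = \<zero>" using additive_on_zero[OF additive_on_funpow[OF T_additive]] .
    then show ?thesis using Z22_funpow_Z11'[OF e(1), of a] e
      by (simp only: x_def e(3,4) T_funpow_scal scal_scal Tpow_closed l_zero act_closed)
  qed
  have "realises (N2_gen m q 0 \<beta> \<gamma> \<nu>) E"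
  proof (rule realisesI)
    show "E (0, 0) \<noteq> \<zero>" using e by (simp add: E_def x_def)
    fix g a b assume ab: "a < m" "b < m"
    show "\<exists>c a' b'. a' < m \<and> b' < m \<and> N2_gen m q 0 \<beta> \<gamma> \<nu> g (a, b) = evec c (a', b') \<and> T g (E (a, b)) = scal c (E (a', b'))" (is "\<exists>c a' b'. ?P c a' b'")
    proof -
      have wit: ?thesis if "?P c a' b'" for a' b' c using that by blast
      show ?thesis
      proof (cases g)
        case Z11
        have *: "T Z11 (E (a, b)) = scal (q ^ b) ((T Z21 ^^ b) (T Z11 (x a)))"
          using funpow_swap(1)[of Z11 Z21 q "x a" b] by (simp add: E_def rel2)
        show ?thesis
        proof (cases a)
          case 0
          have "(T Z21 ^^ b) \<zero> = \<zero>" using additive_on_zero[OF additive_on_funpow[OF T_additive]] .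
          \<comment> \<open>The zero image is presented as 0 times the same basis vector, the format
            that \<open>realises\<close> demands.\<close>
          moreover have "evec 0 (a, b) = (\<lambda>p. 0 :: 'k)" by (simp add: evec_def)
          ultimately show ?thesis using * ab EM[of a b]
            by (intro wit[of "a" "b" "0"]) (simp add: Z11 0 x0 e(4))
        next
          case (Suc a')
          then show ?thesis using * XW[of a'] ab
            by (intro wit[of "a'" "b" "q ^ b * (q ^ a - 1) * q powi (- int 0) * \<nu>"]) (simp add: Z11 E_def T_funpow_scal scal_scal mult_ac)
        qed
      next
        case Z21
        have *: "T Z21 (E (a, b)) = (if b < m - 1 then E (a, b + 1) else scal \<beta> (E (a, 0)))"
          by (simp only: E_def case_prod_conv funpow_0 realises_Z21[OF xM Y(1) ab(2)])
        show ?thesis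
        proof (cases "b < m - 1")
          case True
          then show ?thesis using ab m_pos *
            by (intro wit[of "a" "b + 1" "1"]) (simp add: Z21 EM)
        next
          case False
          then show ?thesis using ab m_pos *
            by (intro wit[of "a" "0" "\<beta>"]) (simp add: Z21 EM)
        qed
      next
        case Z12
        show ?thesis
        proof (cases b)
          case 0
          then show ?thesis using Z12_Z21_funpow(2)[OF xM Vx Y, of a] ab
            by (intro wit[of "a" "m - 1" "inverse \<beta> * q ^ a * q powi (- int 0) * \<nu>"]) (simp add: Z12 E_def mult_ac)
        next
          case (Suc b')
          then show ?thesis using Z12_Z21_funpow(1)[OF xM Vx Y, of b' a] ab
            by (intro wit[of "a" "b'" "q ^ (a + b) * q powi (- int 0) * \<nu>"]) (simp add: Z12 E_def power_add mult_ac)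
        qed
      next
        case Z22
        have W: "T Z22 (E (a, b)) = (T Z21 ^^ b) (x (Suc a))"
          using funpow_swap(1)[of Z22 Z21 1 "x a" b] by (simp add: E_def rel3 WS)
        moreover have "x (Suc a) = scal \<gamma> (x 0)" if "\<not> a < m - 1"
        proof -
          have "Suc a = m" using that ab(1) by simp
          then show ?thesis using Wm x0 by simp
        qed
        ultimately have *: "T Z22 (E (a, b)) = (if a < m - 1 then E (a + 1, b) else scal \<gamma> (E (0, b)))"
          by (simp add: E_def T_funpow_scal)
        show ?thesis
        proof (cases "a < m - 1")
          case True
          then show ?thesis using ab m_pos *
            by (intro wit[of "a + 1" "b" "1"]) (simp add: Z22 EM)
        next
          case False
          then show ?thesis using ab m_pos *
            by (intro wit[of "0" "b" "\<gamma>"]) (simp add: Z22 EM)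
        qed
      qed
    qed
  qed (rule EM)
  then show ?thesis by blast
qed

theorem classification:
  "(\<exists>\<alpha> \<beta> l1 l2 E. \<alpha> \<noteq> 0 \<and> \<beta> \<noteq> 0 \<and> l1 \<noteq> 0 \<and> l2 \<noteq> 0 \<and> realises (N1_gen m q \<alpha> \<beta> l1 l2) E) \<or>
   (\<exists>\<beta> \<gamma> l2 E. \<beta> \<noteq> 0 \<and> l2 \<noteq> 0 \<and> realises (N2_gen m q 0 \<beta> \<gamma> l2) E)"
proof -
  obtain e \<mu> \<nu> where e: "e \<in> carrier M" "e \<noteq> \<zero>" "\<mu> \<noteq> 0" "\<nu> \<noteq> 0" "D e = scal \<mu> e" "V e = scal \<nu> e"
    using exists_common_eigenvector by blast
  have "\<exists>c. \<forall>x\<in>carrier M. (T g ^^ m) x = scal c x" for g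
    by (rule central_power_scalar) (cases g; simp add: central_powers_def)
  then obtain \<alpha> \<beta> \<gamma> where X: "\<forall>x\<in>carrier M. (T Z11 ^^ m) x = scal \<alpha> x"
    and Y: "\<forall>x\<in>carrier M. (T Z21 ^^ m) x = scal \<beta> x" and W: "\<forall>x\<in>carrier M. (T Z22 ^^ m) x = scal \<gamma> x"
    by meson
  \<comment> \<open>Z21 is injective because \<open>V\<close> is, so no power of it kills
    \<open>e\<close>.\<close>
  have "\<beta> \<noteq> 0" using funpow_eq_zero[OF T_additive[of Z21] Z21_inj e(1), of m] Y e(1,2) by auto
  show ?thesis
  proof (cases "\<alpha> = 0")
    case False
    then show ?thesis using exists_N1_realisation[OF e(1,2,5,6) X _ Y] e(3,4) \<open>\<beta> \<noteq> 0\<close> by blast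
  next
    case True
    \<comment> \<open>Z11 is nilpotent in this case. The last nonzero vector of the chain from
      \<open>e\<close> is killed by Z11 and is still an eigenvector of \<open>V\<close>, with
      \<open>\<nu>\<close> divided by a power of \<open>q\<close>.\<close>
    define n where "n = (LEAST n. (T Z11 ^^ n) e = \<zero>)"
    have "(T Z11 ^^ m) e = \<zero>" using X True e(1) by simp
    then have n: "(T Z11 ^^ n) e = \<zero>" unfolding n_def by (rule LeastI)
    with e(2) obtain k where k: "n = Suc k" by (cases n) auto
    define x where "x = (T Z11 ^^ k) e"
    have x: "x \<noteq> \<zero>" unfolding x_def using not_less_Least[of k "\<lambda>n. (T Z11 ^^ n) e = \<zero>"] k n_def by simp
    have Xx: "T Z11 x = \<zero>" using n by (simp add: k x_def)
    have "V ((T Z11 ^^ j) e) = scal (inverse q ^ j * \<nu>) ((T Z11 ^^ j) e)" for j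
    proof (induction j)
      case (Suc j)
      have "V ((T Z11 ^^ Suc j) e) = scal (inverse q) (T Z11 (V ((T Z11 ^^ j) e)))"
        using e(1) by (simp add: V_T scal_scal q_nz)
      then show ?case unfolding Suc using e(1) by (simp add: T_scal scal_scal mult.assoc)
    qed (use e in simp)
    then have "V x = scal (inverse q ^ k * \<nu>) x" by (simp only: x_def)
    moreover have "x \<in> carrier M" using e(1) by (simp add: x_def)
    ultimately have "\<exists>E. realises (N2_gen m q 0 \<beta> \<gamma> (inverse q ^ k * \<nu>)) E"
      using exists_N2_realisation[OF _ x _ Xx W Y] \<open>\<beta> \<noteq> 0\<close> by blast
    moreover have "inverse q ^ k * \<nu> \<noteq> 0" using e(4) q_nz by simp
    ultimately show ?thesis using \<open>\<beta> \<noteq> 0\<close> by blast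
  qed
qed

end

section \<open>The algebra of quantum matrices as a quotient of the free algebra\<close>

abbreviation mat2_class :: "'k::field \<Rightarrow> 'k free_alg \<Rightarrow> 'k free_alg set" where
  "mat2_class q f \<equiv> mat2_ideal q +>\<^bsub>FR\<^esub> f"

lemma mat2_ideal_ideal: "ideal (mat2_ideal q) FR"
  unfolding mat2_ideal_def by (rule ring.genideal_ideal[OF FR_ring]) (simp add: FR_simps)

lemma ring_Mat2: "ring (Mat2 q)"
  unfolding Mat2_def by (rule ideal.quotient_is_ring[OF mat2_ideal_ideal])

lemma Mat2_carrier: "carrier (Mat2 q) = range (mat2_class q)"
  by (auto simp: Mat2_def FactRing_def A_RCOSETS_def' FR_simps)

lemma Mat2_mult: "mat2_class q f \<otimes>\<^bsub>Mat2 q\<^esub> mat2_class q g = mat2_class q (f * g)"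
  using ideal.rcoset_mult_add[OF mat2_ideal_ideal, of f g q] by (simp add: Mat2_def FactRing_def FR_simps)

lemma Mat2_add: "mat2_class q f \<oplus>\<^bsub>Mat2 q\<^esub> mat2_class q g = mat2_class q (f + g)"
proof -
  interpret I: ideal "mat2_ideal q" FR by (rule mat2_ideal_ideal)
  show ?thesis using I.a_rcos_sum[of f g] by (simp add: Mat2_def FactRing_def FR_simps)
qed

lemma Mat2_one: "\<one>\<^bsub>Mat2 q\<^esub> = mat2_class q 1"
  by (simp add: Mat2_def FactRing_def FR_simps)

lemma Mat2_minus: "\<ominus>\<^bsub>Mat2 q\<^esub> mat2_class q f = mat2_class q (- f)"
proof -
  interpret ring "Mat2 q" by (rule ring_Mat2)
  have c: "mat2_class q g \<in> carrier (Mat2 q)" for g by (simp add: Mat2_carrier)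
  have "mat2_class q 0 \<oplus>\<^bsub>Mat2 q\<^esub> mat2_class q 0 = mat2_class q 0" by (simp add: Mat2_add)
  then have "mat2_class q 0 = \<zero>\<^bsub>Mat2 q\<^esub>" using c by (metis add.r_cancel_one')
  then show ?thesis using Mat2_add[of q "- f" f] by (intro minus_equality c) simp
qed

lemma det_q_class: "det_q q = mat2_class q (fgen Z11 * fgen Z22 - fgen Z12 * fgen Z21)"
  by (simp add: det_q_def Zgen_def a_minus_def Mat2_mult Mat2_minus Mat2_add)

lemma mat2_class_relation: "f - g \<in> mat2_relations q \<Longrightarrow> mat2_class q f = mat2_class q g"
proof -
  assume fg: "f - g \<in> mat2_relations q"
  interpret I: ideal "mat2_ideal q" FR by (rule mat2_ideal_ideal)
  have "mat2_relations q \<subseteq> mat2_ideal q"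
    unfolding mat2_ideal_def by (rule ring.genideal_self[OF FR_ring]) (simp add: FR_simps)
  with fg have "f - g \<in> mat2_ideal q" by blast
  then have "f \<in> mat2_class q g"
    by (auto simp: a_r_coset_def' FR_simps intro!: bexI[of _ "f - g"])
  then show ?thesis using I.a_repr_independence'[of f g] by (simp add: FR_simps)
qed

section \<open>The modules given on a basis\<close>

lemma gen_module_simps:
  "carrier (gen_module m T) = {v. \<forall>p. p \<notin> basis_index m \<longrightarrow> v p = 0}"
  "\<zero>\<^bsub>gen_module m T\<^esub> = (\<lambda>p. 0)" "u \<oplus>\<^bsub>gen_module m T\<^esub> v = (\<lambda>p. u p + v p)"
  by (simp_all add: gen_module_def)

lemma gen_module_support: "v \<in> carrier (gen_module m T) \<Longrightarrow> p \<notin> basis_index m \<Longrightarrow> v p = 0"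
  by (cases p) (simp add: gen_module_def)

lemma abelian_group_gen_module: "abelian_group (gen_module m T)"
proof (rule abelian_groupI)
  fix v assume "v \<in> carrier (gen_module m T)"
  then show "\<exists>u\<in>carrier (gen_module m T). u \<oplus>\<^bsub>gen_module m T\<^esub> v = \<zero>\<^bsub>gen_module m T\<^esub>"
    by (intro bexI[of _ "\<lambda>p. - v p"]) (auto simp: gen_module_simps)
qed (auto simp: gen_module_simps add_ac)

lemma free_act_add_vec: "free_act m T (\<lambda>p. u p + v p) f = (\<lambda>p. free_act m T u f p + free_act m T v f p)"
  using free_act_sum[of m T "\<lambda>i. if i then u else v" UNIV f] by (simp add: UNIV_bool add.commute)

lemma free_act_one: "free_act m T v 1 = v"
  using free_act_fscalar[of m T v 1] by (simp add: fscalar_def single_one)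

lemma right_module_gen_module:
  assumes "satisfies_relations q m T" shows "right_module (Mat2 q) (gen_module m T)"
proof -
  interpret ring "Mat2 q" by (rule ring_Mat2)
  interpret M: abelian_group "gen_module m T" by (rule abelian_group_gen_module)
  note smult = gen_module_smult_coset[OF assms]
  have closed: "free_act m T v f \<in> carrier (gen_module m T)" if "v \<in> carrier (gen_module m T)" for v f
    using that assms free_act_closed[of m T v] by (auto simp: gen_module_simps satisfies_relations_def)
  show ?thesis
  proof unfold_locales
    fix r s x y
    assume r: "r \<in> carrier (Mat2 q)" and x: "x \<in> carrier (gen_module m T)"
    from r obtain f where f: "r = mat2_class q f" by (auto simp: Mat2_carrier)
    show "r \<odot>\<^bsub>gen_module m T\<^esub> x \<in> carrier (gen_module m T)" using closed x by (simp add: f smult)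
    { assume y: "y \<in> carrier (gen_module m T)"
      have "x \<oplus>\<^bsub>gen_module m T\<^esub> y \<in> carrier (gen_module m T)" using x y by simp
      then show "r \<odot>\<^bsub>gen_module m T\<^esub> (x \<oplus>\<^bsub>gen_module m T\<^esub> y)
          = r \<odot>\<^bsub>gen_module m T\<^esub> x \<oplus>\<^bsub>gen_module m T\<^esub> r \<odot>\<^bsub>gen_module m T\<^esub> y"
        using x y by (simp add: f smult) (simp add: gen_module_simps free_act_add_vec) }
    { assume "s \<in> carrier (Mat2 q)"
      then obtain g where g: "s = mat2_class q g" by (auto simp: Mat2_carrier)
      show "(r \<oplus>\<^bsub>Mat2 q\<^esub> s) \<odot>\<^bsub>gen_module m T\<^esub> x
          = r \<odot>\<^bsub>gen_module m T\<^esub> x \<oplus>\<^bsub>gen_module m T\<^esub> s \<odot>\<^bsub>gen_module m T\<^esub> x"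
        using x by (simp add: f g Mat2_add smult) (simp add: gen_module_simps free_act_add)
      show "(r \<otimes>\<^bsub>Mat2 q\<^esub> s) \<odot>\<^bsub>gen_module m T\<^esub> x = s \<odot>\<^bsub>gen_module m T\<^esub> (r \<odot>\<^bsub>gen_module m T\<^esub> x)"
        using x closed by (simp add: f g Mat2_mult smult free_act_mult) }
  next
    fix x assume "x \<in> carrier (gen_module m T)"
    then show "\<one>\<^bsub>Mat2 q\<^esub> \<odot>\<^bsub>gen_module m T\<^esub> x = x" by (simp add: Mat2_one smult free_act_one)
  qed
qed

lemma free_act_diagonal:
  assumes "\<And>s. s \<in> basis_index m \<Longrightarrow> free_act m T (evec 1 s) f = evec (d s) s"
    and v: "\<And>p. p \<notin> basis_index m \<Longrightarrow> v p = 0"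
  shows "free_act m T v f = (\<lambda>p. d p * v p)"
proof -
  have "free_act m T v f = free_act m T (\<lambda>p. \<Sum>s\<in>basis_index m. v s * evec 1 s p) f"
    using vec_expand[of m v, OF v] by (rule arg_cong)
  also have "\<dots> = (\<lambda>p. \<Sum>s\<in>basis_index m. v s * evec (d s) s p)"
    by (subst free_act_sum) (simp add: free_act_scale assms(1))
  also have "\<dots> = (\<lambda>p. \<Sum>s\<in>basis_index m. (d s * v s) * evec 1 s p)"
  proof -
    have "v s * evec (d s) s p = (d s * v s) * evec 1 s p" for s p by (simp add: evec_def)
    then show ?thesis by (simp only:)
  qed
  also have "\<dots> = (\<lambda>p. d p * v p)"
    by (rule vec_expand[symmetric]) (simp add: v)
  finally show ?thesis .
qed

text \<open>A nonzero vector of minimal support in a submodule is supported at a single index: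
  otherwise one of the two diagonal elements distinguishes two of its indices, and subtracting an
  eigenvalue shortens it. The basis vector so obtained reaches all others.\<close>

lemma simple_gen_module:
  assumes sat: "satisfies_relations q m T" and m: "m > 0"
    and diag: "\<And>s. s \<in> basis_index m \<Longrightarrow> free_act m T (evec 1 s) f1 = evec (d1 s) s"
      "\<And>s. s \<in> basis_index m \<Longrightarrow> free_act m T (evec 1 s) f2 = evec (d2 s) s"
    and sep: "\<And>s t. s \<in> basis_index m \<Longrightarrow> t \<in> basis_index m \<Longrightarrow> d1 s = d1 t \<Longrightarrow> d2 s = d2 t \<Longrightarrow> s = t"
    and reach: "\<And>s t. s \<in> basis_index m \<Longrightarrow> t \<in> basis_index m \<Longrightarrow> \<exists>f c. c \<noteq> 0 \<and> free_act m T (evec 1 s) f = evec c t"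
  shows "simple_right_module (Mat2 q) (gen_module m T)"
proof -
  let ?M = "gen_module m T"
  have fin: "finite (basis_index m)" by (simp add: basis_index_def)
  have "evec 1 (0, 0) \<in> carrier ?M" "evec 1 (0, 0) \<noteq> \<zero>\<^bsub>?M\<^esub>"
    using m by (simp_all add: gen_module_simps evec_eq_0) (simp add: evec_def basis_index_def)
  then have "carrier ?M \<noteq> {\<zero>\<^bsub>?M\<^esub>}" by blast
  moreover have "H = carrier ?M" if H: "submodule H (Mat2 q) ?M" "H \<noteq> {\<zero>\<^bsub>?M\<^esub>}" for H
  proof -
    interpret H: submodule H "Mat2 q" ?M by (rule H(1))
    have HS: "H \<subseteq> carrier ?M" using H.subset by simp
    have HM: "v p = 0" if "v \<in> H" "p \<notin> basis_index m" for v p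
      using gen_module_support[OF subsetD[OF HS that(1)] that(2)] .
    have act: "free_act m T v f \<in> H" if "v \<in> H" for v f
    proof -
      have "mat2_class q f \<in> carrier (Mat2 q)" by (simp add: Mat2_carrier)
      from H.smult_closed[OF this that] show ?thesis
        by (simp only: gen_module_smult_coset[OF sat subsetD[OF HS that]])
    qed
    have scale: "(\<lambda>p. c * v p) \<in> H" if "v \<in> H" for c v
      using act[OF that, of "fscalar c"] by (simp add: free_act_fscalar)
    have zero: "(\<lambda>p. 0) \<in> H" using H.one_closed by (simp add: gen_module_simps)
    have add: "(\<lambda>p. u p + v p) \<in> H" if "u \<in> H" "v \<in> H" for u v
      using H.m_closed[OF that] by (simp add: gen_module_simps)
    have sum: "(\<lambda>p. \<Sum>i\<in>I. u i p) \<in> H" if "\<And>i. i \<in> I \<Longrightarrow> u i \<in> H" for u and I :: "(nat \<times> nat) set"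
      using that
    proof (induction I rule: infinite_finite_induct)
      case (insert i I)
      then have "(\<lambda>p. u i p + (\<Sum>i\<in>I. u i p)) \<in> H" by (intro add[of "u i"]) simp_all
      with insert.hyps show ?case by simp
    qed (simp_all add: zero)
    define supp where "supp h = {s \<in> basis_index m. h s \<noteq> 0}" for h :: "'a vec"
    define nonzero where "nonzero h \<longleftrightarrow> h \<in> H \<and> h \<noteq> (\<lambda>p. 0)" for h
    have "H \<noteq> {\<lambda>p. 0}" using H(2) unfolding gen_module_simps .
    then obtain h0 where "h0 \<in> H" "h0 \<noteq> (\<lambda>p. 0)" using zero by blast
    then have "nonzero h0" unfolding nonzero_def by (rule conjI)
    then obtain h where nh: "nonzero h" and least: "\<And>h'. nonzero h' \<Longrightarrow> card (supp h) \<le> card (supp h')"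
      using ex_has_least_nat[of nonzero h0 "\<lambda>h. card (supp h)"] by blast
    have h: "h \<in> H" "h \<noteq> (\<lambda>p. 0)" using nh unfolding nonzero_def by (rule conjunct1, rule conjunct2)
    have min: "card (supp h) \<le> card (supp h')" if "h' \<in> H" "h' \<noteq> (\<lambda>p. 0)" for h'
      by (rule least) (unfold nonzero_def, rule conjI[OF that])
    obtain s where s: "h s \<noteq> 0" using h(2) by (meson ext)
    then have sb: "s \<in> basis_index m" using HM[OF h(1)] by blast
    have only: "t = s" if t: "h t \<noteq> 0" for t
    proof (rule ccontr)
      assume "t \<noteq> s"
      have tb: "t \<in> basis_index m" using HM[OF h(1)] t by blast
      have "\<exists>f d. d s \<noteq> d t \<and> (\<forall>s\<in>basis_index m. free_act m T (evec 1 s) f = evec (d s) s)"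
        using sep[OF sb tb] \<open>t \<noteq> s\<close> diag by metis
      then obtain f d where fd: "d s \<noteq> d t" "\<And>s. s \<in> basis_index m \<Longrightarrow> free_act m T (evec 1 s) f = evec (d s) s"
        by blast
      \<comment> \<open>Subtracting the eigenvalue at \<open>s\<close> deletes \<open>s\<close> from
        the support and keeps \<open>t\<close>.\<close>
      define h' where "h' = (\<lambda>p. (d p - d s) * h p)"
      have "free_act m T h f = (\<lambda>p. d p * h p)" by (rule free_act_diagonal[OF fd(2) HM[OF h(1)]])
      then have "h' = (\<lambda>p. free_act m T h f p + (- d s) * h p)" by (simp add: h'_def algebra_simps)
      then have "h' \<in> H" using add[OF act[OF h(1), of f] scale[OF h(1), of "- d s"]] by (simp only:)
      moreover have "h' \<noteq> (\<lambda>p. 0)"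
      proof
        assume "h' = (\<lambda>p. 0)"
        then have "h' t = 0" by (rule fun_cong)
        then show False using fd(1) t by (simp add: h'_def)
      qed
      ultimately have "card (supp h) \<le> card (supp h')" by (rule min)
      moreover have "s \<in> supp h" "s \<notin> supp h'" "supp h' \<subseteq> supp h"
        using sb s by (auto simp: supp_def h'_def)
      then have "supp h' \<subset> supp h" by blast
      then have "card (supp h') < card (supp h)" using fin by (intro psubset_card_mono) (simp_all add: supp_def)
      ultimately show False by simp
    qed
    have "(\<lambda>p. inverse (h s) * h p) = evec 1 s"
    proof
      show "inverse (h s) * h p = evec 1 s p" for p
        using s only[of p] by (cases "p = s") (simp_all add: evec_def, blast)
    qed
    then have es: "evec 1 s \<in> H" using scale[OF h(1), of "inverse (h s)"] by simp
    have et: "evec 1 t \<in> H" if t: "t \<in> basis_index m" for t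
    proof -
      obtain f c where fc: "c \<noteq> 0" "free_act m T (evec 1 s) f = evec c t" using reach[OF sb t] by blast
      then show ?thesis using scale[OF act[OF es, of f], of "inverse c"] by (simp add: evec_scale)
    qed
    have "v \<in> H" if v: "v \<in> carrier ?M" for v
    proof -
      have "(\<lambda>p. \<Sum>s\<in>basis_index m. v s * evec 1 s p) \<in> H" by (rule sum, rule scale, rule et)
      with vec_expand[of m v, OF gen_module_support[OF v]] show ?thesis by (rule ssubst[where P = "\<lambda>x. x \<in> H"])
    qed
    with HS show ?thesis by blast
  qed
  ultimately show ?thesis
    unfolding simple_right_module_def using right_module_gen_module[OF sat] by blast
qed

section \<open>Simplicity of the two families\<close>

lemma primitive_root_power_inj:
  fixes q :: "'k::field"
  assumes "primitive_root_of_unity m q" "q ^ a = q ^ b" "a < m" "b < m"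
  shows "a = b"
proof -
  have "a = b" if "q ^ a = q ^ b" "a \<le> b" "b < m" for a b
  proof -
    have "q \<noteq> 0" using assms(1) by (auto simp: primitive_root_of_unity_def power_0_left)
    then have "q ^ (b - a) = 1" using that by (simp add: power_diff)
    moreover have "b - a < m" using \<open>b < m\<close> by simp
    moreover have "q ^ k \<noteq> 1" if "0 < k" "k < m" for k
      using assms(1) that by (simp add: primitive_root_of_unity_def)
    ultimately have "\<not> 0 < b - a" by blast
    then show ?thesis using that by simp
  qed
  from this[of a b] this[of b a] show ?thesis using assms(2-4) by (cases "a \<le> b") simp_all
qed

definition reaches :: "nat \<Rightarrow> (gen \<Rightarrow> nat \<times> nat \<Rightarrow> 'k::field vec) \<Rightarrow> nat \<times> nat \<Rightarrow> nat \<times> nat \<Rightarrow> bool" where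
  "reaches m T s t \<longleftrightarrow> (\<exists>f c. c \<noteq> 0 \<and> free_act m T (evec 1 s) f = evec c t)"

lemma reaches_refl: "reaches m T s s"
  unfolding reaches_def by (intro exI[of _ 1]) (simp add: free_act_one)

lemma reaches_trans: "reaches m T s t \<Longrightarrow> reaches m T t u \<Longrightarrow> reaches m T s u"
proof -
  assume "reaches m T s t" "reaches m T t u"
  then obtain f c g d where *: "c \<noteq> 0" "free_act m T (evec 1 s) f = evec c t" "d \<noteq> 0" "free_act m T (evec 1 t) g = evec d u"
    unfolding reaches_def by blast
  have "free_act m T (evec c t) g = evec (c * d) u"
    using free_act_scale[of m T c "evec 1 t" g] by (simp add: evec_scale *(4))
  then show ?thesis unfolding reaches_def using * by (intro exI[of _ "f * g"] exI[of _ "c * d"]) (simp add: free_act_mult)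
qed

lemma reaches_gen: "s \<in> basis_index m \<Longrightarrow> T g s = evec c t \<Longrightarrow> c \<noteq> 0 \<Longrightarrow> reaches m T s t"
  unfolding reaches_def by (intro exI[of _ "fgen g"] exI[of _ c]) (simp add: free_act_fgen lin_ext_evec)

lemma reaches_cyclic:
  assumes step: "\<And>a. a < m \<Longrightarrow> reaches m T (e a) (e (if a < m - 1 then a + 1 else 0))" and ab: "a < m" "b < m"
  shows "reaches m T (e a) (e b)"
proof -
  have up: "reaches m T (e a) (e (a + k))" if "a + k < m" for a k
    using that
  proof (induction k)
    case (Suc k)
    have "a + k < m" "a + k < m - 1" using Suc.prems by auto
    with step[of "a + k"] have "reaches m T (e (a + k)) (e (a + Suc k))" by simp
    with Suc.IH[OF \<open>a + k < m\<close>] show ?case by (rule reaches_trans)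
  qed (simp add: reaches_refl)
  have "reaches m T (e a) (e (m - 1))" using up[of a "m - 1 - a"] ab by simp
  moreover have "reaches m T (e (m - 1)) (e 0)" using step[of "m - 1"] ab by simp
  moreover have "reaches m T (e 0) (e b)" using up[of 0 b] ab by simp
  ultimately show ?thesis using reaches_trans by blast
qed

text \<open>The eigenvalue of det_q is \<open>q ^ b * l1\<close> and determines \<open>b\<close>;
  that of Z12 Z21 then determines \<open>a\<close>. Basis vectors are joined by Z11 and Z21, which
  act cyclically with nonzero coefficients, whereas a coefficient of Z22 may vanish.\<close>

lemma simple_N1:
  fixes q :: "'k::field"
  assumes prim: "primitive_root_of_unity m q" and nz: "\<alpha> \<noteq> 0" "\<beta> \<noteq> 0" "l1 \<noteq> 0" "l2 \<noteq> 0"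
  shows "simple_right_module (Mat2 q) (N1 m q \<alpha> \<beta> l1 l2)"
proof -
  let ?T = "N1_gen m q \<alpha> \<beta> l1 l2"
  have m: "m > 0" and qm: "q ^ m = 1" using prim by (auto simp: primitive_root_of_unity_def)
  have q0: "q \<noteq> 0" using m qm by (auto simp: power_0_left)
  have sat: "satisfies_relations q m ?T" using N1_satisfies_relations[OF m qm nz(1,2)] .
  have qm1: "q ^ (m - 1) = inverse q"
    using power_minus_mult[OF m, of q] qm inverse_unique[of q "q ^ (m - 1)"] by (simp add: mult.commute)
  have powi_neg: "q powi (- int a) = inverse q ^ a" for a by (simp add: power_int_minus power_inverse)
  have powi_diff: "q powi (int b - int a) = q ^ b * inverse q ^ a" for a b
    using q0 by (simp add: power_int_diff power_inverse divide_inverse)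
  have bi: "(a, b) \<in> basis_index m \<longleftrightarrow> a < m \<and> b < m" for a b by (simp add: basis_index_def)
  define d1 d2 where "d1 = (\<lambda>(a :: nat, b :: nat). q ^ b * l1)" and "d2 = (\<lambda>(a :: nat, b :: nat). q ^ b * inverse q ^ a * l2)"
  note [simp] = free_act_diff free_act_mult free_act_fgen lin_ext_evec evec_scale evec_diff bi
  have v: "free_act m ?T (evec 1 s) (fgen Z12 * fgen Z21) = evec (d2 s) s" if s: "s \<in> basis_index m" for s
  proof -
    obtain a b where ab: "s = (a, b)" "a < m" "b < m" using s by (cases s) (auto simp: bi)
    show ?thesis
    proof (cases b)
      case 0
      have c: "inverse \<beta> * l2 * x * \<beta> = x * l2" for x using nz by simp
      show ?thesis using ab m nz 0 by (simp add: d2_def powi_neg c)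
    next
      case (Suc b')
      have "b' < m - Suc 0" using ab Suc by simp
      then show ?thesis using ab Suc by (simp add: d2_def powi_diff del: of_nat_Suc)
    qed
  qed
  have u: "free_act m ?T (evec 1 s) (fgen Z11 * fgen Z22 - fgen Z12 * fgen Z21) = evec (d1 s) s" if s: "s \<in> basis_index m" for s
  proof -
    obtain a b where ab: "s = (a, b)" "a < m" "b < m" using s by (cases s) (auto simp: bi)
    have "free_act m ?T (evec 1 s) (fgen Z11 * fgen Z22) = evec (q ^ b * (l1 + inverse q ^ a * l2)) s"
    proof (cases "a < m - 1")
      case True
      have cancel: "l1 + x - (x - y) = l1 + y" for x y by simp
      have "q * inverse q ^ (a + 1) = inverse q ^ a" using q0 by simp
      moreover have "q * (1 - x) * l2 = q * l2 - (q * x) * l2" for x by (simp add: algebra_simps)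
      ultimately have c: "l1 + q * l2 - q * (1 - q powi (- int (a + 1))) * l2 = l1 + inverse q ^ a * l2"
        unfolding powi_neg by (simp only: cancel)
      have "free_act m ?T (evec 1 s) (fgen Z11 * fgen Z22)
          = evec (q ^ b * (l1 + q * l2 - q * (1 - q powi (- int (a + 1))) * l2)) s"
        using ab True by simp
      then show ?thesis unfolding c .
    next
      case False
      have c: "q ^ b * \<alpha> * (inverse \<alpha> * x) = q ^ b * x" for x using nz by simp
      from False have "a = m - 1" using ab by simp
      moreover have "inverse q ^ (m - 1) = q" using qm1 q0 by (simp add: power_inverse)
      ultimately show ?thesis using ab m False by (simp add: c)
    qed
    then show ?thesis using v[OF s] ab(1) by (simp add: d1_def d2_def algebra_simps)
  qed
  show ?thesis
    unfolding N1_def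
  proof (rule simple_gen_module[OF sat m u v])
    fix s t assume st: "s \<in> basis_index m" "t \<in> basis_index m" "d1 s = d1 t" "d2 s = d2 t"
    obtain a b a' b' where ab: "s = (a, b)" "t = (a', b')" by (cases s; cases t)
    have "b = b'" using st nz primitive_root_power_inj[OF prim, of b b'] by (simp add: ab d1_def bi)
    moreover from this have "q ^ a = q ^ a'" using st nz q0 by (simp add: ab d2_def power_inverse)
    then have "a = a'" using st primitive_root_power_inj[OF prim, of a a'] by (simp add: ab bi)
    ultimately show "s = t" by (simp add: ab)
  next
    fix s t assume st: "s \<in> basis_index m" "t \<in> basis_index m"
    obtain a b a' b' where ab: "s = (a, b)" "t = (a', b')" by (cases s; cases t)
    have lt: "a < m" "b < m" "a' < m" "b' < m" using st by (auto simp: ab bi)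
    have "reaches m ?T (a, b) (a', b)"
    proof (rule reaches_cyclic[where e = "\<lambda>a. (a, b)"])
      show "reaches m ?T (a, b) (if a < m - 1 then a + 1 else 0, b)" if "a < m" for a
        using that lt nz q0 by (intro reaches_gen[of _ _ _ Z11 "if a < m - 1 then q ^ b else q ^ b * \<alpha>"]) simp_all
    qed (use lt in auto)
    moreover have "reaches m ?T (a', b) (a', b')"
    proof (rule reaches_cyclic[where e = "\<lambda>b. (a', b)"])
      show "reaches m ?T (a', b) (a', if b < m - 1 then b + 1 else 0)" if "b < m" for b
        using that lt nz q0 by (intro reaches_gen[of _ _ _ Z21 "if b < m - 1 then 1 else \<beta>"]) simp_all
    qed (use lt in auto)
    ultimately have "reaches m ?T s t" unfolding ab by (rule reaches_trans)
    then show "\<exists>f c. c \<noteq> 0 \<and> free_act m ?T (evec 1 s) f = evec c t" by (simp add: reaches_def)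
  qed
qed

text \<open>Again det_q determines \<open>b\<close>, and Z12 Z21 then determines \<open>a\<close>.
  Since \<gamma> may be 0, the first index is not treated as a cycle: Z11 lowers it, with
  \<open>q ^ a - 1\<close> nonzero for \<open>0 < a < m\<close> by primitivity, and Z22 raises it
  from 0.\<close>

lemma simple_N2:
  fixes q :: "'k::field"
  assumes prim: "primitive_root_of_unity m q" and nz: "\<beta> \<noteq> 0" "l2 \<noteq> 0"
  shows "simple_right_module (Mat2 q) (N2 m q r \<beta> \<gamma> l2)"
proof -
  let ?T = "N2_gen m q r \<beta> \<gamma> l2"
  have m: "m > 0" and qm: "q ^ m = 1" using prim by (auto simp: primitive_root_of_unity_def)
  have q0: "q \<noteq> 0" using m qm by (auto simp: power_0_left)
  have sat: "satisfies_relations q m ?T" using N2_satisfies_relations[OF m qm nz(1)] .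
  have bi: "(a, b) \<in> basis_index m \<longleftrightarrow> a < m \<and> b < m" for a b by (simp add: basis_index_def)
  define k where "k = q powi (- int r) * l2"
  have k0: "k \<noteq> 0" using nz q0 by (simp add: k_def)
  define d1 d2 where "d1 = (\<lambda>(a :: nat, b :: nat). - (q ^ b * k))" and "d2 = (\<lambda>(a :: nat, b :: nat). q ^ (a + b) * k)"
  note [simp] = free_act_diff free_act_mult free_act_fgen lin_ext_evec evec_scale evec_diff bi lin_ext_zero
  have v: "free_act m ?T (evec 1 s) (fgen Z12 * fgen Z21) = evec (d2 s) s" if s: "s \<in> basis_index m" for s
  proof -
    obtain a b where ab: "s = (a, b)" "a < m" "b < m" using s by (cases s) (auto simp: bi)
    show ?thesis
    proof (cases b)
      case 0
      have c: "inverse \<beta> * x * y * z * \<beta> = x * (y * z)" for x y z using nz by simp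
      show ?thesis using ab m 0 by (simp add: d2_def k_def c)
    next
      case (Suc b')
      have "b' < m - Suc 0" using ab Suc by simp
      then show ?thesis using ab Suc by (simp add: d2_def k_def mult.assoc[symmetric])
    qed
  qed
  have u: "free_act m ?T (evec 1 s) (fgen Z11 * fgen Z22 - fgen Z12 * fgen Z21) = evec (d1 s) s" if s: "s \<in> basis_index m" for s
  proof -
    obtain a b where ab: "s = (a, b)" "a < m" "b < m" using s by (cases s) (auto simp: bi)
    have "free_act m ?T (evec 1 s) (fgen Z11 * fgen Z22) = evec (q ^ b * (q ^ a - 1) * k) s"
    proof (cases a)
      case 0
      have "evec 0 s = (\<lambda>p. 0 :: 'k)" for s by (simp add: evec_def)
      with 0 show ?thesis using ab m by simp
    next
      case (Suc a')
      have "a' < m - Suc 0" using ab Suc by simp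
      then show ?thesis using ab Suc by (simp add: k_def mult.assoc[symmetric])
    qed
    then show ?thesis using v[OF s] ab(1) by (simp add: d1_def d2_def algebra_simps power_add)
  qed
  show ?thesis
    unfolding N2_def
  proof (rule simple_gen_module[OF sat m u v])
    fix s t assume st: "s \<in> basis_index m" "t \<in> basis_index m" "d1 s = d1 t" "d2 s = d2 t"
    obtain a b a' b' where ab: "s = (a, b)" "t = (a', b')" by (cases s; cases t)
    have "b = b'" using st k0 primitive_root_power_inj[OF prim, of b b'] by (simp add: ab d1_def bi)
    moreover from this have "q ^ a = q ^ a'" using st k0 q0 by (simp add: ab d2_def power_add)
    then have "a = a'" using st primitive_root_power_inj[OF prim, of a a'] by (simp add: ab bi)
    ultimately show "s = t" by (simp add: ab)
  next
    fix s t assume st: "s \<in> basis_index m" "t \<in> basis_index m"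
    obtain a b a' b' where ab: "s = (a, b)" "t = (a', b')" by (cases s; cases t)
    have lt: "a < m" "b < m" "a' < m" "b' < m" using st by (auto simp: ab bi)
    have down: "reaches m ?T (a, b) (0, b)" if "a < m" for a
      using that
    proof (induction a)
      case (Suc a)
      have "q ^ Suc a \<noteq> 1" using prim Suc.prems by (simp add: primitive_root_of_unity_def del: power_Suc)
      then have "reaches m ?T (Suc a, b) (a, b)" using Suc.prems lt nz q0
        by (intro reaches_gen[of _ _ _ Z11 "q ^ b * (q ^ Suc a - 1) * q powi (- int r) * l2"]) simp_all
      then show ?case using Suc reaches_trans by (meson Suc_lessD)
    qed (simp add: reaches_refl)
    have up: "reaches m ?T (0, b) (a, b)" if "a < m" for a
      using that
    proof (induction a)
      case (Suc a)
      have "a < m - Suc 0" using Suc.prems by simp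
      then have "reaches m ?T (a, b) (Suc a, b)" using Suc.prems lt by (intro reaches_gen[of _ _ _ Z22 1]) simp_all
      then show ?case using Suc reaches_trans by (meson Suc_lessD)
    qed (simp add: reaches_refl)
    have "reaches m ?T (a', b) (a', b')"
    proof (rule reaches_cyclic[where e = "\<lambda>b. (a', b)"])
      show "reaches m ?T (a', b) (a', if b < m - 1 then b + 1 else 0)" if "b < m" for b
        using that lt nz q0 by (intro reaches_gen[of _ _ _ Z21 "if b < m - 1 then 1 else \<beta>"]) simp_all
    qed (use lt in auto)
    then have "reaches m ?T s t" unfolding ab using down[OF lt(1)] up[OF lt(3)] reaches_trans by blast
    then show "\<exists>f c. c \<noteq> 0 \<and> free_act m ?T (evec 1 s) f = evec c t" by (simp add: reaches_def)
  qed
qed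

section \<open>Right modules as representations\<close>

context right_module
begin

lemma smult_zero: "x \<in> carrier M \<Longrightarrow> \<zero>\<^bsub>R\<^esub> \<odot>\<^bsub>M\<^esub> x = \<zero>\<^bsub>M\<^esub>"
  using act_add_ring[of "\<zero>\<^bsub>R\<^esub>" "\<zero>\<^bsub>R\<^esub>" x] act_closed[of "\<zero>\<^bsub>R\<^esub>" x]
  by (metis R.l_zero R.zero_closed M.add.l_cancel_one')

lemma smult_minus_one: "x \<in> carrier M \<Longrightarrow> (\<ominus>\<^bsub>R\<^esub> \<one>\<^bsub>R\<^esub>) \<odot>\<^bsub>M\<^esub> x = \<ominus>\<^bsub>M\<^esub> x"
  using act_add_ring[of "\<ominus>\<^bsub>R\<^esub> \<one>\<^bsub>R\<^esub>" "\<one>\<^bsub>R\<^esub>" x] act_closed[of "\<ominus>\<^bsub>R\<^esub> \<one>\<^bsub>R\<^esub>" x]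
  by (simp add: act_one R.l_neg smult_zero M.minus_equality)

lemma right_submoduleI:
  assumes "H \<subseteq> carrier M" "\<zero>\<^bsub>M\<^esub> \<in> H" "\<And>x y. x \<in> H \<Longrightarrow> y \<in> H \<Longrightarrow> x \<oplus>\<^bsub>M\<^esub> y \<in> H"
    "\<And>r x. r \<in> carrier R \<Longrightarrow> x \<in> H \<Longrightarrow> r \<odot>\<^bsub>M\<^esub> x \<in> H"
  shows "submodule H R M"
proof -
  have "\<ominus>\<^bsub>M\<^esub> x \<in> H" if "x \<in> H" for x
    using assms(4)[of "\<ominus>\<^bsub>R\<^esub> \<one>\<^bsub>R\<^esub>" x] smult_minus_one[of x] assms(1) that by auto
  then have "subgroup H (add_monoid M)"
    using assms(1-3) by (intro M.add.subgroupI) (auto simp: a_inv_def)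
  then show ?thesis using assms(4) by (simp add: submodule_def submodule_axioms_def)
qed

end

lemma fscalar_mult: "fscalar a * fscalar b = fscalar (a * b)"
  by (simp add: fscalar_def mult_single)

lemma fscalar_add: "fscalar (a + b) = fscalar a + fscalar b"
  by (simp add: fscalar_def single_add)

lemma fscalar_one: "fscalar 1 = 1"
  by (simp add: fscalar_def single_one)

lemma fscalar_fgen: "fscalar c * fgen g = fgen g * fscalar c"
  by (simp add: fscalar_def fgen_def mult_single)

text \<open>Words are peeled from the left because in a right module the leftmost letter acts
  first.\<close>

lemma free_alg_induct_gen [case_names scalar gen add]:
  fixes f :: "'k::field free_alg"
  assumes scalar: "\<And>c. P (fscalar c)" and gen: "\<And>g f. P f \<Longrightarrow> P (fgen g * f)" and add: "\<And>f f'. P f \<Longrightarrow> P f' \<Longrightarrow> P (f + f')"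
  shows "P f"
proof (induction f rule: free_alg_induct)
  case (single w c)
  obtain xs where w: "w = Word xs" by (cases w)
  show ?case unfolding w
  proof (induction xs)
    case Nil
    show ?case using scalar[of c] by (simp add: fscalar_def zero_word_def)
  next
    case (Cons g xs)
    have "fgen g * Poly_Mapping.single (Word xs) c = Poly_Mapping.single (Word (g # xs)) c"
      by (simp add: fgen_def mult_single plus_word_def)
    then show ?case using gen[OF Cons, of g] by simp
  qed
qed (rule add)

lemma fscalar_commute: "fscalar c * f = f * fscalar c"
proof (induction f rule: free_alg_induct_gen)
  case (gen g f)
  have "fscalar c * (fgen g * f) = fgen g * (fscalar c * f)" by (simp add: mult.assoc[symmetric] fscalar_fgen)
  then show ?case by (simp only: gen mult.assoc)
qed (simp_all add: fscalar_mult mult.commute distrib_left distrib_right)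

locale mat2_right_module = right_module "Mat2 q" M
  for q :: "'k::alg_closed_field" and M :: "('k free_alg set, 'v) module" +
  fixes m :: nat
  assumes prim: "primitive_root_of_unity m q"
begin

text \<open>The action is pulled back to the free algebra, so that identities can be checked on
  representatives instead of cosets.\<close>

definition opr :: "'k free_alg \<Rightarrow> 'v \<Rightarrow> 'v" where "opr f x = mat2_class q f \<odot>\<^bsub>M\<^esub> x"

abbreviation scal :: "'k \<Rightarrow> 'v \<Rightarrow> 'v" where "scal c \<equiv> opr (fscalar c)"

lemma class_closed: "mat2_class q f \<in> carrier (Mat2 q)"
  by (simp add: Mat2_carrier)

lemma opr_closed [simp]: "x \<in> carrier M \<Longrightarrow> opr f x \<in> carrier M"
  by (simp add: opr_def act_closed class_closed)

lemma opr_add: "x \<in> carrier M \<Longrightarrow> opr (f + g) x = opr f x \<oplus>\<^bsub>M\<^esub> opr g x"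
  using act_add_ring[OF class_closed class_closed, of x f g] by (simp add: opr_def Mat2_add)

lemma opr_add_right: "x \<in> carrier M \<Longrightarrow> y \<in> carrier M \<Longrightarrow> opr f (x \<oplus>\<^bsub>M\<^esub> y) = opr f x \<oplus>\<^bsub>M\<^esub> opr f y"
  by (simp add: opr_def act_add_module class_closed)

lemma opr_mult: "x \<in> carrier M \<Longrightarrow> opr (f * g) x = opr g (opr f x)"
  using act_mult[OF class_closed class_closed, of x f g] by (simp add: opr_def Mat2_mult)

lemma opr_one: "x \<in> carrier M \<Longrightarrow> opr 1 x = x"
  using act_one[of x] by (simp add: opr_def Mat2_one)

lemma opr_relation: "f - g \<in> mat2_relations q \<Longrightarrow> opr f x = opr g x"
  by (simp add: opr_def mat2_class_relation)

sublocale comm_ring_action M scal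
  by unfold_locales
    (simp_all add: opr_add opr_add_right opr_one opr_mult[symmetric] fscalar_add fscalar_one fscalar_mult mult.commute)

lemma opr_diff: "x \<in> carrier M \<Longrightarrow> opr (f - g) x = opr f x \<ominus>\<^bsub>M\<^esub> opr g x"
proof -
  assume x: "x \<in> carrier M"
  have "opr (f - g) x \<oplus>\<^bsub>M\<^esub> opr g x = opr f x" using opr_add[OF x, of "f - g" g] by simp
  then show ?thesis using x by (metis M.add.inv_solve_right a_minus_def opr_closed a_inv_def)
qed

lemma opr_scal: "x \<in> carrier M \<Longrightarrow> opr f (scal c x) = scal c (opr f x)"
  by (simp add: opr_mult[symmetric] fscalar_commute)

sublocale mat2_rep M scal q m "\<lambda>g. opr (fgen g)"
proof unfold_locales
  show "additive_on M (opr (fgen g))" for g by (simp add: additive_on_def opr_add_right)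
  show "opr (fgen g) (scal c x) = scal c (opr (fgen g) x)" if "x \<in> carrier M" for x g c
    using that by (simp add: opr_mult[symmetric] fscalar_fgen)
  fix x assume x: "x \<in> carrier M"
  have rel: "opr f x = opr g x" if "f - g \<in> mat2_relations q" for f g by (rule opr_relation[OF that])
  show "opr (fgen Z11) (opr (fgen Z12) x) = opr (fgen Z12) (opr (fgen Z11) x)"
    using rel[of "fgen Z12 * fgen Z11" "fgen Z11 * fgen Z12"] x by (simp add: mat2_relations_def opr_mult)
  show "opr (fgen Z11) (opr (fgen Z21) x) = scal q (opr (fgen Z21) (opr (fgen Z11) x))"
    using rel[of "fgen Z21 * fgen Z11" "fscalar q * (fgen Z11 * fgen Z21)"] x
    by (simp add: mat2_relations_def opr_mult opr_scal)
  show "opr (fgen Z21) (opr (fgen Z22) x) = opr (fgen Z22) (opr (fgen Z21) x)"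
    using rel[of "fgen Z22 * fgen Z21" "fgen Z21 * fgen Z22"] x by (simp add: mat2_relations_def opr_mult)
  show "opr (fgen Z12) (opr (fgen Z22) x) = scal q (opr (fgen Z22) (opr (fgen Z12) x))"
    using rel[of "fgen Z22 * fgen Z12" "fscalar q * (fgen Z12 * fgen Z22)"] x
    by (simp add: mat2_relations_def opr_mult opr_scal)
  show "opr (fgen Z12) (opr (fgen Z21) x) = scal q (opr (fgen Z21) (opr (fgen Z12) x))"
    using rel[of "fgen Z21 * fgen Z12" "fscalar q * (fgen Z12 * fgen Z21)"] x
    by (simp add: mat2_relations_def opr_mult opr_scal)
  show "opr (fgen Z11) (opr (fgen Z22) x)
      = opr (fgen Z22) (opr (fgen Z11) x) \<oplus>\<^bsub>M\<^esub> scal (q - 1) (opr (fgen Z21) (opr (fgen Z12) x))"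
    using rel[of "fgen Z22 * fgen Z11" "fgen Z11 * fgen Z22 + fscalar (q - 1) * (fgen Z12 * fgen Z21)"] x
    by (simp add: mat2_relations_def opr_mult opr_add opr_scal)
qed (rule prim)

lemma D_eq_opr: "x \<in> carrier M \<Longrightarrow> D x = opr (fgen Z11 * fgen Z22 - fgen Z12 * fgen Z21) x"
  by (simp add: D_def opr_diff opr_mult)

lemma V_eq_opr: "x \<in> carrier M \<Longrightarrow> V x = opr (fgen Z12 * fgen Z21) x"
  by (simp add: V_def opr_mult)

lemma opr_mem:
  assumes H: "H \<subseteq> carrier M" "\<And>x y. x \<in> H \<Longrightarrow> y \<in> H \<Longrightarrow> x \<oplus>\<^bsub>M\<^esub> y \<in> H"
    "\<And>c x. x \<in> H \<Longrightarrow> scal c x \<in> H" "\<And>g x. x \<in> H \<Longrightarrow> opr (fgen g) x \<in> H" and x: "x \<in> H"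
  shows "opr f x \<in> H"
  using x
proof (induction f arbitrary: x rule: free_alg_induct_gen)
  case (scalar c)
  then show ?case by (rule H(3))
next
  case (gen g f)
  have "opr f (opr (fgen g) x) \<in> H" by (rule gen.IH[OF H(4)[OF gen.prems]])
  then show ?case using opr_mult[OF subsetD[OF H(1) gen.prems]] by simp
next
  case (add f f')
  have "opr f x \<oplus>\<^bsub>M\<^esub> opr f' x \<in> H" by (rule H(2)[OF add.IH(1)[OF add.prems] add.IH(2)[OF add.prems]])
  then show ?case using opr_add[OF subsetD[OF H(1) add.prems]] by simp
qed

lemma torsionfree_inj:
  assumes "torsionfree (Mat2 q) (mat2_class q f) M" "x \<in> carrier M" "opr f x = \<zero>\<^bsub>M\<^esub>"
  shows "x = \<zero>\<^bsub>M\<^esub>"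
proof -
  have "mat2_class q f [^]\<^bsub>Mat2 q\<^esub> (1 :: nat) = mat2_class q f"
    using class_closed by (rule R.nat_pow_eone)
  then show ?thesis using assms unfolding torsionfree_def opr_def by metis
qed

lemma simple_mat2_repI:
  assumes "simple_right_module (Mat2 q) M" "torsionfree (Mat2 q) (det_q q) M"
    "torsionfree (Mat2 q) (Zgen q Z12 \<otimes>\<^bsub>Mat2 q\<^esub> Zgen q Z21) M"
  shows "simple_mat2_rep M scal q m (\<lambda>g. opr (fgen g))"
proof unfold_locales
  show "carrier M \<noteq> {\<zero>\<^bsub>M\<^esub>}" using assms(1) by (simp add: simple_right_module_def)
  fix H
  assume H: "H \<subseteq> carrier M" "\<zero>\<^bsub>M\<^esub> \<in> H" "\<And>x y. x \<in> H \<Longrightarrow> y \<in> H \<Longrightarrow> x \<oplus>\<^bsub>M\<^esub> y \<in> H"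
    "\<And>c x. x \<in> H \<Longrightarrow> scal c x \<in> H" "\<And>g x. x \<in> H \<Longrightarrow> opr (fgen g) x \<in> H"
  have "submodule H (Mat2 q) M"
  proof (rule right_submoduleI[OF H(1-3)])
    fix r x assume "r \<in> carrier (Mat2 q)" and x: "x \<in> H"
    then obtain f where "r = mat2_class q f" by (auto simp: Mat2_carrier)
    then show "r \<odot>\<^bsub>M\<^esub> x \<in> H" using opr_mem[OF H(1,3-5) x, of f] by (simp add: opr_def)
  qed
  then show "H = {\<zero>\<^bsub>M\<^esub>} \<or> H = carrier M" using assms(1) by (simp add: simple_right_module_def)
next
  fix x assume x: "x \<in> carrier M"
  show "x = \<zero>\<^bsub>M\<^esub>" if "D x = \<zero>\<^bsub>M\<^esub>"
    using torsionfree_inj[OF assms(2)[unfolded det_q_class] x] that D_eq_opr[OF x] by simp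
  show "x = \<zero>\<^bsub>M\<^esub>" if "V x = \<zero>\<^bsub>M\<^esub>"
    using torsionfree_inj[OF assms(3)[unfolded Zgen_def Mat2_mult] x] that V_eq_opr[OF x] by simp
qed

section \<open>The homomorphism defined by a realisation\<close>

definition comb :: "(nat \<times> nat \<Rightarrow> 'v) \<Rightarrow> 'k vec \<Rightarrow> 'v" where
  "comb E v = finsum M (\<lambda>s. scal (v s) (E s)) (basis_index m)"

context
  fixes E :: "nat \<times> nat \<Rightarrow> 'v"
  assumes E: "\<And>s. s \<in> basis_index m \<Longrightarrow> E s \<in> carrier M"
begin

lemma comb_closed: "comb E v \<in> carrier M"
  unfolding comb_def using E by (intro finsum_closed) auto

lemma comb_add: "comb E (\<lambda>p. u p + v p) = comb E u \<oplus>\<^bsub>M\<^esub> comb E v"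
proof -
  have "comb E (\<lambda>p. u p + v p) = finsum M (\<lambda>s. scal (u s) (E s) \<oplus>\<^bsub>M\<^esub> scal (v s) (E s)) (basis_index m)"
    unfolding comb_def using E by (intro finsum_cong') (auto simp: act_add_left)
  also have "\<dots> = comb E u \<oplus>\<^bsub>M\<^esub> comb E v"
    unfolding comb_def using E by (intro finsum_addf) auto
  finally show ?thesis .
qed

lemma additive_on_finsum:
  assumes S: "additive_on M S" and I: "finite I" "\<And>i. i \<in> I \<Longrightarrow> h i \<in> carrier M"
  shows "S (finsum M h I) = finsum M (\<lambda>i. S (h i)) I"
  using I
proof (induction I rule: finite_induct)
  case empty
  then show ?case using additive_on_zero[OF S] by simp
next
  case (insert i I)
  have hc: "h \<in> I \<rightarrow> carrier M" "h i \<in> carrier M" "(\<lambda>i. S (h i)) \<in> I \<rightarrow> carrier M" "S (h i) \<in> carrier M"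
    using insert.prems S by (auto simp: additive_on_def)
  then have "S (finsum M h (insert i I)) = S (h i) \<oplus>\<^bsub>M\<^esub> S (finsum M h I)"
    using insert.hyps S by (simp add: additive_on_def)
  then show ?case using insert hc by simp
qed

lemma finite_basis_index: "finite (basis_index m)"
  by (simp add: basis_index_def)

lemma comb_evec: "s \<in> basis_index m \<Longrightarrow> comb E (evec c s) = scal c (E s)"
proof -
  assume s: "s \<in> basis_index m"
  have "comb E (evec c s) = finsum M (\<lambda>t. if s = t then scal c (E t) else \<zero>\<^bsub>M\<^esub>) (basis_index m)"
    unfolding comb_def using E by (intro finsum_cong') (auto simp: evec_def)
  also have "\<dots> = scal c (E s)" using E s finite_basis_index by (intro add.finprod_singleton) auto
  finally show ?thesis .
qed

lemma comb_scale: "comb E (\<lambda>p. c * v p) = scal c (comb E v)"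
proof -
  have "additive_on M (scal c)" by (simp add: additive_on_def act_add_right)
  then have "scal c (comb E v) = finsum M (\<lambda>s. scal c (scal (v s) (E s))) (basis_index m)"
    unfolding comb_def using E finite_basis_index by (intro additive_on_finsum) auto
  also have "\<dots> = comb E (\<lambda>p. c * v p)"
    unfolding comb_def using E by (intro finsum_cong') (auto simp: act_mult)
  finally show ?thesis by simp
qed

lemma comb_sum: "finite I \<Longrightarrow> comb E (\<lambda>p. \<Sum>i\<in>I. u i p) = finsum M (\<lambda>i. comb E (u i)) I"
proof (induction I rule: finite_induct)
  case empty
  have "comb E (\<lambda>p. 0) = \<zero>\<^bsub>M\<^esub>"
    using comb_scale[of 0 "\<lambda>p. 0"] comb_closed by simp
  then show ?case by simp
next
  case (insert i I)
  have "(\<lambda>i. comb E (u i)) \<in> I \<rightarrow> carrier M" using comb_closed by blast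
  then show ?case using insert comb_closed by (simp add: comb_add)
qed

lemma comb_lin_ext:
  assumes "\<And>s. s \<in> basis_index m \<Longrightarrow> comb E (G g s) = opr (fgen g) (E s)"
  shows "comb E (lin_ext m (G g) v) = opr (fgen g) (comb E v)"
proof -
  have "comb E (lin_ext m (G g) v) = finsum M (\<lambda>s. comb E (\<lambda>p. v s * G g s p)) (basis_index m)"
    unfolding lin_ext_def by (rule comb_sum[OF finite_basis_index])
  also have "\<dots> = finsum M (\<lambda>s. opr (fgen g) (scal (v s) (E s))) (basis_index m)"
    using E assms by (intro finsum_cong') (auto simp: comb_scale T_scal)
  also have "\<dots> = opr (fgen g) (comb E v)"
    unfolding comb_def using E finite_basis_index by (intro additive_on_finsum[symmetric] T_additive) auto
  finally show ?thesis .
qed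

lemma comb_free_act:
  assumes "\<And>g s. s \<in> basis_index m \<Longrightarrow> comb E (G g s) = opr (fgen g) (E s)"
  shows "comb E (free_act m G v f) = opr f (comb E v)"
proof (induction f arbitrary: v rule: free_alg_induct_gen)
  case (scalar c)
  show ?case by (simp add: free_act_fscalar comb_scale)
next
  case (gen g f)
  show ?case using gen.IH comb_lin_ext[of G g v, OF assms] comb_closed
    by (simp add: free_act_mult free_act_fgen opr_mult)
next
  case (add f f')
  then show ?case using comb_closed by (simp add: free_act_add comb_add opr_add)
qed

end

text \<open>\<open>comb E\<close> is a homomorphism from the basis module to \<open>M\<close>,
  nonzero at the basis vector with index \<open>(0, 0)\<close>. Both modules are simple, so its
  kernel is zero and its image is everything. The basis makes this direction easy to define; the
  isomorphism asked for is its inverse.\<close>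

lemma right_module_iso_gen_module:
  assumes M: "simple_right_module (Mat2 q) M" and N: "simple_right_module (Mat2 q) (gen_module m G)"
    and sat: "satisfies_relations q m G" and real: "realises G E"
  shows "right_module_iso (Mat2 q) M (gen_module m G)"
proof -
  let ?N = "gen_module m G"
  interpret N: right_module "Mat2 q" ?N using N by (simp add: simple_right_module_def)
  have E: "E s \<in> carrier M" if "s \<in> basis_index m" for s using realises_closed[OF real that] .
  have gen: "comb E (G g s) = opr (fgen g) (E s)" if s: "s \<in> basis_index m" for g s
  proof -
    obtain c t where t: "t \<in> basis_index m" "G g s = evec c t" "opr (fgen g) (E s) = scal c (E t)"
      using realises_gen[OF real s] by blast
    show ?thesis unfolding t(2,3) by (rule comb_evec[OF E t(1)])
  qed
  note closed = comb_closed[of E, OF E]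
  have add: "comb E (u \<oplus>\<^bsub>?N\<^esub> v) = comb E u \<oplus>\<^bsub>M\<^esub> comb E v" for u v
    using comb_add[of E u v, OF E] by (simp add: gen_module_simps)
  have smult: "comb E (r \<odot>\<^bsub>?N\<^esub> v) = r \<odot>\<^bsub>M\<^esub> comb E v" if r: "r \<in> carrier (Mat2 q)" and v: "v \<in> carrier ?N" for r v
  proof -
    obtain f where f: "r = mat2_class q f" using r by (auto simp: Mat2_carrier)
    show ?thesis using comb_free_act[of E G v f, OF E gen] v by (simp add: f gen_module_smult_coset[OF sat] opr_def)
  qed
  have zero: "comb E \<zero>\<^bsub>?N\<^esub> = \<zero>\<^bsub>M\<^esub>"
    using comb_scale[of E 0 "\<lambda>p. 0", OF E] closed by (simp add: gen_module_simps)
  have "submodule {v \<in> carrier ?N. comb E v = \<zero>\<^bsub>M\<^esub>} (Mat2 q) ?N"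
  proof (rule N.right_submoduleI)
    fix r v assume r: "r \<in> carrier (Mat2 q)" and v: "v \<in> {v \<in> carrier ?N. comb E v = \<zero>\<^bsub>M\<^esub>}"
    obtain f where f: "r = mat2_class q f" using r by (auto simp: Mat2_carrier)
    have "opr f \<zero>\<^bsub>M\<^esub> = \<zero>\<^bsub>M\<^esub>" by (rule additive_on_zero) (simp add: additive_on_def opr_add_right)
    then show "r \<odot>\<^bsub>?N\<^esub> v \<in> {v \<in> carrier ?N. comb E v = \<zero>\<^bsub>M\<^esub>}"
      using smult[OF r] v N.act_closed[OF r] by (simp add: f opr_def)
  qed (simp_all add: add zero)
  moreover have "evec 1 (0, 0) \<in> carrier ?N" "comb E (evec 1 (0, 0)) \<noteq> \<zero>\<^bsub>M\<^esub>"
  proof -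
    have 0: "(0, 0) \<in> basis_index m" using m_pos by (simp add: basis_index_def)
    then show "evec 1 (0, 0) \<in> carrier ?N" by (auto simp: gen_module_simps evec_def)
    show "comb E (evec 1 (0, 0)) \<noteq> \<zero>\<^bsub>M\<^esub>"
      using comb_evec[of E "(0, 0)" 1, OF E 0] E[OF 0] realises_nonzero[OF real] by (simp add: fscalar_one opr_one)
  qed
  ultimately have ker: "{v \<in> carrier ?N. comb E v = \<zero>\<^bsub>M\<^esub>} = {\<zero>\<^bsub>?N\<^esub>}"
    using N unfolding simple_right_module_def by blast
  have inj: "inj_on (comb E) (carrier ?N)"
  proof (rule inj_onI)
    fix u v assume uv: "u \<in> carrier ?N" "v \<in> carrier ?N" "comb E u = comb E v"
    define w where "w = (\<lambda>p. u p + (- 1) * v p)"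
    have "comb E w = comb E u \<oplus>\<^bsub>M\<^esub> scal (- 1) (comb E v)"
      unfolding w_def using comb_add[of E u "\<lambda>p. (- 1) * v p", OF E] comb_scale[of E "- 1" v, OF E] by (simp only:)
    also have "\<dots> = \<zero>\<^bsub>M\<^esub>"
      using act_minus_left[OF closed, of 1 v] act_one[OF closed, of v] closed[of v] uv(3) by (simp only: r_neg)
    finally have "comb E w = \<zero>\<^bsub>M\<^esub>" .
    moreover have "w \<in> carrier ?N" using uv(1,2) by (simp add: w_def gen_module_simps)
    ultimately have "w = \<zero>\<^bsub>?N\<^esub>" using ker by blast
    then have "w p = 0" for p by (simp add: gen_module_simps)
    then show "u = v" by (auto simp: w_def)
  qed
  have "submodule (comb E ` carrier ?N) (Mat2 q) M"
  proof (rule right_submoduleI)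
    show "comb E ` carrier ?N \<subseteq> carrier M" using closed by blast
    show "\<zero>\<^bsub>M\<^esub> \<in> comb E ` carrier ?N" using zero by (metis N.M.zero_closed imageI)
    show "x \<oplus>\<^bsub>M\<^esub> y \<in> comb E ` carrier ?N" if "x \<in> comb E ` carrier ?N" "y \<in> comb E ` carrier ?N" for x y
    proof -
      obtain u v where "u \<in> carrier ?N" "v \<in> carrier ?N" "x = comb E u" "y = comb E v" using \<open>x \<in> _\<close> \<open>y \<in> _\<close> by blast
      then show ?thesis using add[of u v, symmetric] by simp
    qed
    show "r \<odot>\<^bsub>M\<^esub> x \<in> comb E ` carrier ?N" if "r \<in> carrier (Mat2 q)" "x \<in> comb E ` carrier ?N" for r x
    proof -
      obtain u where u: "u \<in> carrier ?N" "x = comb E u" using \<open>x \<in> _\<close> by blast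
      then show ?thesis using smult[OF that(1) u(1), symmetric] N.act_closed[OF that(1) u(1)] by simp
    qed
  qed
  then have "comb E ` carrier ?N = {\<zero>\<^bsub>M\<^esub>} \<or> comb E ` carrier ?N = carrier M"
    using M unfolding simple_right_module_def by blast
  with \<open>evec 1 (0, 0) \<in> carrier ?N\<close> \<open>comb E (evec 1 (0, 0)) \<noteq> \<zero>\<^bsub>M\<^esub>\<close> have im: "comb E ` carrier ?N = carrier M" by blast
  define h where "h = inv_into (carrier ?N) (comb E)"
  have bij: "bij_betw h (carrier M) (carrier ?N)"
    unfolding h_def using inj im by (intro bij_betw_inv_into) (simp add: bij_betw_def)
  have h_comb: "h (comb E v) = v" if "v \<in> carrier ?N" for v using inv_into_f_f[OF inj that] by (simp add: h_def)
  have comb_h: "comb E (h x) = x" "h x \<in> carrier ?N" if "x \<in> carrier M" for x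
    using that im by (simp_all add: h_def f_inv_into_f inv_into_into)
  show ?thesis
    unfolding right_module_iso_def
  proof (intro exI[of _ h] conjI ballI bij)
    fix x y assume "x \<in> carrier M" "y \<in> carrier M"
    then show "h (x \<oplus>\<^bsub>M\<^esub> y) = h x \<oplus>\<^bsub>?N\<^esub> h y"
      using h_comb[of "h x \<oplus>\<^bsub>?N\<^esub> h y"] comb_h by (simp add: add)
  next
    fix r x assume r: "r \<in> carrier (Mat2 q)" and x: "x \<in> carrier M"
    then show "h (r \<odot>\<^bsub>M\<^esub> x) = r \<odot>\<^bsub>?N\<^esub> h x"
      using h_comb[OF N.act_closed[OF r comb_h(2)[OF x]]] comb_h(1)[OF x] smult[OF r comb_h(2)[OF x]] by simp
  qed
qed

end

theorem theorem3p4p3: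
  fixes q :: "'k::alg_closed_field" and m :: nat
  assumes "q \<noteq> 0" and "primitive_root_of_unity m q"
  shows
    "(\<forall>\<alpha> \<beta> l\<^sub>1 l\<^sub>2. \<alpha> \<noteq> 0 \<and> \<beta> \<noteq> 0 \<and> l\<^sub>1 \<noteq> 0 \<and> l\<^sub>2 \<noteq> 0 \<longrightarrow>
        simple_right_module (Mat2 q) (N1 m q \<alpha> \<beta> l\<^sub>1 l\<^sub>2)) \<and>
     (\<forall>r \<beta> \<gamma> l\<^sub>2. r \<le> m - 1 \<and> \<beta> \<noteq> 0 \<and> l\<^sub>2 \<noteq> 0 \<longrightarrow>
        simple_right_module (Mat2 q) (N2 m q r \<beta> \<gamma> l\<^sub>2)) \<and>
     (\<forall>M :: ('k free_alg set, 'v) module.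
        simple_right_module (Mat2 q) M \<and>
        torsionfree (Mat2 q) (det_q q) M \<and>
        torsionfree (Mat2 q) (Zgen q Z12 \<otimes>\<^bsub>Mat2 q\<^esub> Zgen q Z21) M \<longrightarrow>
        (\<exists>\<alpha> \<beta> l\<^sub>1 l\<^sub>2. \<alpha> \<noteq> 0 \<and> \<beta> \<noteq> 0 \<and> l\<^sub>1 \<noteq> 0 \<and> l\<^sub>2 \<noteq> 0 \<and>
           right_module_iso (Mat2 q) M (N1 m q \<alpha> \<beta> l\<^sub>1 l\<^sub>2)) \<or>
        (\<exists>r \<beta> \<gamma> l\<^sub>2. r \<le> m - 1 \<and> \<beta> \<noteq> 0 \<and> l\<^sub>2 \<noteq> 0 \<and>
           right_module_iso (Mat2 q) M (N2 m q r \<beta> \<gamma> l\<^sub>2)))"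
proof (intro conjI allI impI)
  note prim = assms(2)
  have m: "m > 0" "q ^ m = 1" using prim by (auto simp: primitive_root_of_unity_def)
  show "simple_right_module (Mat2 q) (N1 m q \<alpha> \<beta> l1 l2)"
    if "\<alpha> \<noteq> 0 \<and> \<beta> \<noteq> 0 \<and> l1 \<noteq> 0 \<and> l2 \<noteq> 0" for \<alpha> \<beta> l1 l2 :: 'k
    using simple_N1[OF prim] that by blast
  show "simple_right_module (Mat2 q) (N2 m q r \<beta> \<gamma> l2)"
    if "r \<le> m - 1 \<and> \<beta> \<noteq> 0 \<and> l2 \<noteq> 0" for r \<beta> \<gamma> l2
    using simple_N2[OF prim] that by blast
  fix M :: "('k free_alg set, 'v) module"
  assume M: "simple_right_module (Mat2 q) M \<and> torsionfree (Mat2 q) (det_q q) M \<and>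
    torsionfree (Mat2 q) (Zgen q Z12 \<otimes>\<^bsub>Mat2 q\<^esub> Zgen q Z21) M"
  interpret mat2_right_module q M m
    using M prim by (simp add: mat2_right_module_def mat2_right_module_axioms_def simple_right_module_def)
  interpret simple_mat2_rep M scal q m "\<lambda>g. opr (fgen g)"
    using simple_mat2_repI M by blast
  from classification
  show "(\<exists>\<alpha> \<beta> l1 l2. \<alpha> \<noteq> 0 \<and> \<beta> \<noteq> 0 \<and> l1 \<noteq> 0 \<and> l2 \<noteq> 0 \<and> right_module_iso (Mat2 q) M (N1 m q \<alpha> \<beta> l1 l2)) \<or>
      (\<exists>r \<beta> \<gamma> l2. r \<le> m - 1 \<and> \<beta> \<noteq> 0 \<and> l2 \<noteq> 0 \<and> right_module_iso (Mat2 q) M (N2 m q r \<beta> \<gamma> l2))"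
  proof (elim disjE exE conjE)
    fix \<alpha> \<beta> l1 l2 E
    assume nz: "\<alpha> \<noteq> 0" "\<beta> \<noteq> 0" "l1 \<noteq> 0" "l2 \<noteq> 0" and real: "realises (N1_gen m q \<alpha> \<beta> l1 l2) E"
    have "right_module_iso (Mat2 q) M (N1 m q \<alpha> \<beta> l1 l2)"
      unfolding N1_def using M simple_N1[OF prim nz] N1_satisfies_relations[OF m nz(1,2)] real
      by (intro right_module_iso_gen_module) (simp_all add: N1_def)
    with nz show ?thesis by blast
  next
    fix \<beta> \<gamma> l2 E
    assume nz: "\<beta> \<noteq> 0" "l2 \<noteq> 0" and real: "realises (N2_gen m q 0 \<beta> \<gamma> l2) E"
    have "right_module_iso (Mat2 q) M (N2 m q 0 \<beta> \<gamma> l2)"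
      unfolding N2_def using M simple_N2[OF prim nz] N2_satisfies_relations[OF m nz(1)] real
      by (intro right_module_iso_gen_module) (simp_all add: N2_def)
    with nz show ?thesis by blast
  qed
qed

end
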